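(* Let $\eta,\lambda\in\mathbb N^n$, let $1\le k\le n$, and suppose $|\lambda|=|\eta|+1$. Let $S=\{i_1<\cdots<i_s\}=\{i:\eta_i\ne\lambda_i\}$ (nonempty because $|\lambda|\neq|\eta|$). Let $g_{k\eta}^\lambda\in\mathbb Q(\alpha)$ be the coefficients defined by $F_{\varepsilon_k}F_\eta=\sum_\lambda g_{k\eta}^\lambda F_\lambda^*$. Then $g_{k\eta}^\lambda\neq 0$ if and only if all of the following hold: (a) $\lambda=c_S(\eta)$; (b) either $i_s\ge k$, or $\eta_i=\eta_{i_1}+1$ for some $i\ge k$ (with $i\le n$); (c) if $\eta_1=\cdots=\eta_k=\eta_{i_1}$, then $i_1\le k$.
   Context: Throughout $\mathbb N=\{0,1,2,\ldots\}$, $n\ge1$, $\alpha$ is an indeterminate, and polynomials lie in $\mathbb Q(\alpha)[x_1,\ldots,x_n]$. Elements $\gamma=(\gamma_1,\ldots,\gamma_n)\in\mathbb N^n$ are called compositions; $|\gamma|=\sum_i\gamma_i$; $\varepsilon_k$ is the $k$-th standard basis vector. Operator $c_L$: for a nonempty $L=\{j_1<\cdots<j_\ell\}\subseteq\{1,\ldots,n\}$, $c_L(\eta)=\lambda$ is defined by $\lambda_{j_p}=\eta_{j_{p+1}}$ for $p<\ell$, $\lambda_{j_\ell}=\eta_{j_1}+1$, and $\lambda_i=\eta_i$ for $i\notin L$. Nonsymmetric Jack polynomials: put $l'_\gamma(i)=\#\{h<i:\gamma_h\ge\gamma_i\}+\#\{h>i:\gamma_h>\gamma_i\}$ and $\overline\gamma_i=\alpha\gamma_i-l'_\gamma(i)$.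 The Cherednik operators are $\xi_i=\alpha x_i\partial_i+\sum_{j<i}N_{ij}x_j+\sum_{j>i}x_jN_{ij}$, where $N_{ij}=\frac{1-s_{ij}}{x_i-x_j}$, $s_{ij}$ exchanges the variables $x_i$ and $x_j$, and $x_j$ denotes multiplication by $x_j$ (so $N_{ij}x_j$ is $f\mapsto N_{ij}(x_jf)$). The monic nonsymmetric Jack polynomial $E_\gamma$ is the unique polynomial with $\xi_iE_\gamma=\overline\gamma_iE_\gamma$ for all $i$ and coefficient of $x^\gamma$ equal to $1$ (its existence and uniqueness, and the fact that the $E_\gamma$ form a basis, are known). Hooks: the diagram of $\gamma$ is the set of boxes $s=(i,j)$ with $1\le i\le n$, $1\le j\le\gamma_i$. Put $a_\gamma(s)=\gamma_i-j$, $l_\gamma(s)=\#\{h<i:j\le\gamma_h+1\le\gamma_i\}+\#\{h>i:j\le\gamma_h\le\gamma_i\}$, $d_\gamma(s)=\alpha(a_\gamma(s)+1)+l_\gamma(s)+1$, $d'_\gamma(s)=d_\gamma(s)-1$, $d_\gamma=\prod_{s\in\gamma}d_\gamma(s)$, $d'_\gamma=\prod_{s\in\gamma}d'_\gamma(s)$. The integral nonsymmetric Jack polynomial is $F_\gamma=d_\gamma E_\gamma$, and $F_\gamma^*=(d_\gamma d'_\gamma)^{-1}F_\gamma$ (this is the basis dual to $\{F_\gamma\}$ under Sahi's scalar product, for which the $F_\gamma$ are orthogonal with $\langle F_\gamma,F_\gamma\rangle=d_\gamma d'_\gamma$). *)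

theory Defs
  imports
    "HOL-Library.Poly_Mapping"
    "HOL-Computational_Algebra.Polynomial"
    "HOL-Computational_Algebra.Fraction_Field"
    "HOL-Combinatorics.Transposition"
begin

(* Exponent vectors and polynomials are finitely supported functions with indices in nat;
   for fixed n only the indices 1, ..., n may occur (compositions, poly_ring). *)

type_synonym ratfun = "rat poly fract"
type_synonym comp = "nat \<Rightarrow>\<^sub>0 nat"
type_synonym mpol = "comp \<Rightarrow>\<^sub>0 ratfun"

abbreviation part :: "comp \<Rightarrow> nat \<Rightarrow> nat" where
  "part \<gamma> i \<equiv> Poly_Mapping.lookup \<gamma> i"

abbreviation mcoeff :: "mpol \<Rightarrow> comp \<Rightarrow> ratfun" where
  "mcoeff f \<beta> \<equiv> Poly_Mapping.lookup f \<beta>"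

definition \<alpha> :: ratfun where
  "\<alpha> = Fract [:0, 1:] 1"

definition compositions :: "nat \<Rightarrow> comp set" where
  "compositions n = {\<gamma>. Poly_Mapping.keys \<gamma> \<subseteq> {1..n}}"

definition csize :: "nat \<Rightarrow> comp \<Rightarrow> nat" where
  "csize n \<gamma> = (\<Sum>i\<in>{1..n}. part \<gamma> i)"

definition unit_comp :: "nat \<Rightarrow> comp" where
  "unit_comp k = Poly_Mapping.single k 1"

definition poly_ring :: "nat \<Rightarrow> mpol set" where
  "poly_ring n = {f. Poly_Mapping.keys f \<subseteq> compositions n}"

definition mconst :: "ratfun \<Rightarrow> mpol" where
  "mconst c = Poly_Mapping.single 0 c"

definition mvar :: "nat \<Rightarrow> mpol" where
  "mvar i = Poly_Mapping.single (unit_comp i) 1"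

(* The truncated subtraction is harmless: terms with part \<beta> i = 0 have coefficient 0. *)
definition mderiv :: "nat \<Rightarrow> mpol \<Rightarrow> mpol" where
  "mderiv i f = (\<Sum>\<beta>\<in>Poly_Mapping.keys f.
     Poly_Mapping.single (\<beta> - unit_comp i) (of_nat (part \<beta> i) * mcoeff f \<beta>))"

definition swap_exp :: "nat \<Rightarrow> nat \<Rightarrow> comp \<Rightarrow> comp" where
  "swap_exp i j = Poly_Mapping.map_key (Transposition.transpose i j)"

definition swap_vars :: "nat \<Rightarrow> nat \<Rightarrow> mpol \<Rightarrow> mpol" where
  "swap_vars i j = Poly_Mapping.map_key (swap_exp i j)"

(* N_ij = (1 - s_ij) / (x_i - x_j); the lemma divdiff below shows that the quotient exists *)
definition divdiff :: "nat \<Rightarrow> nat \<Rightarrow> mpol \<Rightarrow> mpol" where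
  "divdiff i j f = (THE q. (mvar i - mvar j) * q = f - swap_vars i j f)"

definition cherednik :: "nat \<Rightarrow> nat \<Rightarrow> mpol \<Rightarrow> mpol" where
  "cherednik n i f =
     mconst \<alpha> * (mvar i * mderiv i f)
     + (\<Sum>j\<in>{1..<i}. divdiff i j (mvar j * f))
     + (\<Sum>j\<in>{i<..n}. mvar j * divdiff i j f)"

definition coleg_row :: "nat \<Rightarrow> comp \<Rightarrow> nat \<Rightarrow> nat" where
  "coleg_row n \<gamma> i =
     card {h \<in> {1..<i}. part \<gamma> h \<ge> part \<gamma> i} + card {h \<in> {i<..n}. part \<gamma> h > part \<gamma> i}"

definition spectral :: "nat \<Rightarrow> comp \<Rightarrow> nat \<Rightarrow> ratfun" where
  "spectral n \<gamma> i = \<alpha> * of_nat (part \<gamma> i) - of_nat (coleg_row n \<gamma> i)"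

definition jackE :: "nat \<Rightarrow> comp \<Rightarrow> mpol" where
  "jackE n \<gamma> = (THE E. E \<in> poly_ring n
     \<and> (\<forall>i\<in>{1..n}. cherednik n i E = mconst (spectral n \<gamma> i) * E)
     \<and> mcoeff E \<gamma> = 1)"

definition diagram :: "nat \<Rightarrow> comp \<Rightarrow> (nat \<times> nat) set" where
  "diagram n \<gamma> = (SIGMA i : {1..n}. {1..part \<gamma> i})"

definition arm :: "comp \<Rightarrow> nat \<times> nat \<Rightarrow> nat" where
  "arm \<gamma> s = part \<gamma> (fst s) - snd s"

definition leg :: "nat \<Rightarrow> comp \<Rightarrow> nat \<times> nat \<Rightarrow> nat" where
  "leg n \<gamma> s = (case s of (i, j) \<Rightarrow>
     card {h \<in> {1..<i}. j \<le> part \<gamma> h + 1 \<and> part \<gamma> h + 1 \<le> part \<gamma> i}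
     + card {h \<in> {i<..n}. j \<le> part \<gamma> h \<and> part \<gamma> h \<le> part \<gamma> i})"

definition hook :: "nat \<Rightarrow> comp \<Rightarrow> nat \<times> nat \<Rightarrow> ratfun" where
  "hook n \<gamma> s = \<alpha> * (of_nat (arm \<gamma> s) + 1) + of_nat (leg n \<gamma> s) + 1"

definition hook' :: "nat \<Rightarrow> comp \<Rightarrow> nat \<times> nat \<Rightarrow> ratfun" where
  "hook' n \<gamma> s = hook n \<gamma> s - 1"

definition hook_prod :: "nat \<Rightarrow> comp \<Rightarrow> ratfun" where
  "hook_prod n \<gamma> = (\<Prod>s\<in>diagram n \<gamma>. hook n \<gamma> s)"

definition hook'_prod :: "nat \<Rightarrow> comp \<Rightarrow> ratfun" where
  "hook'_prod n \<gamma> = (\<Prod>s\<in>diagram n \<gamma>. hook' n \<gamma> s)"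

definition jackF :: "nat \<Rightarrow> comp \<Rightarrow> mpol" where
  "jackF n \<gamma> = mconst (hook_prod n \<gamma>) * jackE n \<gamma>"

definition jackF_dual :: "nat \<Rightarrow> comp \<Rightarrow> mpol" where
  "jackF_dual n \<gamma> = mconst (inverse (hook_prod n \<gamma> * hook'_prod n \<gamma>)) * jackF n \<gamma>"

(* The coefficients g_{k eta}^mu of the expansion in the basis (jackF_dual n \<mu>),
   as a finitely supported function of mu. *)
definition pieri_coeffs :: "nat \<Rightarrow> nat \<Rightarrow> comp \<Rightarrow> (comp \<Rightarrow>\<^sub>0 ratfun)" where
  "pieri_coeffs n k \<eta> = (THE g. Poly_Mapping.keys g \<subseteq> compositions n
     \<and> jackF n (unit_comp k) * jackF n \<eta>
         = (\<Sum>\<mu>\<in>Poly_Mapping.keys g. mconst (Poly_Mapping.lookup g \<mu>) * jackF_dual n \<mu>))"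

definition pieri_coeff :: "nat \<Rightarrow> nat \<Rightarrow> comp \<Rightarrow> comp \<Rightarrow> ratfun" where
  "pieri_coeff n k \<eta> \<mu> = Poly_Mapping.lookup (pieri_coeffs n k \<eta>) \<mu>"

(* For j_p in L with p < l, the next element j_{p+1} is Min {m \<in> L. j_p < m}. *)
definition cycle_op :: "nat set \<Rightarrow> comp \<Rightarrow> comp" where
  "cycle_op L \<eta> = Abs_poly_mapping (\<lambda>i.
     if i \<notin> L then part \<eta> i
     else if i = Max L then part \<eta> (Min L) + 1
     else part \<eta> (Min {m \<in> L. i < m}))"

lemma part_cycle_op:
  assumes "finite L"
  shows "part (cycle_op L \<eta>) i =
    (if i \<notin> L then part \<eta> i
     else if i = Max L then part \<eta> (Min L) + 1
     else part \<eta> (Min {m \<in> L. i < m}))"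
proof -
  have "finite {i. (if i \<notin> L then part \<eta> i
     else if i = Max L then part \<eta> (Min L) + 1
     else part \<eta> (Min {m \<in> L. i < m})) \<noteq> 0}"
    by (rule finite_subset[of _ "L \<union> Poly_Mapping.keys \<eta>"])
       (use assms in \<open>auto simp: in_keys_iff split: if_splits\<close>)
  then show ?thesis
    unfolding cycle_op_def by (subst lookup_Abs_poly_mapping) auto
qed

lemma part_swap_exp: "part (swap_exp i j \<beta>) h = part \<beta> (Transposition.transpose i j h)"
  unfolding swap_exp_def by (subst map_key.rep_eq) auto

lemma swap_exp_swap_exp [simp]: "swap_exp i j (swap_exp i j \<beta>) = \<beta>"
  by (rule poly_mapping_eqI) (simp add: part_swap_exp)

lemma inj_swap_exp: "inj (swap_exp i j)"
  by (metis injI swap_exp_swap_exp)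

lemma mcoeff_swap_vars: "mcoeff (swap_vars i j f) \<beta> = mcoeff f (swap_exp i j \<beta>)"
  unfolding swap_vars_def by (subst map_key.rep_eq) (auto simp: inj_swap_exp)

lemma swap_vars_add: "swap_vars i j (f + g) = swap_vars i j f + swap_vars i j g"
  by (rule poly_mapping_eqI) (simp add: mcoeff_swap_vars lookup_add)

lemma swap_vars_single:
  "swap_vars i j (Poly_Mapping.single \<beta> c) = Poly_Mapping.single (swap_exp i j \<beta>) c"
  by (rule poly_mapping_eqI) (auto simp: mcoeff_swap_vars lookup_single when_def)

lemma mvar_power: "mvar i ^ a = Poly_Mapping.single (Poly_Mapping.single i a) 1"
proof (induction a)
  case (Suc a)
  then show ?case
    by (simp add: mvar_def unit_comp_def mult_single flip: single_add)
qed simp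

lemma mvar_diff_dvd_monomial:
  assumes "i \<noteq> j"
  shows "mvar i - mvar j dvd Poly_Mapping.single \<beta> c - swap_vars i j (Poly_Mapping.single \<beta> c)"
proof -
  define a b where "a = part \<beta> i" and "b = part \<beta> j"
  define r where "r = Poly_Mapping.update i 0 (Poly_Mapping.update j 0 \<beta>)"
  have 1: "\<beta> = r + Poly_Mapping.single i a + Poly_Mapping.single j b"
    using assms by (intro poly_mapping_eqI)
      (auto simp: lookup_add lookup_single lookup_update when_def a_def b_def r_def)
  have 2: "swap_exp i j \<beta> = r + Poly_Mapping.single i b + Poly_Mapping.single j a"
    using assms by (intro poly_mapping_eqI)
      (auto simp: lookup_add lookup_single lookup_update when_def a_def b_def r_def
        part_swap_exp transpose_def)
  have *: "mvar i - mvar j dvd mvar i ^ p * mvar j ^ q - mvar i ^ q * mvar j ^ p" if "q \<le> p" for p q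
  proof -
    obtain d where d: "p = q + d" using \<open>q \<le> p\<close> le_Suc_ex by blast
    have "mvar i ^ p * mvar j ^ q - mvar i ^ q * mvar j ^ p
        = mvar i ^ q * mvar j ^ q * (mvar i ^ d - mvar j ^ d)"
      by (simp add: d power_add algebra_simps)
    moreover have "mvar i - mvar j dvd mvar i ^ d - mvar j ^ d"
      by (metis dvd_triv_left power_diff_sumr2)
    ultimately show ?thesis by simp
  qed
  have "mvar i - mvar j dvd mvar i ^ a * mvar j ^ b - mvar i ^ b * mvar j ^ a"
  proof (cases "b \<le> a")
    case False
    then have "mvar i - mvar j dvd - (mvar i ^ b * mvar j ^ a - mvar i ^ a * mvar j ^ b)"
      using *[of a b] by (metis dvd_minus_iff nat_le_linear)
    then show ?thesis by simp
  qed (use * in blast)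
  moreover have "Poly_Mapping.single \<beta> c - swap_vars i j (Poly_Mapping.single \<beta> c)
      = Poly_Mapping.single r c * (mvar i ^ a * mvar j ^ b - mvar i ^ b * mvar j ^ a)"
    unfolding swap_vars_single 2 by (subst 1)
      (simp add: mvar_power mult_single right_diff_distrib add.assoc)
  ultimately show ?thesis by simp
qed

lemma mvar_diff_dvd:
  assumes "i \<noteq> j"
  shows "mvar i - mvar j dvd f - swap_vars i j f"
proof (induction f rule: update_induct)
  case const
  show ?case by (simp add: swap_vars_def map_key_zero[OF inj_swap_exp])
next
  case (update f \<beta> c)
  have eq: "Poly_Mapping.update \<beta> c f = f + Poly_Mapping.single \<beta> c"
    using update(1) by (intro poly_mapping_eqI)
      (auto simp: lookup_update lookup_add lookup_single when_def in_keys_iff)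
  have "mvar i - mvar j dvd (f - swap_vars i j f)
      + (Poly_Mapping.single \<beta> c - swap_vars i j (Poly_Mapping.single \<beta> c))"
    using update.IH mvar_diff_dvd_monomial[OF assms] by (rule dvd_add)
  then show ?case by (simp add: eq swap_vars_add algebra_simps)
qed

lemma mvar_diff_nonzero:
  assumes "i \<noteq> j"
  shows "mvar i - mvar j \<noteq> 0"
proof
  assume "mvar i - mvar j = 0"
  then have "mcoeff (mvar i) (unit_comp i) = mcoeff (mvar j) (unit_comp i)" by simp
  moreover have "unit_comp j \<noteq> unit_comp i"
    using assms by (metis lookup_single_eq lookup_single_not_eq unit_comp_def zero_neq_one)
  ultimately show False by (simp add: mvar_def lookup_single)
qed

lemma divdiff:
  assumes "i \<noteq> j"
  shows "(mvar i - mvar j) * divdiff i j f = f - swap_vars i j f"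
proof -
  obtain q where q: "f - swap_vars i j f = (mvar i - mvar j) * q"
    using mvar_diff_dvd[OF assms] by (auto elim: dvdE)
  show ?thesis
    unfolding divdiff_def
  proof (rule theI)
    show "(mvar i - mvar j) * q = f - swap_vars i j f" using q by simp
    show "q' = q" if "(mvar i - mvar j) * q' = f - swap_vars i j f" for q'
      using that q mvar_diff_nonzero[OF assms] by simp
  qed
qed

end

(* The commutator of the Cherednik operator xi_k with multiplication by e_1 = x_1 + ... + x_n is
   alpha x_k. So if c is the coefficient of E_mu in e_1 E_eta, the coefficient of E_mu in x_k E_eta
   is c (mu'_k - eta'_k) / alpha, where ' denotes eigenvalues. As F_{eps_k} is a scalar multiple of
   (alpha + k) x_k + x_{k+1} + ... + x_n, the coefficient g is nonzero iff c is nonzero and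
     (alpha + k) (mu'_k - eta'_k) + sum_{j > k} (mu'_j - eta'_j)
   is nonzero. For mu = c_L(eta) the coefficients of this quadratic polynomial in alpha can be
   computed, because the entries at positions up to k change by a single replacement.

   To find c, write x_n = Phi s_1 ... s_{n-1} with the raising operator Phi. Each s_i maps E_gamma
   to a combination of E_gamma and E_{s_i gamma} with nonzero coefficients, and the composition that
   is finally reached determines the path. So E_mu occurs in x_n E_eta iff mu = c_L(eta) with n in
   L. Phi commutes with e_1 and rotates the positions, which carries n to any other position.

   That the E_gamma exist and form a basis is shown by building eigenfunctions with Phi and s_i.
   Their coefficients agree with those of x^gamma at alpha = infinity, and they span by
   dimension. *)
theory Submission
  imports Defs
begin

section \<open>Polynomials and permutations of variables\<close>

text \<open>All nonvanishing is decided by \<alpha>. If \<gamma>_i and \<gamma>_(i+1) differ, so do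
  the \<alpha>-coefficients of the eigenvalues at i and i+1, and the inverse of the difference of
  these eigenvalues vanishes at \<alpha> = \<infinity>. This keeps the coefficient of x^\<gamma>
  alive through the construction, in place of the usual triangularity in an order on compositions.
  It also prevents s_i from sending E_\<gamma> to a multiple of itself: the factor would be that
  inverse, and its square is not 1. If the two entries agree, s_i fixes E_\<gamma>, and the path
  does not branch. Multiplication by x_k reveals c only where the eigenvalues of \<eta> and \<mu> at
  k differ. This suffices, because any position at which two compositions differ separates their
  eigenvalues. The set L found there is not determined by \<mu>; positions that c_L leaves unchanged
  can be removed one by one, which ends in the set S of the theorem.\<close>

lemma mpol_induct [case_names zero add]:
  fixes f :: mpol
  assumes "P 0" "\<And>f \<beta> c. P f \<Longrightarrow> P (f + Poly_Mapping.single \<beta> c)"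
  shows "P f"
proof (induction f rule: update_induct)
  case (update f \<beta> c)
  have "Poly_Mapping.update \<beta> c f = f + Poly_Mapping.single \<beta> c"
    using update(1) by (intro poly_mapping_eqI)
      (auto simp: lookup_update lookup_add lookup_single when_def in_keys_iff)
  then show ?case using assms(2) update.IH by simp
qed (rule assms(1))

lemma mcoeff_single_times_add:
  "mcoeff (Poly_Mapping.single \<beta> c * f) (\<beta> + \<gamma>) = c * mcoeff f \<gamma>"
  by (induction f rule: mpol_induct)
    (auto simp: lookup_add lookup_single when_def distrib_left mult_single)

lemma mcoeff_single_times_eq_0:
  assumes "\<And>\<gamma>. \<delta> \<noteq> \<beta> + \<gamma>"
  shows "mcoeff (Poly_Mapping.single \<beta> c * f) \<delta> = 0"
  using assms by (induction f rule: mpol_induct)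
    (auto simp: lookup_add lookup_single when_def distrib_left mult_single)

lemma mcoeff_mconst_times: "mcoeff (mconst c * f) \<beta> = c * mcoeff f \<beta>"
  using mcoeff_single_times_add[of 0 c f \<beta>] by (simp add: mconst_def)

lemma mconst_0 [simp]: "mconst 0 = 0"
  by (simp add: mconst_def)

lemma mconst_1 [simp]: "mconst 1 = 1"
  by (simp add: mconst_def)

lemma mconst_mult: "mconst (c * d) = mconst c * mconst d"
  by (simp add: mconst_def mult_single)

lemma mconst_add: "mconst (c + d) = mconst c + mconst d"
  by (simp add: mconst_def single_add)

lemma mconst_diff: "mconst (c - d) = mconst c - mconst d"
  by (simp add: mconst_def single_diff)

lemma mconst_minus: "mconst (- c) = - mconst c"
  by (simp add: mconst_def single_uminus)

lemma mconst_of_nat: "mconst (of_nat m) = of_nat m"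
  by (simp add: mconst_def)

lemma mconst_eq_0_iff [simp]: "mconst c = 0 \<longleftrightarrow> c = 0"
  by (metis mconst_0 mconst_def lookup_single_eq lookup_zero)

lemma part_unit_comp: "part (unit_comp i) j = (if i = j then 1 else 0)"
  by (simp add: unit_comp_def lookup_single when_def)

lemma unit_comp_inject [simp]: "unit_comp i = unit_comp j \<longleftrightarrow> i = j"
  by (metis part_unit_comp zero_neq_one)

lemma comp_minus_plus_unit: "part \<beta> i \<noteq> 0 \<Longrightarrow> unit_comp i + (\<beta> - unit_comp i) = \<beta>"
  by (rule poly_mapping_eqI) (auto simp: lookup_add lookup_minus part_unit_comp)

lemma mcoeff_mvar_times:
  "mcoeff (mvar i * f) \<beta> = (if part \<beta> i = 0 then 0 else mcoeff f (\<beta> - unit_comp i))"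
proof (cases "part \<beta> i = 0")
  case True
  then have "\<beta> \<noteq> unit_comp i + \<gamma>" for \<gamma>
    by (metis add_is_0 lookup_add part_unit_comp zero_neq_one)
  then show ?thesis using True by (simp add: mvar_def mcoeff_single_times_eq_0)
next
  case False
  then show ?thesis
    using mcoeff_single_times_add[of "unit_comp i" 1 f "\<beta> - unit_comp i"]
    by (simp add: mvar_def comp_minus_plus_unit)
qed

lemma mcoeff_mvar_times_add: "mcoeff (mvar i * f) (\<beta> + unit_comp i) = mcoeff f \<beta>"
  by (simp add: mcoeff_mvar_times lookup_add part_unit_comp)

text \<open>Diagonal on monomials, so the truncated subtraction of \<open>mderiv\<close> disappears
  from all later arguments.\<close>

definition euler :: "nat \<Rightarrow> mpol \<Rightarrow> mpol" where
  "euler i f = mvar i * mderiv i f"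

lemma mcoeff_euler: "mcoeff (euler i f) \<beta> = of_nat (part \<beta> i) * mcoeff f \<beta>"
proof -
  have "euler i f = (\<Sum>\<beta>\<in>Poly_Mapping.keys f.
      Poly_Mapping.single (unit_comp i + (\<beta> - unit_comp i)) (of_nat (part \<beta> i) * mcoeff f \<beta>))"
    by (simp add: euler_def mderiv_def sum_distrib_left mvar_def mult_single)
  also have "\<dots> = (\<Sum>\<beta>\<in>Poly_Mapping.keys f.
      Poly_Mapping.single \<beta> (of_nat (part \<beta> i) * mcoeff f \<beta>))"
  proof (intro sum.cong refl)
    fix \<beta>
    show "Poly_Mapping.single (unit_comp i + (\<beta> - unit_comp i)) (of_nat (part \<beta> i) * mcoeff f \<beta>) =
      Poly_Mapping.single \<beta> (of_nat (part \<beta> i) * mcoeff f \<beta>)"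
      by (cases "part \<beta> i = 0") (auto simp: comp_minus_plus_unit)
  qed
  finally show ?thesis
    by (simp add: lookup_sum lookup_single when_def sum.delta' in_keys_iff)
qed

lemma euler_add: "euler i (f + g) = euler i f + euler i g"
  by (rule poly_mapping_eqI) (simp add: mcoeff_euler lookup_add algebra_simps)

lemma euler_mconst: "euler i (mconst c * f) = mconst c * euler i f"
  by (rule poly_mapping_eqI) (simp add: mcoeff_euler mcoeff_mconst_times mult.left_commute)

lemma euler_mvar_times:
  "euler i (mvar j * f) = mvar j * euler i f + (if i = j then mvar j * f else 0)"
  by (rule poly_mapping_eqI)
    (auto simp: mcoeff_euler mcoeff_mvar_times lookup_add lookup_minus part_unit_comp
      left_diff_distrib of_nat_diff)

text \<open>For bijective \<open>w\<close>, the substitution of the variable with index \<open>w i\<close> for the one with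
  index \<open>i\<close>.\<close>

definition act :: "(nat \<Rightarrow> nat) \<Rightarrow> mpol \<Rightarrow> mpol" where
  "act w = Poly_Mapping.map_key (Poly_Mapping.map_key w)"

abbreviation pcomp :: "comp \<Rightarrow> (nat \<Rightarrow> nat) \<Rightarrow> comp" where
  "pcomp \<beta> w \<equiv> Poly_Mapping.map_key w \<beta>"

lemma part_pcomp: "bij w \<Longrightarrow> part (pcomp \<beta> w) i = part \<beta> (w i)"
  by (subst map_key.rep_eq) (auto simp: bij_is_inj)

lemma pcomp_pcomp: "bij w \<Longrightarrow> bij v \<Longrightarrow> pcomp (pcomp \<beta> w) v = pcomp \<beta> (w \<circ> v)"
  by (rule poly_mapping_eqI) (simp add: part_pcomp bij_comp)

lemma pcomp_id [simp]: "pcomp \<beta> id = \<beta>"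
  by (rule poly_mapping_eqI) (simp add: part_pcomp)

lemma pcomp_inv [simp]:
  assumes "bij w"
  shows "pcomp (pcomp \<beta> w) (inv w) = \<beta>" "pcomp (pcomp \<beta> (inv w)) w = \<beta>"
proof -
  have w: "w \<circ> inv w = id" "inv w \<circ> w = id"
    using assms by (auto simp: fun_eq_iff bij_is_surj surj_f_inv_f bij_is_inj)
  show "pcomp (pcomp \<beta> w) (inv w) = \<beta>" "pcomp (pcomp \<beta> (inv w)) w = \<beta>"
    using assms by (simp_all add: pcomp_pcomp bij_imp_bij_inv w)
qed

lemma inj_pcomp: "bij w \<Longrightarrow> inj (\<lambda>\<beta>. pcomp \<beta> w)"
  by (metis injI pcomp_inv(1))

text \<open>A monomial with exponent \<gamma> goes to the one with exponent
  \<open>pcomp \<gamma> (inv w)\<close>, hence coefficients are pulled back along w itself. This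
  makes \<open>act\<close> a left action although \<open>pcomp\<close> is a right action.\<close>

lemma mcoeff_act: "bij w \<Longrightarrow> mcoeff (act w f) \<beta> = mcoeff f (pcomp \<beta> w)"
  unfolding act_def by (subst map_key.rep_eq) (auto simp: inj_pcomp)

lemma act_add: "bij w \<Longrightarrow> act w (f + g) = act w f + act w g"
  by (rule poly_mapping_eqI) (simp add: mcoeff_act lookup_add)

lemma act_diff: "bij w \<Longrightarrow> act w (f - g) = act w f - act w g"
  by (rule poly_mapping_eqI) (simp add: mcoeff_act lookup_minus)

lemma act_0 [simp]: "bij w \<Longrightarrow> act w 0 = 0"
  by (rule poly_mapping_eqI) (simp add: mcoeff_act)

lemma act_sum: "bij w \<Longrightarrow> act w (\<Sum>i\<in>I. f i) = (\<Sum>i\<in>I. act w (f i))"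
  by (induction I rule: infinite_finite_induct) (auto simp: act_add)

lemma act_single:
  "bij w \<Longrightarrow> act w (Poly_Mapping.single \<beta> c) = Poly_Mapping.single (pcomp \<beta> (inv w)) c"
  by (rule poly_mapping_eqI)
    (use pcomp_inv in \<open>fastforce simp: mcoeff_act lookup_single when_def\<close>)

lemma pcomp_add: "bij w \<Longrightarrow> pcomp (\<beta> + \<gamma>) w = pcomp \<beta> w + pcomp \<gamma> w"
  by (rule poly_mapping_eqI) (simp add: part_pcomp lookup_add)

lemma act_mult:
  assumes "bij w"
  shows "act w (f * g) = act w f * act w g"
proof (induction f rule: mpol_induct)
  case (add f \<beta> c)
  have "act w (Poly_Mapping.single \<beta> c * g) = act w (Poly_Mapping.single \<beta> c) * act w g"
    by (induction g rule: mpol_induct)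
      (simp_all add: assms distrib_left act_add mult_single act_single pcomp_add bij_imp_bij_inv)
  with add show ?case
    by (simp add: distrib_right act_add assms)
qed (simp add: assms)

lemma act_act: "bij w \<Longrightarrow> bij v \<Longrightarrow> act w (act v f) = act (w \<circ> v) f"
  by (rule poly_mapping_eqI) (simp add: mcoeff_act pcomp_pcomp bij_comp)

lemma act_id [simp]: "act id f = f"
  by (rule poly_mapping_eqI) (simp add: mcoeff_act)

lemma pcomp_0 [simp]: "bij w \<Longrightarrow> pcomp 0 w = 0"
  by (rule poly_mapping_eqI) (simp add: part_pcomp)

lemma act_mconst [simp]: "bij w \<Longrightarrow> act w (mconst c) = mconst c"
  by (simp add: mconst_def act_single bij_imp_bij_inv)

lemma act_mconst_times: "bij w \<Longrightarrow> act w (mconst c * f) = mconst c * act w f"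
  by (simp add: act_mult)

lemma pcomp_unit_comp_inv:
  assumes "bij w"
  shows "pcomp (unit_comp i) (inv w) = unit_comp (w i)"
  by (rule poly_mapping_eqI)
    (use assms in \<open>auto simp: part_pcomp bij_imp_bij_inv part_unit_comp bij_is_surj surj_f_inv_f bij_is_inj\<close>)

lemma act_mvar: "bij w \<Longrightarrow> act w (mvar i) = mvar (w i)"
  by (simp add: mvar_def act_single pcomp_unit_comp_inv)

lemma bij_transpose [simp]: "bij (Transposition.transpose i j)"
  by (rule involuntory_imp_bij) simp

lemma swap_vars_act: "swap_vars i j = act (Transposition.transpose i j)"
  by (simp add: swap_vars_def swap_exp_def act_def)

lemma act_transpose_transpose [simp]:
  "act (Transposition.transpose i j) (act (Transposition.transpose i j) f) = f"
  by (simp add: act_act)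

lemma act_euler:
  assumes "bij w"
  shows "act w (euler i f) = euler (w i) (act w f)"
  by (rule poly_mapping_eqI) (simp add: mcoeff_act mcoeff_euler assms part_pcomp)

text \<open>The factor x_i - x_j can be cancelled, so a divided difference is identified by its
  defining equation. The further rules for \<open>divdiff\<close> rest on this.\<close>

lemma divdiff_eqI:
  assumes "i \<noteq> j" "(mvar i - mvar j) * q = f - act (Transposition.transpose i j) f"
  shows "divdiff i j f = q"
  using divdiff[OF assms(1), of f] assms mvar_diff_nonzero[OF assms(1)]
  by (metis mult_left_cancel swap_vars_act)

lemma divdiff': "i \<noteq> j \<Longrightarrow>
    (mvar i - mvar j) * divdiff i j f = f - act (Transposition.transpose i j) f"
  using divdiff[of i j f] by (simp add: swap_vars_act)

lemma divdiff_add: "i \<noteq> j \<Longrightarrow> divdiff i j (f + g) = divdiff i j f + divdiff i j g"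
  by (rule divdiff_eqI) (simp_all add: distrib_left divdiff' act_add)

lemma divdiff_mult_invariant:
  "i \<noteq> j \<Longrightarrow> act (Transposition.transpose i j) g = g \<Longrightarrow> divdiff i j (g * f) = g * divdiff i j f"
  by (rule divdiff_eqI) (simp_all add: mult.left_commute[of _ g] divdiff' act_mult right_diff_distrib)

lemma divdiff_mconst: "i \<noteq> j \<Longrightarrow> divdiff i j (mconst c * f) = mconst c * divdiff i j f"
  by (simp add: divdiff_mult_invariant)

lemma transpose_conj:
  "bij w \<Longrightarrow> Transposition.transpose (w i) (w j) \<circ> w = w \<circ> Transposition.transpose i j"
  by (auto simp: fun_eq_iff transpose_def bij_is_inj inj_eq)

lemma act_divdiff:
  assumes "bij w" "i \<noteq> j"
  shows "act w (divdiff i j f) = divdiff (w i) (w j) (act w f)"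
proof (rule divdiff_eqI[symmetric])
  show ne: "w i \<noteq> w j" using assms by (simp add: bij_is_inj inj_eq)
  have "(mvar (w i) - mvar (w j)) * act w (divdiff i j f)
      = act w ((mvar i - mvar j) * divdiff i j f)"
    by (simp add: assms act_mult act_diff act_mvar)
  also have "\<dots> = act w f - act w (act (Transposition.transpose i j) f)"
    by (simp add: assms divdiff' act_diff)
  also have "act w (act (Transposition.transpose i j) f)
      = act (Transposition.transpose (w i) (w j)) (act w f)"
    by (simp add: act_act assms transpose_conj)
  finally show "(mvar (w i) - mvar (w j)) * act w (divdiff i j f)
      = act w f - act (Transposition.transpose (w i) (w j)) (act w f)" .
qed

section \<open>Commutation relations of the Cherednik operators\<close>

lemma cherednik_euler:
  "cherednik n i f = mconst \<alpha> * euler i f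
     + (\<Sum>j\<in>{1..<i}. divdiff i j (mvar j * f)) + (\<Sum>j\<in>{i<..n}. mvar j * divdiff i j f)"
  by (simp add: cherednik_def euler_def)

lemma cherednik_add: "cherednik n i (f + g) = cherednik n i f + cherednik n i g"
  by (simp add: cherednik_euler euler_add distrib_left divdiff_add sum.distrib)

lemma cherednik_mconst: "cherednik n i (mconst c * f) = mconst c * cherednik n i f"
  by (simp add: cherednik_euler euler_mconst distrib_left divdiff_mconst sum_distrib_left
      mult.left_commute[of _ "mconst c"])

lemma cherednik_minus: "cherednik n i (- f) = - cherednik n i f"
  using cherednik_mconst[of n i "-1" f] by (simp add: mconst_minus)

lemma cherednik_diff: "cherednik n i (f - g) = cherednik n i f - cherednik n i g"
  using cherednik_add[of n i f "- g"] by (simp add: cherednik_minus)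

lemma cherednik_0 [simp]: "cherednik n i 0 = 0"
  using cherednik_mconst[of n i 0 0] by simp

definition e1 :: "nat \<Rightarrow> mpol" where
  "e1 n = (\<Sum>j\<in>{1..n}. mvar j)"

lemma act_e1:
  assumes "bij w" "w ` {1..n} = {1..n}"
  shows "act w (e1 n) = e1 n"
proof -
  have "act w (e1 n) = (\<Sum>j\<in>{1..n}. mvar (w j))"
    by (simp add: e1_def act_sum assms act_mvar)
  also have "\<dots> = (\<Sum>j\<in>w ` {1..n}. mvar j)"
    using assms(1) by (subst sum.reindex) (auto intro: inj_on_subset bij_is_inj)
  finally show ?thesis by (simp only: assms e1_def)
qed

lemma transpose_image: "i \<in> A \<Longrightarrow> j \<in> A \<Longrightarrow> Transposition.transpose i j ` A = A"
  by (auto simp: transpose_def image_iff)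

lemma euler_e1_times:
  assumes "i \<in> {1..n}"
  shows "euler i (e1 n * f) = e1 n * euler i f + mvar i * f"
proof -
  have "euler i (e1 n * f) = (\<Sum>j\<in>{1..n}. euler i (mvar j * f))"
    unfolding e1_def sum_distrib_right
    by (rule poly_mapping_eqI) (simp add: mcoeff_euler lookup_sum sum_distrib_left)
  also have "\<dots> = e1 n * euler i f + mvar i * f"
    using assms by (simp add: euler_mvar_times sum.distrib e1_def sum_distrib_right)
  finally show ?thesis .
qed

text \<open>Divided differences are linear over symmetric polynomials, so only the derivation in
  \<xi>_i fails to commute with e_1; it contributes x_i times the derivative 1 of e_1.\<close>

lemma cherednik_e1_times:
  assumes "i \<in> {1..n}"
  shows "cherednik n i (e1 n * f) = e1 n * cherednik n i f + mconst \<alpha> * (mvar i * f)"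
proof -
  have "divdiff i j (e1 n * g) = e1 n * divdiff i j g" if "j \<in> {1..n}" "i \<noteq> j" for j g
    using that assms by (intro divdiff_mult_invariant act_e1 transpose_image bij_transpose)
  then have "(\<Sum>j\<in>{1..<i}. divdiff i j (mvar j * (e1 n * f)))
        = (\<Sum>j\<in>{1..<i}. e1 n * divdiff i j (mvar j * f))"
    "(\<Sum>j\<in>{i<..n}. mvar j * divdiff i j (e1 n * f))
        = (\<Sum>j\<in>{i<..n}. e1 n * (mvar j * divdiff i j f))"
    using assms by (auto intro!: sum.cong simp: mult.left_commute[of _ "e1 n"])
  then show ?thesis
    using assms by (simp add: cherednik_euler euler_e1_times distrib_left sum_distrib_left
        mult.left_commute[of _ "e1 n"])
qed

text \<open>The index ranges are transported as images because w need not respect the order of the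
  indices. Comparing these images with the ranges of another operator yields the relations
  below.\<close>

lemma act_cherednik:
  assumes "bij w"
  shows "act w (cherednik n i f) = mconst \<alpha> * euler (w i) (act w f)
     + (\<Sum>j\<in>w ` {1..<i}. divdiff (w i) j (mvar j * act w f))
     + (\<Sum>j\<in>w ` {i<..n}. mvar j * divdiff (w i) j (act w f))"
proof -
  have inj: "inj_on w A" for A
    using assms by (meson bij_is_inj inj_on_subset subset_UNIV)
  show ?thesis
    by (simp add: cherednik_euler act_add assms act_mult act_euler act_sum act_divdiff act_mvar
        sum.reindex[OF inj])
qed

abbreviation adj :: "nat \<Rightarrow> nat \<Rightarrow> nat" where
  "adj i \<equiv> Transposition.transpose i (Suc i)"

lemma act_adj_cherednik_other:
  assumes "1 \<le> i" "i < n" "j \<noteq> i" "j \<noteq> Suc i"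
  shows "act (adj i) (cherednik n j f) = cherednik n j (act (adj i) f)"
proof -
  have "adj i ` {1..<j} = {1..<j}" "adj i ` {j<..n} = {j<..n}"
    using assms by (cases "i < j"; auto intro!: transpose_image)+
  moreover have "adj i j = j" using assms by simp
  ultimately show ?thesis
    by (simp only: act_cherednik bij_transpose) (simp add: cherednik_euler)
qed

text \<open>A relation of the degenerate affine Hecke algebra. After conjugation all terms of
  \<xi>_(i+1) are in place except the one for index i, where x_i stands outside the divided
  difference instead of inside; the two forms differ by f.\<close>

lemma act_adj_cherednik:
  assumes "1 \<le> i" "i < n"
  shows "act (adj i) (cherednik n i f) = cherednik n (Suc i) (act (adj i) f) + f"
proof -
  let ?g = "act (adj i) f"
  have im: "adj i ` {1..<i} = {1..<i}" "adj i ` {i<..n} = insert i {Suc i<..n}"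
    using assms by (auto simp: transpose_def image_iff)
  have lt: "{1..<Suc i} = insert i {1..<i}" using assms by auto
  have "mvar i * divdiff (Suc i) i ?g = divdiff (Suc i) i (mvar i * ?g) + f"
  proof -
    have sw: "Transposition.transpose (Suc i) i = adj i" by (simp add: transpose_commute)
    have "divdiff (Suc i) i (mvar i * ?g) = mvar i * divdiff (Suc i) i ?g - f"
    proof (rule divdiff_eqI)
      have "(mvar (Suc i) - mvar i) * (mvar i * divdiff (Suc i) i ?g - f)
        = mvar i * (?g - f) - (mvar (Suc i) - mvar i) * f"
        unfolding right_diff_distrib mult.left_commute[of _ "mvar i"]
        by (subst divdiff') (simp_all add: sw right_diff_distrib)
      then show "(mvar (Suc i) - mvar i) * (mvar i * divdiff (Suc i) i ?g - f) =
        mvar i * ?g - act (Transposition.transpose (Suc i) i) (mvar i * ?g)"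
        by (simp add: sw act_mult act_mvar left_diff_distrib)
          (simp add: right_diff_distrib)
    qed simp
    then show ?thesis by simp
  qed
  moreover have "act (adj i) (cherednik n i f) = mconst \<alpha> * euler (Suc i) ?g
     + (\<Sum>j\<in>{1..<i}. divdiff (Suc i) j (mvar j * ?g))
     + (\<Sum>j\<in>insert i {Suc i<..n}. mvar j * divdiff (Suc i) j ?g)"
    by (subst act_cherednik) (simp_all only: bij_transpose im transpose_apply_first)
  moreover have "finite {Suc i<..n}" "i \<notin> {Suc i<..n}" "finite {1..<i}" "i \<notin> {1..<i}" by auto
  ultimately show ?thesis
    by (simp only: cherednik_euler lt sum.insert) (simp add: add_ac)
qed

lemma act_adj_cherednik_Suc:
  assumes "1 \<le> i" "i < n"
  shows "act (adj i) (cherednik n (Suc i) f) = cherednik n i (act (adj i) f) - f"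
proof -
  have "act (adj i) (act (adj i) (cherednik n i (act (adj i) f)))
      = act (adj i) (cherednik n (Suc i) f) + act (adj i) (act (adj i) f)"
    by (subst act_adj_cherednik[OF assms]) (simp add: act_add)
  then show ?thesis by simp
qed

section \<open>The raising operator\<close>

definition rot :: "nat \<Rightarrow> nat \<Rightarrow> nat" where
  "rot n i = (if i = 1 then n else if 1 < i \<and> i \<le> n then i - 1 else i)"

text \<open>For this purpose \<open>rot\<close> fixes every index outside 1, ..., n:
  \<open>act\<close> needs bijections of all natural numbers.\<close>

lemma bij_rot:
  assumes "1 \<le> n"
  shows "bij (rot n)"
proof (rule o_bij)
  let ?v = "\<lambda>i. if i = n then 1 else if 1 \<le> i \<and> i < n then i + 1 else i"
  show "?v \<circ> rot n = id" "rot n \<circ> ?v = id"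
    using assms by (auto simp: rot_def fun_eq_iff)
qed

text \<open>The Knop-Sahi operator \<Phi>, which sends f(x_1, ..., x_n) to x_n f(x_n, x_1, ...,
  x_(n-1)).\<close>

definition raise :: "nat \<Rightarrow> mpol \<Rightarrow> mpol" where
  "raise n f = mvar n * act (rot n) f"

lemma rot_image:
  assumes "1 \<le> i" "i \<le> n"
  shows "rot n ` {1..<Suc i} = insert n {1..<i}" "rot n ` {i<..n} = {i..<n}"
proof -
  have "j \<in> rot n ` {1..<Suc i}" if "j \<in> insert n {1..<i}" for j
  proof (cases "j = n")
    case True
    then show ?thesis using assms by (intro image_eqI[of _ _ 1]) (auto simp: rot_def)
  next
    case False
    then show ?thesis using that assms by (intro image_eqI[of _ _ "Suc j"]) (auto simp: rot_def)
  qed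
  moreover have "rot n j \<in> insert n {1..<i}" if "j \<in> {1..<Suc i}" for j
    using that assms by (auto simp: rot_def)
  ultimately show "rot n ` {1..<Suc i} = insert n {1..<i}" by blast
  have "j \<in> rot n ` {i<..n}" if "j \<in> {i..<n}" for j
    using that assms by (intro image_eqI[of _ _ "Suc j"]) (auto simp: rot_def)
  moreover have "rot n j \<in> {i..<n}" if "j \<in> {i<..n}" for j
    using that assms by (auto simp: rot_def)
  ultimately show "rot n ` {i<..n} = {i..<n}" by blast
qed

lemma rot_image_all:
  assumes "1 \<le> n"
  shows "rot n ` {1..n} = {1..n}"
proof -
  have "{1..n} = {1..<Suc n}" by auto
  moreover have "rot n ` {1..<Suc n} = {1..n}" using rot_image(1)[of n n] assms by auto
  ultimately show ?thesis by metis
qed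

lemma divdiff_mvar_other:
  "i \<noteq> j \<Longrightarrow> k \<noteq> i \<Longrightarrow> k \<noteq> j \<Longrightarrow> divdiff i j (mvar k * f) = mvar k * divdiff i j f"
  by (rule divdiff_mult_invariant) (simp_all add: act_mvar)

text \<open>Rotation carries index 1, which lies below i+1, to index n, which lies above i. The
  factor x_n in front turns its term N_in x_n into x_n N_in x_n, exactly the form that \<xi>_i needs
  for j = n. The other divided differences commute with x_n.\<close>

lemma cherednik_raise:
  assumes "1 \<le> i" "i < n"
  shows "cherednik n i (raise n f) = raise n (cherednik n (Suc i) f)"
proof -
  let ?g = "act (rot n) f"
  have rot: "rot n (Suc i) = i" using assms by (simp add: rot_def)
  have "(\<Sum>j\<in>{1..<i}. divdiff i j (mvar j * (mvar n * ?g)))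
      = (\<Sum>j\<in>{1..<i}. mvar n * divdiff i j (mvar j * ?g))"
    using assms by (intro sum.cong refl)
      (auto simp: divdiff_mvar_other mult.left_commute[of _ "mvar n"])
  moreover have "{i<..n} = insert n {Suc i..<n}" using assms by auto
  then have "(\<Sum>j\<in>{i<..n}. mvar j * divdiff i j (mvar n * ?g))
    = mvar n * divdiff i n (mvar n * ?g) + (\<Sum>j\<in>{Suc i..<n}. mvar j * divdiff i j (mvar n * ?g))"
    by simp
  moreover have "(\<Sum>j\<in>{Suc i..<n}. mvar j * divdiff i j (mvar n * ?g))
      = (\<Sum>j\<in>{Suc i..<n}. mvar n * (mvar j * divdiff i j ?g))"
    using assms by (intro sum.cong refl)
      (auto simp: divdiff_mvar_other mult.left_commute[of _ "mvar n"])
  moreover have "(\<Sum>j\<in>insert n {1..<i}. divdiff i j (mvar j * ?g))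
      = divdiff i n (mvar n * ?g) + (\<Sum>j\<in>{1..<i}. divdiff i j (mvar j * ?g))"
    using assms by simp
  moreover have "act (rot n) (cherednik n (Suc i) f) = mconst \<alpha> * euler i ?g
     + (\<Sum>j\<in>insert n {1..<i}. divdiff i j (mvar j * ?g))
     + (\<Sum>j\<in>{Suc i..<n}. mvar j * divdiff i j ?g)"
    using assms by (subst act_cherednik) (simp_all only: bij_rot rot rot_image le_SucI Suc_leI
        less_imp_le order.trans[of 1 i n] simp_thms)
  ultimately show ?thesis
    using assms
    by (simp only: raise_def cherednik_euler euler_mvar_times)
      (simp add: sum_distrib_left distrib_left mult.left_commute[of _ "mvar n"] add_ac)
qed

text \<open>Here every other index changes sides. The product x_j x_n is symmetric in its two
  variables and can be taken out of the divided difference. The extra \<alpha> comes from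
  differentiating the factor x_n.\<close>

lemma cherednik_raise_last:
  assumes "1 \<le> n"
  shows "cherednik n n (raise n f) = raise n (cherednik n 1 f) + mconst \<alpha> * raise n f"
proof -
  let ?g = "act (rot n) f"
  have rot: "rot n 1 = n" by (simp add: rot_def)
  have "(\<Sum>j\<in>{1..<n}. divdiff n j (mvar j * (mvar n * ?g)))
      = (\<Sum>j\<in>{1..<n}. mvar n * (mvar j * divdiff n j ?g))"
  proof (intro sum.cong refl)
    fix j assume "j \<in> {1..<n}"
    then have "divdiff n j ((mvar j * mvar n) * ?g) = (mvar j * mvar n) * divdiff n j ?g"
      by (intro divdiff_mult_invariant) (auto simp: act_mult act_mvar)
    then show "divdiff n j (mvar j * (mvar n * ?g)) = mvar n * (mvar j * divdiff n j ?g)"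
      by (simp add: mult_ac)
  qed
  moreover have "act (rot n) (cherednik n 1 f) = mconst \<alpha> * euler n ?g
     + (\<Sum>j\<in>{1..<n}. mvar j * divdiff n j ?g)"
    using assms rot_image(2)[of 1 n] by (subst act_cherednik) (simp_all add: bij_rot rot[simplified])
  ultimately show ?thesis
    by (simp only: raise_def cherednik_euler euler_mvar_times)
      (simp add: sum_distrib_left distrib_left mult.left_commute[of _ "mvar n"] add_ac)
qed

section \<open>Compositions and their spectra\<close>

lemma of_int_fract: "(of_int k :: ratfun) = Fract [:of_int k:] 1"
proof (cases k)
  case (nonneg m)
  then show ?thesis by (simp add: of_nat_fract of_nat_poly)
next
  case (neg m)
  then show ?thesis
    by (simp only: of_int_minus of_int_of_nat_eq minus_fract of_nat_fract)
      (simp add: of_nat_poly del: of_nat_Suc)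
qed

text \<open>Transcendence of \<alpha>, up to the degree that occurs: eigenvalues are linear in
  \<alpha>, and \<open>bracket\<close> multiplies one difference of them by \<alpha> + k.\<close>

lemma alpha_quadratic_eq_0:
  assumes "\<alpha> * \<alpha> * of_int a + \<alpha> * of_int b + of_int c = 0"
  shows "a = 0" "b = 0" "c = 0"
proof -
  have "\<alpha> * \<alpha> * of_int a + \<alpha> * of_int b + of_int c = Fract [:of_int c, of_int b, of_int a:] 1"
    by (simp add: of_int_fract \<alpha>_def)
  with assms have "[:of_int c, of_int b, of_int a:] = (0 :: rat poly)"
    by (simp add: Zero_fract_def eq_fract)
  then show "a = 0" "b = 0" "c = 0" by simp_all
qed

lemma alpha_linear_eq_0:
  assumes "\<alpha> * of_int b + of_int c = 0"
  shows "b = 0" "c = 0"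
  using assms alpha_quadratic_eq_0[of 0 b c] by simp_all

lemma alpha_linear_nonzero: "\<alpha> * (of_nat a + 1) + of_nat b \<noteq> 0"
  using alpha_linear_eq_0(1)[of "int a + 1" "int b"] by auto

lemma alpha_nonzero: "\<alpha> \<noteq> 0"
  using alpha_linear_nonzero[of 0 0] by simp

text \<open>The rational functions that vanish at \<open>\<alpha> = \<infinity>\<close>.\<close>

definition infsml :: "ratfun \<Rightarrow> bool" where
  "infsml f \<longleftrightarrow> (\<exists>p q. q \<noteq> 0 \<and> f = Fract p q \<and> (p = 0 \<or> degree p < degree q))"

lemma infsml_0 [simp]: "infsml 0"
  unfolding infsml_def by (intro exI[of _ 0] exI[of _ 1]) (simp add: Zero_fract_def)

lemma not_infsml_1: "\<not> infsml 1"
  by (auto simp: infsml_def One_fract_def eq_fract)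

lemma infsml_cases:
  assumes "infsml f"
  obtains "f = 0" | p q where "p \<noteq> 0" "q \<noteq> 0" "f = Fract p q" "degree p < degree q"
  using assms unfolding infsml_def by (metis fract_collapse(1))

lemma infsml_add:
  assumes "infsml f" "infsml g"
  shows "infsml (f + g)"
  using assms(1)
proof (cases rule: infsml_cases)
  case f: (2 p q)
  from assms(2) show ?thesis
  proof (cases rule: infsml_cases)
    case g: (2 r s)
    have "degree (p * s) < degree (q * s)" "degree (r * q) < degree (q * s)"
      using f g by (auto simp: degree_mult_eq)
    then have "degree (p * s + r * q) < degree (q * s)" by (rule degree_add_less)
    then show ?thesis
      unfolding infsml_def using f g
      by (intro exI[of _ "p * s + r * q"] exI[of _ "q * s"]) simp
  qed (use assms in simp)
qed (use assms in simp)

lemma infsml_mult: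
  assumes "infsml f" "infsml g"
  shows "infsml (f * g)"
  using assms(1)
proof (cases rule: infsml_cases)
  case f: (2 p q)
  from assms(2) show ?thesis
  proof (cases rule: infsml_cases)
    case g: (2 r s)
    then show ?thesis
      unfolding infsml_def using f
      by (intro exI[of _ "p * r"] exI[of _ "q * s"]) (simp add: degree_mult_eq)
  qed simp
qed simp

lemma infsml_minus: "infsml f \<Longrightarrow> infsml (- f)"
  unfolding infsml_def by (metis minus_fract degree_minus neg_equal_0_iff_equal)

lemma infsml_diff: "infsml f \<Longrightarrow> infsml g \<Longrightarrow> infsml (f - g)"
  using infsml_add[of f "- g"] infsml_minus[of g] by simp

lemma infsml_inverse_linear:
  assumes "b \<noteq> 0"
  shows "infsml (inverse (\<alpha> * of_int b + of_int c))"
proof -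
  have "inverse (\<alpha> * of_int b + of_int c) = Fract 1 [:of_int c, of_int b:]"
    by (simp add: of_int_fract \<alpha>_def)
  then show ?thesis
    unfolding infsml_def using assms
    by (intro exI[of _ 1] exI[of _ "[:of_int c, of_int b:]"]) simp
qed

section \<open>Compositions under swaps and raising\<close>

lemma compositions_iff: "\<gamma> \<in> compositions n \<longleftrightarrow> (\<forall>i. i \<notin> {1..n} \<longrightarrow> part \<gamma> i = 0)"
  by (auto simp: compositions_def in_keys_iff subset_eq)

lemma compositions_eqI:
  assumes "\<gamma> \<in> compositions n" "\<delta> \<in> compositions n" "\<And>i. i \<in> {1..n} \<Longrightarrow> part \<gamma> i = part \<delta> i"
  shows "\<gamma> = \<delta>"
  by (rule poly_mapping_eqI) (metis assms compositions_iff)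

lemma zero_compositions [simp]: "0 \<in> compositions n"
  by (simp add: compositions_iff)

lemma unit_comp_compositions [simp]: "k \<in> {1..n} \<Longrightarrow> unit_comp k \<in> compositions n"
  by (auto simp: compositions_iff part_unit_comp)

lemma poly_ring_iff: "f \<in> poly_ring n \<longleftrightarrow> (\<forall>\<beta>. \<beta> \<notin> compositions n \<longrightarrow> mcoeff f \<beta> = 0)"
  by (auto simp: poly_ring_def in_keys_iff subset_eq)

definition swapc :: "nat \<Rightarrow> comp \<Rightarrow> comp" where
  "swapc i \<gamma> = pcomp \<gamma> (adj i)"

lemma part_swapc: "part (swapc i \<gamma>) j = part \<gamma> (adj i j)"
  by (simp add: swapc_def part_pcomp)

lemma swapc_swapc [simp]: "swapc i (swapc i \<gamma>) = \<gamma>"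
  by (rule poly_mapping_eqI) (simp add: part_swapc)

lemma swapc_id: "part \<gamma> i = part \<gamma> (Suc i) \<Longrightarrow> swapc i \<gamma> = \<gamma>"
  by (rule poly_mapping_eqI) (auto simp: part_swapc transpose_def)

lemma adj_mem: "1 \<le> i \<Longrightarrow> i < n \<Longrightarrow> adj i j \<in> {1..n} \<longleftrightarrow> j \<in> {1..n}"
  by (auto simp: transpose_def)

lemma swapc_compositions:
  "1 \<le> i \<Longrightarrow> i < n \<Longrightarrow> swapc i \<gamma> \<in> compositions n \<longleftrightarrow> \<gamma> \<in> compositions n"
proof -
  have *: "swapc i \<gamma> \<in> compositions n" if "1 \<le> i" "i < n" "\<gamma> \<in> compositions n" for \<gamma>
    using that adj_mem[of i n] by (auto simp: compositions_iff part_swapc)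
  show "1 \<le> i \<Longrightarrow> i < n \<Longrightarrow> swapc i \<gamma> \<in> compositions n \<longleftrightarrow> \<gamma> \<in> compositions n"
    using *[of \<gamma>] *[of "swapc i \<gamma>"] by auto
qed

lemma mcoeff_act_adj: "mcoeff (act (adj i) f) \<beta> = mcoeff f (swapc i \<beta>)"
  by (simp add: mcoeff_act swapc_def)

text \<open>The composition (\<gamma>_2, ..., \<gamma>_n, \<gamma>_1 + 1), written so that it
  matches the way \<open>raise\<close> moves exponents.\<close>

definition raisec :: "nat \<Rightarrow> comp \<Rightarrow> comp" where
  "raisec n \<gamma> = pcomp \<gamma> (inv (rot n)) + unit_comp n"

lemma part_raisec_rot:
  assumes "1 \<le> n" "1 \<le> i" "i \<le> n"
  shows "part (raisec n \<gamma>) (rot n i) = part \<gamma> i + (if i = 1 then 1 else 0)"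
proof -
  have "n = rot n i \<longleftrightarrow> i = 1" using assms by (auto simp: rot_def)
  then show ?thesis
    using bij_rot[OF assms(1)]
    by (simp add: raisec_def lookup_add part_pcomp bij_imp_bij_inv part_unit_comp bij_is_inj)
qed

lemma part_raisec:
  assumes "1 \<le> n" "1 \<le> i" "i \<le> n"
  shows "part (raisec n \<gamma>) i = (if i = n then part \<gamma> 1 + 1 else part \<gamma> (Suc i))"
  using part_raisec_rot[of n 1 \<gamma>] part_raisec_rot[of n "Suc i" \<gamma>] assms
  by (auto simp: rot_def)

lemma raisec_compositions:
  assumes "1 \<le> n" "\<gamma> \<in> compositions n"
  shows "raisec n \<gamma> \<in> compositions n"
  unfolding compositions_iff
proof (intro allI impI)
  fix i assume i: "i \<notin> {1..n}"
  then have "rot n i = i" "i \<noteq> n" using assms by (auto simp: rot_def)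
  then have "inv (rot n) i = i"
    by (metis assms(1) bij_is_inj bij_rot inv_f_f)
  then show "part (raisec n \<gamma>) i = 0"
    using i assms \<open>i \<noteq> n\<close> bij_rot[OF assms(1)]
    by (simp add: raisec_def lookup_add part_pcomp bij_imp_bij_inv part_unit_comp compositions_iff)
qed

lemma raisec_inject [simp]:
  assumes "1 \<le> n"
  shows "raisec n \<gamma> = raisec n \<delta> \<longleftrightarrow> \<gamma> = \<delta>"
  using bij_rot[OF assms] by (auto simp: raisec_def dest: arg_cong[of _ _ "\<lambda>\<beta>. pcomp \<beta> (rot n)"])

lemma raisec_surj:
  assumes "1 \<le> n" "\<beta> \<in> compositions n" "part \<beta> n \<noteq> 0"
  obtains \<gamma> where "\<gamma> \<in> compositions n" "\<beta> = raisec n \<gamma>"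
proof
  have eq: "\<beta> - unit_comp n + unit_comp n = \<beta>"
    using comp_minus_plus_unit[OF assms(3)] by (simp add: add.commute)
  let ?\<gamma> = "pcomp (\<beta> - unit_comp n) (rot n)"
  show "\<beta> = raisec n ?\<gamma>"
    using bij_rot[OF assms(1)] by (simp add: raisec_def eq)
  have "rot n i = i" if "i \<notin> {1..n}" for i using that assms by (auto simp: rot_def)
  then show "?\<gamma> \<in> compositions n"
    using assms bij_rot[OF assms(1)] by (auto simp: compositions_iff part_pcomp lookup_minus)
qed

lemma mcoeff_raise_raisec:
  assumes "1 \<le> n"
  shows "mcoeff (raise n f) (raisec n \<gamma>) = mcoeff f \<gamma>"
  using bij_rot[OF assms] by (simp add: raise_def raisec_def mcoeff_mvar_times_add mcoeff_act)

lemma mcoeff_raise_eq_0: "part \<beta> n = 0 \<Longrightarrow> mcoeff (raise n f) \<beta> = 0"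
  by (simp add: raise_def mcoeff_mvar_times)

lemma csize_swapc:
  assumes "1 \<le> i" "i < n"
  shows "csize n (swapc i \<gamma>) = csize n \<gamma>"
  unfolding csize_def
  by (rule sum.reindex_bij_witness[of _ "adj i" "adj i"])
    (use assms in \<open>simp_all add: adj_mem[simplified] part_swapc\<close>)

lemma csize_raisec:
  assumes "1 \<le> n"
  shows "csize n (raisec n \<gamma>) = csize n \<gamma> + 1"
proof -
  have inj: "inj_on (rot n) {1..<Suc n}"
    using bij_rot[OF assms] by (meson bij_is_inj inj_on_subset subset_UNIV)
  have "rot n ` {1..<Suc n} = {1..n}" using rot_image(1)[of n n] assms by auto
  then have "csize n (raisec n \<gamma>) = (\<Sum>i\<in>{1..<Suc n}. part (raisec n \<gamma>) (rot n i))"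
    unfolding csize_def using sum.reindex[OF inj, of "part (raisec n \<gamma>)"] by simp
  also have "\<dots> = (\<Sum>i\<in>{1..<Suc n}. part \<gamma> i + (if i = 1 then 1 else 0))"
    using assms by (intro sum.cong refl part_raisec_rot) auto
  also have "\<dots> = csize n \<gamma> + 1"
    using assms by (simp add: sum.distrib csize_def atLeastLessThanSuc_atLeastAtMost)
  finally show ?thesis .
qed

text \<open>A strict linear order on the rows, in which the smaller index wins a tie. It makes
  \<open>coleg_row\<close> a rank, so bijections that respect the order preserve it.\<close>

definition beats :: "comp \<Rightarrow> nat \<Rightarrow> nat \<Rightarrow> bool" where
  "beats \<gamma> h i \<longleftrightarrow> part \<gamma> i < part \<gamma> h \<or> part \<gamma> i = part \<gamma> h \<and> h < i"

lemma coleg_row_beats: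
  assumes "i \<in> {1..n}"
  shows "coleg_row n \<gamma> i = card {h \<in> {1..n}. beats \<gamma> h i}"
proof -
  have "{h \<in> {1..n}. beats \<gamma> h i} = {h \<in> {1..<i}. part \<gamma> i \<le> part \<gamma> h} \<union> {h \<in> {i<..n}. part \<gamma> i < part \<gamma> h}"
    using assms by (auto simp: beats_def) (metis less_irrefl linorder_neqE_nat)
  moreover have "card \<dots> = coleg_row n \<gamma> i"
    unfolding coleg_row_def by (rule card_Un_disjoint) auto
  ultimately show ?thesis by simp
qed

lemma coleg_row_bij:
  assumes "bij w" "w ` {1..n} = {1..n}" "i \<in> {1..n}"
    and "\<And>h. h \<in> {1..n} \<Longrightarrow> beats \<delta> (w h) (w i) \<longleftrightarrow> beats \<gamma> h i"
  shows "coleg_row n \<delta> (w i) = coleg_row n \<gamma> i"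
proof -
  have "{h \<in> {1..n}. beats \<delta> h (w i)} = w ` {h \<in> {1..n}. beats \<gamma> h i}"
    using assms(2,4) by (auto 4 3)
  moreover have "w i \<in> {1..n}" using assms by blast
  ultimately show ?thesis
    using assms(1,3) by (simp only: coleg_row_beats) (meson bij_is_inj card_image inj_on_subset subset_UNIV)
qed

lemma spectral_swapc:
  assumes "1 \<le> i" "i < n" "part \<gamma> i \<noteq> part \<gamma> (Suc i)" "j \<in> {1..n}"
  shows "spectral n (swapc i \<gamma>) (adj i j) = spectral n \<gamma> j"
proof -
  have "beats (swapc i \<gamma>) (adj i h) (adj i j) = beats \<gamma> h j" for h
    using assms(3) by (auto simp: beats_def part_swapc transpose_def)
  then have "coleg_row n (swapc i \<gamma>) (adj i j) = coleg_row n \<gamma> j"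
    using assms by (intro coleg_row_bij transpose_image) auto
  then show ?thesis by (simp add: spectral_def part_swapc)
qed

text \<open>Row 1 wins every tie. Moved to position n it loses every tie, but its entry has grown by
  one, so the same rows beat it. The order among the other rows does not change.\<close>

lemma spectral_raisec_rot:
  assumes "1 \<le> n" "j \<in> {1..n}"
  shows "spectral n (raisec n \<gamma>) (rot n j) = spectral n \<gamma> j + (if j = 1 then \<alpha> else 0)"
proof -
  note im = rot_image_all[OF assms(1)]
  have "beats (raisec n \<gamma>) (rot n h) (rot n j) = beats \<gamma> h j" if "h \<in> {1..n}" for h
  proof -
    have "part (raisec n \<gamma>) (rot n h) = part \<gamma> h + (if h = 1 then 1 else 0)"
      "part (raisec n \<gamma>) (rot n j) = part \<gamma> j + (if j = 1 then 1 else 0)"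
      using assms that by (simp_all add: part_raisec_rot)
    moreover have "rot n h < rot n j \<longleftrightarrow> (if h = 1 then False else if j = 1 then True else h < j)"
      using assms that by (auto simp: rot_def)
    ultimately show ?thesis unfolding beats_def using assms that by auto
  qed
  then have "coleg_row n (raisec n \<gamma>) (rot n j) = coleg_row n \<gamma> j"
    using assms im by (intro coleg_row_bij bij_rot)
  then show ?thesis using assms by (simp add: spectral_def part_raisec_rot algebra_simps)
qed

lemma spectral_raisec:
  assumes "1 \<le> n" "i \<in> {1..n}"
  shows "spectral n (raisec n \<gamma>) i = (if i = n then spectral n \<gamma> 1 + \<alpha> else spectral n \<gamma> (Suc i))"
  using spectral_raisec_rot[of n 1 \<gamma>] spectral_raisec_rot[of n "Suc i" \<gamma>] assms
  by (auto simp: rot_def)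

lemma coleg_row_Suc_eq:
  assumes "1 \<le> i" "i < n" "part \<gamma> i = part \<gamma> (Suc i)"
  shows "coleg_row n \<gamma> (Suc i) = Suc (coleg_row n \<gamma> i)"
proof -
  have "{h \<in> {1..n}. beats \<gamma> h (Suc i)} = insert i {h \<in> {1..n}. beats \<gamma> h i}"
    using assms by (auto simp: beats_def)
  moreover have "i \<notin> {h \<in> {1..n}. beats \<gamma> h i}" by (auto simp: beats_def)
  ultimately show ?thesis using assms by (simp add: coleg_row_beats)
qed

lemma spectral_Suc_eq:
  assumes "1 \<le> i" "i < n" "part \<gamma> i = part \<gamma> (Suc i)"
  shows "spectral n \<gamma> i = spectral n \<gamma> (Suc i) + 1"
  using assms by (simp add: spectral_def coleg_row_Suc_eq)

lemma spectral_diff: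
  "spectral n \<gamma> i - spectral n \<delta> j
    = \<alpha> * of_int (int (part \<gamma> i) - int (part \<delta> j)) + of_int (int (coleg_row n \<delta> j) - int (coleg_row n \<gamma> i))"
  by (simp add: spectral_def algebra_simps)

lemma spectral_eqD:
  assumes "spectral n \<gamma> i = spectral n \<delta> j"
  shows "part \<gamma> i = part \<delta> j" "coleg_row n \<gamma> i = coleg_row n \<delta> j"
proof -
  have "spectral n \<gamma> i - spectral n \<delta> j = 0" using assms by simp
  from alpha_linear_eq_0[OF this[unfolded spectral_diff]]
  show "part \<gamma> i = part \<delta> j" "coleg_row n \<gamma> i = coleg_row n \<delta> j" by simp_all
qed

lemma spectral_inj:
  assumes "\<gamma> \<in> compositions n" "\<delta> \<in> compositions n"
    and "\<And>i. i \<in> {1..n} \<Longrightarrow> spectral n \<gamma> i = spectral n \<delta> i"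
  shows "\<gamma> = \<delta>"
  using assms spectral_eqD(1) by (intro compositions_eqI[of _ n]) blast+

text \<open>The multiple of E_\<gamma> that has to be subtracted from s_i E_\<gamma> to obtain an
  eigenfunction for s_i \<gamma>. For equal entries it is 1 by \<open>spectral_Suc_eq\<close>, and
  the corrected polynomial is zero by \<open>act_adj_jackE_eq\<close>.\<close>

definition refl_coeff :: "nat \<Rightarrow> comp \<Rightarrow> nat \<Rightarrow> ratfun" where
  "refl_coeff n \<gamma> i = inverse (spectral n \<gamma> i - spectral n \<gamma> (Suc i))"

lemma spectral_neq_Suc: "part \<gamma> i \<noteq> part \<gamma> (Suc i) \<Longrightarrow> spectral n \<gamma> i \<noteq> spectral n \<gamma> (Suc i)"
  using spectral_eqD(1) by blast

lemma infsml_refl_coeff: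
  assumes "part \<gamma> i \<noteq> part \<gamma> (Suc i)"
  shows "infsml (refl_coeff n \<gamma> i)"
  unfolding refl_coeff_def spectral_diff using assms by (intro infsml_inverse_linear) simp

lemma refl_coeff_nonzero: "part \<gamma> i \<noteq> part \<gamma> (Suc i) \<Longrightarrow> refl_coeff n \<gamma> i \<noteq> 0"
  using spectral_neq_Suc by (simp add: refl_coeff_def)

lemma refl_coeff_square:
  assumes "part \<gamma> i \<noteq> part \<gamma> (Suc i)"
  shows "refl_coeff n \<gamma> i * refl_coeff n \<gamma> i \<noteq> 1"
  using infsml_refl_coeff[OF assms] infsml_mult not_infsml_1 by metis

section \<open>Nonsymmetric Jack polynomials\<close>

text \<open>Normalisation and membership in \<open>poly_ring\<close> are kept apart: \<Phi> and the
  corrected swaps preserve the eigenvalue equations, while the leading coefficient has to be tracked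
  separately.\<close>

definition eig :: "nat \<Rightarrow> comp \<Rightarrow> mpol \<Rightarrow> bool" where
  "eig n \<gamma> f \<longleftrightarrow> (\<forall>i\<in>{1..n}. cherednik n i f = mconst (spectral n \<gamma> i) * f)"

definition homog :: "nat \<Rightarrow> nat \<Rightarrow> mpol \<Rightarrow> bool" where
  "homog n d f \<longleftrightarrow> (\<forall>\<beta>. mcoeff f \<beta> \<noteq> 0 \<longrightarrow> \<beta> \<in> compositions n \<and> csize n \<beta> = d)"

lemma raise_add: "1 \<le> n \<Longrightarrow> raise n (f + g) = raise n f + raise n g"
  by (simp add: raise_def act_add bij_rot distrib_left)

lemma raise_mconst: "1 \<le> n \<Longrightarrow> raise n (mconst c * f) = mconst c * raise n f"
  by (simp add: raise_def act_mconst_times bij_rot mult.left_commute)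

lemma raise_e1_times:
  assumes "1 \<le> n"
  shows "raise n (e1 n * f) = e1 n * raise n f"
  using assms
  by (simp add: raise_def act_mult bij_rot act_e1[OF bij_rot rot_image_all] mult.left_commute)

lemma eig_raise:
  assumes "1 \<le> n" "eig n \<gamma> f"
  shows "eig n (raisec n \<gamma>) (raise n f)"
  unfolding eig_def
proof
  fix i assume i: "i \<in> {1..n}"
  show "cherednik n i (raise n f) = mconst (spectral n (raisec n \<gamma>) i) * raise n f"
  proof (cases "i = n")
    case True
    have "cherednik n 1 f = mconst (spectral n \<gamma> 1) * f" using assms by (simp add: eig_def)
    with True assms show ?thesis
      by (simp add: cherednik_raise_last spectral_raisec raise_mconst mconst_add distrib_right)
  next
    case False
    with i have "cherednik n (Suc i) f = mconst (spectral n \<gamma> (Suc i)) * f"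
      using assms by (simp add: eig_def)
    with False i assms show ?thesis
      by (simp add: cherednik_raise spectral_raisec raise_mconst)
  qed
qed

lemma cherednik_act_adj_eig:
  assumes "1 \<le> i" "i < n" "eig n \<gamma> f"
  shows "cherednik n i (act (adj i) f) = mconst (spectral n \<gamma> (Suc i)) * act (adj i) f + f"
    and "cherednik n (Suc i) (act (adj i) f) = mconst (spectral n \<gamma> i) * act (adj i) f - f"
    and "j \<in> {1..n} \<Longrightarrow> j \<noteq> i \<Longrightarrow> j \<noteq> Suc i \<Longrightarrow>
      cherednik n j (act (adj i) f) = mconst (spectral n \<gamma> j) * act (adj i) f"
proof -
  have e: "cherednik n j f = mconst (spectral n \<gamma> j) * f" if "j \<in> {1..n}" for j
    using assms that by (simp add: eig_def)
  show "cherednik n i (act (adj i) f) = mconst (spectral n \<gamma> (Suc i)) * act (adj i) f + f"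
    using act_adj_cherednik_Suc[OF assms(1,2), of f] e[of "Suc i"] assms
    by (simp add: act_mconst_times)
  show "cherednik n (Suc i) (act (adj i) f) = mconst (spectral n \<gamma> i) * act (adj i) f - f"
    using act_adj_cherednik[OF assms(1,2), of f] e[of i] assms
    by (simp add: act_mconst_times)
  show "cherednik n j (act (adj i) f) = mconst (spectral n \<gamma> j) * act (adj i) f"
    if "j \<in> {1..n}" "j \<noteq> i" "j \<noteq> Suc i"
    using act_adj_cherednik_other[OF assms(1,2), of j f] e[of j] that
    by (simp add: act_mconst_times)
qed

text \<open>On the span of f and s_i f the operator \<xi>_i is triangular: it scales f by
  \<gamma>'_i and sends s_i f to \<gamma>'_(i+1) s_i f + f. The correction term solves for the
  second eigenvector; \<xi>_(i+1) behaves in the same way.\<close>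

lemma eig_swap:
  assumes "1 \<le> i" "i < n" "eig n \<gamma> f" "part \<gamma> i \<noteq> part \<gamma> (Suc i)"
  shows "eig n (swapc i \<gamma>) (act (adj i) f - mconst (refl_coeff n \<gamma> i) * f)"
  unfolding eig_def
proof
  fix j assume j: "j \<in> {1..n}"
  let ?r = "refl_coeff n \<gamma> i" and ?p = "spectral n \<gamma> i" and ?q = "spectral n \<gamma> (Suc i)"
  have "?r * (?p - ?q) = 1"
    using spectral_neq_Suc[OF assms(4)] by (simp add: refl_coeff_def)
  then have r: "?r * ?p = 1 + ?r * ?q" by (simp add: algebra_simps)
  have r': "mconst ?r * mconst ?p = 1 + mconst ?r * mconst ?q"
    using arg_cong[OF r, of mconst] by (simp add: mconst_mult mconst_add)
  have s: "spectral n (swapc i \<gamma>) j = spectral n \<gamma> (adj i j)"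
    using spectral_swapc[OF assms(1,2,4), of "adj i j"] j adj_mem[OF assms(1,2), of j] by simp
  have e: "cherednik n j f = mconst (spectral n \<gamma> j) * f"
    using assms j by (simp add: eig_def)
  consider "j = i" | "j = Suc i" | "j \<noteq> i" "j \<noteq> Suc i" by blast
  then show "cherednik n j (act (adj i) f - mconst ?r * f) =
    mconst (spectral n (swapc i \<gamma>) j) * (act (adj i) f - mconst ?r * f)"
  proof cases
    case 1
    have "f - mconst ?r * (mconst ?p * f) = - (mconst ?q * (mconst ?r * f))"
      unfolding mult.assoc[symmetric] r' by (simp add: algebra_simps)
    with 1 assms show ?thesis
      by (simp add: s[unfolded 1] e[unfolded 1] cherednik_diff cherednik_mconst
          cherednik_act_adj_eig right_diff_distrib add_diff_eq[symmetric])
  next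
    case 2
    have "mconst ?p * (mconst ?r * f) = f + mconst ?r * (mconst ?q * f)"
      unfolding mult.assoc[symmetric] mult.commute[of "mconst ?p"] r' by (simp add: algebra_simps)
    with 2 assms show ?thesis
      by (simp add: s[unfolded 2] e[unfolded 2] cherednik_diff cherednik_mconst
          cherednik_act_adj_eig right_diff_distrib)
  next
    case 3
    with assms j show ?thesis
      by (simp add: s e cherednik_diff cherednik_mconst cherednik_act_adj_eig
          right_diff_distrib mult.left_commute)
  qed
qed

lemma homog_raise:
  assumes "1 \<le> n" "homog n d f"
  shows "homog n (Suc d) (raise n f)"
  unfolding homog_def
proof (intro allI impI)
  fix \<beta> assume \<beta>: "mcoeff (raise n f) \<beta> \<noteq> 0"
  define \<gamma> where "\<gamma> = pcomp (\<beta> - unit_comp n) (rot n)"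
  have "part \<beta> n \<noteq> 0" using \<beta> mcoeff_raise_eq_0 by blast
  then have eq: "\<beta> = raisec n \<gamma>"
    using comp_minus_plus_unit[of \<beta> n] bij_rot[OF assms(1)]
    by (simp add: raisec_def \<gamma>_def add.commute)
  with \<beta> have "mcoeff f \<gamma> \<noteq> 0" using mcoeff_raise_raisec[OF assms(1)] by simp
  then show "\<beta> \<in> compositions n \<and> csize n \<beta> = Suc d"
    using assms raisec_compositions csize_raisec by (simp add: homog_def eq)
qed

lemma homog_act_adj:
  assumes "1 \<le> i" "i < n" "homog n d f"
  shows "homog n d (act (adj i) f)"
  unfolding homog_def
proof (intro allI impI)
  fix \<beta> assume "mcoeff (act (adj i) f) \<beta> \<noteq> 0"
  then have "swapc i \<beta> \<in> compositions n \<and> csize n (swapc i \<beta>) = d"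
    using assms(3) by (auto simp: homog_def mcoeff_act_adj)
  then show "\<beta> \<in> compositions n \<and> csize n \<beta> = d"
    using assms(1,2) by (simp add: swapc_compositions csize_swapc)
qed

lemma homog_mconst: "homog n d f \<Longrightarrow> homog n d (mconst c * f)"
  by (simp add: homog_def mcoeff_mconst_times)

lemma homog_diff: "homog n d f \<Longrightarrow> homog n d g \<Longrightarrow> homog n d (f - g)"
  by (simp add: homog_def lookup_minus) (metis diff_self)

text \<open>Each N_ij x_j with j < i sends 1 to -1, and in the zero composition exactly the rows
  before i beat row i.\<close>

lemma eig_one: "eig n 0 1"
  unfolding eig_def
proof
  fix i assume i: "i \<in> {1..n}"
  have euler: "euler i 1 = 0"
    by (rule poly_mapping_eqI) (auto simp: mcoeff_euler lookup_one when_def)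
  have lower: "divdiff i j (mvar j * 1) = - 1" if "j \<in> {1..<i}" for j
    using that by (intro divdiff_eqI) (auto simp: act_mvar)
  have upper: "divdiff i j 1 = 0" if "j \<in> {i<..n}" for j
    using that act_mconst[of _ 1] by (intro divdiff_eqI) auto
  have "{h \<in> {1..<i}. part 0 i \<le> part 0 h} = {1..<i}" by auto
  then have "coleg_row n 0 i = i - 1" unfolding coleg_row_def by simp
  then have "spectral n 0 i = - of_nat (i - 1)" by (simp add: spectral_def)
  moreover have "(\<Sum>j\<in>{1..<i}. divdiff i j (mvar j * 1)) = - of_nat (i - 1)"
    using lower by simp
  moreover have "(\<Sum>j\<in>{i<..n}. mvar j * divdiff i j 1) = 0"
    using upper by simp
  ultimately show "cherednik n i 1 = mconst (spectral n 0 i) * 1"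
    unfolding cherednik_euler by (simp add: euler mconst_minus mconst_of_nat)
qed

text \<open>A nonzero composition with nonzero last entry is raised from a smaller one. Otherwise
  its last nonzero entry is moved one place to the right, which lowers the second measure. All
  coefficients are controlled at infinity, not only the one at \<gamma>, because the swap subtracts
  a multiple of f from s_i f.\<close>

lemma eigenfunction_exists:
  assumes n: "1 \<le> n" and "\<gamma> \<in> compositions n"
  shows "\<exists>f. eig n \<gamma> f \<and> homog n (csize n \<gamma>) f
    \<and> (\<forall>\<beta>. infsml (mcoeff f \<beta> - (if \<beta> = \<gamma> then 1 else 0)))"
  using assms(2)
proof (induction \<gamma> rule: wf_induct_rule[OF wf_measures[of "[csize n, \<lambda>\<gamma>. n - Max (Poly_Mapping.keys \<gamma>)]"]])
  case (1 \<gamma>)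
  consider "\<gamma> = 0" | "part \<gamma> n \<noteq> 0" | "\<gamma> \<noteq> 0" "part \<gamma> n = 0" by blast
  then show ?case
  proof cases
    case 1
    have "homog n 0 1" by (simp add: homog_def lookup_one csize_def)
    moreover have "csize n 0 = 0" by (simp add: csize_def)
    ultimately show ?thesis
      using 1 eig_one by (intro exI[of _ 1]) (auto simp: lookup_one when_def)
  next
    case 2
    then obtain \<delta> where \<delta>: "\<delta> \<in> compositions n" "\<gamma> = raisec n \<delta>"
      using raisec_surj[OF n \<open>\<gamma> \<in> compositions n\<close>] by blast
    then have size: "csize n \<gamma> = Suc (csize n \<delta>)" using csize_raisec[OF n] by simp
    then obtain f where f: "eig n \<delta> f" "homog n (csize n \<delta>) f"
      "\<And>\<beta>. infsml (mcoeff f \<beta> - (if \<beta> = \<delta> then 1 else 0))"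
      using 1(1)[of \<delta>] \<delta>(1) by auto
    have "infsml (mcoeff (raise n f) \<beta> - (if \<beta> = \<gamma> then 1 else 0))" for \<beta>
    proof (cases "\<exists>\<epsilon>. \<beta> = raisec n \<epsilon>")
      case True
      then obtain \<epsilon> where "\<beta> = raisec n \<epsilon>" by blast
      then show ?thesis using f(3)[of \<epsilon>] n by (simp add: \<delta>(2) mcoeff_raise_raisec)
    next
      case False
      have "mcoeff (raise n f) \<beta> = 0"
      proof (rule ccontr)
        assume *: "mcoeff (raise n f) \<beta> \<noteq> 0"
        then have "\<beta> \<in> compositions n" using homog_raise[OF n f(2)] by (simp add: homog_def)
        then show False
          using False * mcoeff_raise_eq_0[of \<beta> n f] raisec_surj[OF n, of \<beta>] by metis
      qed
      then show ?thesis using False \<delta>(2) by auto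
    qed
    then show ?thesis
      using eig_raise[OF n f(1)] homog_raise[OF n f(2)] size \<delta>(2) by metis
  next
    case 3
    define i where "i = Max (Poly_Mapping.keys \<gamma>)"
    have i_key: "i \<in> Poly_Mapping.keys \<gamma>" unfolding i_def using 3 by (intro Max_in) auto
    moreover have "part \<gamma> (Suc i) = 0"
      using Max_ge[OF finite_keys, of "Suc i" \<gamma>] unfolding i_def[symmetric] in_keys_iff by fastforce
    ultimately have i: "1 \<le> i" "i < n" "part \<gamma> i \<noteq> 0" "part \<gamma> (Suc i) = 0"
      using \<open>\<gamma> \<in> compositions n\<close> 3(2) by (auto simp: compositions_def in_keys_iff subset_eq le_less)
    define \<delta> where "\<delta> = swapc i \<gamma>"
    have \<gamma>: "\<gamma> = swapc i \<delta>" by (simp add: \<delta>_def)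
    have \<delta>: "\<delta> \<in> compositions n" "csize n \<delta> = csize n \<gamma>" "part \<delta> i \<noteq> part \<delta> (Suc i)"
      using i \<open>\<gamma> \<in> compositions n\<close> by (auto simp: \<delta>_def swapc_compositions csize_swapc part_swapc)
    have "Suc i \<in> Poly_Mapping.keys \<delta>" using i by (simp add: \<delta>_def in_keys_iff part_swapc)
    then have "i < Max (Poly_Mapping.keys \<delta>)"
      using Max_ge[OF finite_keys, of "Suc i" \<delta>] by (simp add: Suc_le_eq)
    then have "n - Max (Poly_Mapping.keys \<delta>) < n - Max (Poly_Mapping.keys \<gamma>)"
      using i by (simp add: i_def)
    then obtain f where f: "eig n \<delta> f" "homog n (csize n \<delta>) f"
      "\<And>\<beta>. infsml (mcoeff f \<beta> - (if \<beta> = \<delta> then 1 else 0))"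
      using 1(1)[of \<delta>] \<delta>(1,2) by auto
    let ?r = "refl_coeff n \<delta> i"
    let ?g = "act (adj i) f - mconst ?r * f"
    have "infsml (mcoeff ?g \<beta> - (if \<beta> = \<gamma> then 1 else 0))" for \<beta>
    proof -
      have "mcoeff ?g \<beta> - (if \<beta> = \<gamma> then 1 else 0)
        = (mcoeff f (swapc i \<beta>) - (if swapc i \<beta> = \<delta> then 1 else 0))
          - (?r * (mcoeff f \<beta> - (if \<beta> = \<delta> then 1 else 0)) + (if \<beta> = \<delta> then ?r else 0))"
      proof -
        have "swapc i \<beta> = \<delta> \<longleftrightarrow> \<beta> = \<gamma>" using \<gamma> by auto
        then show ?thesis
          by (simp add: lookup_minus mcoeff_act_adj mcoeff_mconst_times right_diff_distrib)
      qed
      also have "infsml \<dots>"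
        by (rule infsml_diff[OF f(3) infsml_add[OF infsml_mult[OF infsml_refl_coeff[OF \<delta>(3)] f(3)]]])
          (simp add: infsml_refl_coeff[OF \<delta>(3)])
      finally show ?thesis .
    qed
    moreover have "eig n \<gamma> ?g" unfolding \<gamma> using i \<delta> f by (intro eig_swap)
    moreover have "homog n (csize n \<gamma>) ?g"
      using i f \<delta> by (intro homog_diff homog_act_adj homog_mconst) simp_all
    ultimately show ?thesis by blast
  qed
qed

section \<open>Linear independence of eigenfunctions\<close>

lemma cherednik_eig_sum:
  assumes "finite A" "i \<in> {1..n}" "\<And>\<mu>. \<mu> \<in> A \<Longrightarrow> eig n \<mu> (e \<mu>)"
  shows "cherednik n i (\<Sum>\<mu>\<in>A. mconst (c \<mu>) * e \<mu>) = (\<Sum>\<mu>\<in>A. mconst (c \<mu> * spectral n \<mu> i) * e \<mu>)"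
  using assms
proof (induction A rule: finite_induct)
  case (insert x A)
  then have "eig n x (e x)" by blast
  then show ?case using insert
    by (simp add: cherednik_add cherednik_mconst eig_def mconst_mult mult.assoc)
qed simp

lemma cherednik_eig_sum_diff:
  assumes "finite A" "i \<in> {1..n}" "\<And>\<mu>. \<mu> \<in> A \<Longrightarrow> eig n \<mu> (e \<mu>)"
    and "f = (\<Sum>\<mu>\<in>A. mconst (c \<mu>) * e \<mu>)"
  shows "cherednik n i f - mconst a * f = (\<Sum>\<mu>\<in>A. mconst (c \<mu> * (spectral n \<mu> i - a)) * e \<mu>)"
proof -
  have "cherednik n i f - mconst a * f
    = (\<Sum>\<mu>\<in>A. mconst (c \<mu> * spectral n \<mu> i) * e \<mu> - mconst a * (mconst (c \<mu>) * e \<mu>))"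
    unfolding assms(4) using cherednik_eig_sum[of A i n e c] assms(1-3)
    by (simp add: sum_distrib_left sum_subtractf)
  also have "\<dots> = (\<Sum>\<mu>\<in>A. mconst (c \<mu> * (spectral n \<mu> i - a)) * e \<mu>)"
    by (simp add: mconst_diff mconst_mult right_diff_distrib left_diff_distrib mult_ac)
  finally show ?thesis .
qed

text \<open>The usual elimination: \<xi>_i minus its eigenvalue at \<nu> removes \<nu> from the
  relation and multiplies the coefficient of \<mu> by a nonzero number if i separates the two. The
  choice of i may depend on \<mu>.\<close>

lemma eig_independent:
  assumes "finite A" "A \<subseteq> compositions n"
    and "\<And>\<mu>. \<mu> \<in> A \<Longrightarrow> eig n \<mu> (e \<mu>)" "\<And>\<mu>. \<mu> \<in> A \<Longrightarrow> e \<mu> \<noteq> 0"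
    and "(\<Sum>\<mu>\<in>A. mconst (c \<mu>) * e \<mu>) = 0" "\<mu> \<in> A"
  shows "c \<mu> = 0"
  using assms
proof (induction A arbitrary: c \<mu> rule: finite_induct)
  case (insert \<nu> A)
  have zero: "c \<mu> = 0" if \<mu>: "\<mu> \<in> A" for \<mu>
  proof -
    obtain i where i: "i \<in> {1..n}" "spectral n \<mu> i \<noteq> spectral n \<nu> i"
      using \<mu> insert.prems(1) insert.hyps(2) spectral_inj[of \<mu> n \<nu>] by blast
    have "finite (insert \<nu> A)" using insert.hyps(1) by simp
    from cherednik_eig_sum_diff[OF this i(1) insert.prems(2) insert.prems(4)[symmetric], of "spectral n \<nu> i"]
    have "(\<Sum>\<mu>\<in>A. mconst (c \<mu> * (spectral n \<mu> i - spectral n \<nu> i)) * e \<mu>) = 0"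
      using insert.hyps by simp
    then have "c \<mu> * (spectral n \<mu> i - spectral n \<nu> i) = 0"
      using insert.IH[of "\<lambda>\<mu>. c \<mu> * (spectral n \<mu> i - spectral n \<nu> i)" \<mu>] insert.prems \<mu> by simp
    then show ?thesis using i(2) by simp
  qed
  then have "mconst (c \<nu>) * e \<nu> = 0" using insert.prems(4) insert.hyps by simp
  then have "c \<nu> = 0" using insert.prems(3)[of \<nu>] by simp
  then show ?case using zero insert.prems(5) by blast
qed simp

lemma eig_sum_coeff_0:
  assumes "finite A" "A \<subseteq> compositions n" "\<And>\<mu>. \<mu> \<in> A \<Longrightarrow> eig n \<mu> (e \<mu>) \<and> e \<mu> \<noteq> 0"
    and "f = (\<Sum>\<mu>\<in>A. mconst (c \<mu>) * e \<mu>)"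
    and "i \<in> {1..n}" "cherednik n i f = mconst a * f" "\<mu> \<in> A" "spectral n \<mu> i \<noteq> a"
  shows "c \<mu> = 0"
proof -
  have "(\<Sum>\<mu>\<in>A. mconst (c \<mu> * (spectral n \<mu> i - a)) * e \<mu>) = 0"
    using cherednik_eig_sum_diff[of A i n e f c a] assms by simp
  then have "c \<mu> * (spectral n \<mu> i - a) = 0"
    using eig_independent[of A n e "\<lambda>\<mu>. c \<mu> * (spectral n \<mu> i - a)" \<mu>] assms by blast
  then show ?thesis using assms(8) by simp
qed

section \<open>Spans, dimension count and uniqueness\<close>

interpretation mp: vector_space "\<lambda>c f. mconst c * f"
  by unfold_locales (simp_all add: distrib_left distrib_right mconst_add mconst_mult mult.assoc)

lemma eig_inj_on:
  assumes "\<And>\<mu>. \<mu> \<in> C \<Longrightarrow> eig n \<mu> (e \<mu>) \<and> e \<mu> \<noteq> 0" "C \<subseteq> compositions n"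
  shows "inj_on e C"
proof (rule inj_onI)
  fix \<mu> \<nu> assume *: "\<mu> \<in> C" "\<nu> \<in> C" "e \<mu> = e \<nu>"
  have "spectral n \<mu> i = spectral n \<nu> i" if "i \<in> {1..n}" for i
  proof -
    have "mconst (spectral n \<mu> i) * e \<mu> = mconst (spectral n \<nu> i) * e \<mu>"
      using assms(1)[of \<mu>] assms(1)[of \<nu>] * that unfolding eig_def by metis
    then have "mconst (spectral n \<mu> i - spectral n \<nu> i) = 0"
      using assms(1)[of \<mu>] * by (simp add: mconst_diff)
    then show ?thesis by (simp only: mconst_eq_0_iff right_minus_eq)
  qed
  then show "\<mu> = \<nu>" using * assms(2) spectral_inj[of \<mu> n \<nu>] by blast
qed

lemma eig_independent_set:
  assumes "\<And>\<mu>. \<mu> \<in> C \<Longrightarrow> eig n \<mu> (e \<mu>) \<and> e \<mu> \<noteq> 0" "C \<subseteq> compositions n"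
  shows "mp.independent (e ` C)"
proof
  assume "mp.dependent (e ` C)"
  then obtain t u v where t: "finite t" "t \<subseteq> e ` C" "(\<Sum>v\<in>t. mconst (u v) * v) = 0" "v \<in> t" "u v \<noteq> 0"
    unfolding mp.dependent_explicit by blast
  obtain A where A: "A \<subseteq> C" "t = e ` A" using t(2) by (meson subset_imageE)
  have inj: "inj_on e A" using eig_inj_on[OF assms] A(1) inj_on_subset by blast
  have "finite A" using t(1) A(2) inj finite_image_iff by blast
  moreover have "(\<Sum>\<mu>\<in>A. mconst (u (e \<mu>)) * e \<mu>) = 0"
    using t(3) unfolding A(2) by (simp add: sum.reindex[OF inj])
  ultimately have "u (e \<mu>) = 0" if "\<mu> \<in> A" for \<mu>
    using eig_independent[of A n e "\<lambda>\<mu>. u (e \<mu>)" \<mu>] assms A(1) that by blast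
  then show False using t(4,5) A(2) by blast
qed

lemma span_imageE:
  assumes "f \<in> mp.span (e ` C)"
  obtains A c where "finite A" "A \<subseteq> C" "f = (\<Sum>\<mu>\<in>A. mconst (c \<mu>) * e \<mu>)"
proof -
  obtain t r where t: "finite t" "t \<subseteq> e ` C" "f = (\<Sum>a\<in>t. mconst (r a) * a)"
    using assms unfolding mp.span_explicit by blast
  then obtain A where A: "A \<subseteq> C" "inj_on e A" "t = e ` A" by (meson subset_image_inj)
  have "finite A" using t(1) A finite_image_iff by blast
  then show thesis using that[of A "\<lambda>\<mu>. r (e \<mu>)"] A t(3) by (simp add: sum.reindex)
qed

lemma finite_compositions_size: "finite {\<gamma> \<in> compositions n. csize n \<gamma> = d}"
proof -
  have "part \<gamma> i \<le> csize n \<gamma>" if "i \<in> {1..n}" for \<gamma> i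
    unfolding csize_def using that by (intro member_le_sum) auto
  then have "part ` {\<gamma> \<in> compositions n. csize n \<gamma> = d}
    \<subseteq> {f. \<forall>i. (i \<in> {1..n} \<longrightarrow> f i \<in> {..d}) \<and> (i \<notin> {1..n} \<longrightarrow> f i = 0)}"
    by (auto simp: compositions_iff)
  moreover have "finite \<dots>" by (rule finite_set_of_finite_funs) auto
  ultimately have "finite (part ` {\<gamma> \<in> compositions n. csize n \<gamma> = d})" by (rule finite_subset)
  moreover have "inj_on part {\<gamma> \<in> compositions n. csize n \<gamma> = d}"
    by (rule inj_onI) (rule poly_mapping_eqI, simp only:)
  ultimately show ?thesis by (rule finite_imageD)
qed

lemma mpol_sum_monomials: "f = (\<Sum>\<beta>\<in>Poly_Mapping.keys f. mconst (mcoeff f \<beta>) * Poly_Mapping.single \<beta> 1)"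
  by (rule poly_mapping_eqI)
    (simp add: lookup_sum mconst_def mult_single lookup_single when_def sum.delta' in_keys_iff)

text \<open>The eigenfunctions of degree \<open>d\<close> are linearly independent and as many as the monomials of
  degree \<open>d\<close>.\<close>

lemma homog_in_span:
  assumes e: "\<And>\<mu>. \<mu> \<in> compositions n \<Longrightarrow> eig n \<mu> (e \<mu>) \<and> e \<mu> \<noteq> 0 \<and> homog n (csize n \<mu>) (e \<mu>)"
    and "homog n d f"
  shows "f \<in> mp.span (e ` compositions n)"
proof (rule ccontr)
  assume f: "f \<notin> mp.span (e ` compositions n)"
  define C where "C = {\<gamma> \<in> compositions n. csize n \<gamma> = d}"
  define T where "T = (\<lambda>\<beta>. Poly_Mapping.single \<beta> 1 :: mpol) ` C"
  have C: "finite C" "C \<subseteq> compositions n" unfolding C_def by (rule finite_compositions_size) auto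
  have in_T: "g \<in> mp.span T" if "homog n d g" for g
  proof -
    have "Poly_Mapping.single \<beta> 1 \<in> T" if "\<beta> \<in> Poly_Mapping.keys g" for \<beta>
      using that \<open>homog n d g\<close> by (auto simp: T_def C_def homog_def in_keys_iff)
    then show ?thesis
      by (subst mpol_sum_monomials) (intro mp.span_sum mp.span_scale mp.span_base)
  qed
  have inj: "inj_on e C" using eig_inj_on[of C n e] e C(2) by blast
  have ind: "mp.independent (e ` C)" using eig_independent_set[of C n e] e C(2) by blast
  have notin: "f \<notin> mp.span (e ` C)"
    using f mp.span_mono[of "e ` C" "e ` compositions n"] C(2) by blast
  \<comment> \<open>With f outside the span there would be one more independent vector than
    monomials of degree d.\<close>
  have "mp.independent (insert f (e ` C))" using ind notin by (rule mp.independent_insertI[rotated])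
  moreover have "insert f (e ` C) \<subseteq> mp.span T"
    using in_T assms by (auto simp: C_def)
  ultimately have "card (insert f (e ` C)) \<le> card T"
    using mp.independent_span_bound[of T] C(1) by (simp add: T_def)
  also have "\<dots> \<le> card C" unfolding T_def using C(1) by (rule card_image_le)
  finally show False
    using notin C(1) card_image[OF inj] mp.span_base[of f "e ` C"]
    by (simp add: card_insert_if split: if_splits)
qed

lemma poly_ring_in_span:
  assumes e: "\<And>\<mu>. \<mu> \<in> compositions n \<Longrightarrow> eig n \<mu> (e \<mu>) \<and> e \<mu> \<noteq> 0 \<and> homog n (csize n \<mu>) (e \<mu>)"
    and "f \<in> poly_ring n"
  shows "f \<in> mp.span (e ` compositions n)"
proof -
  have "Poly_Mapping.single \<beta> 1 \<in> mp.span (e ` compositions n)" if "\<beta> \<in> Poly_Mapping.keys f" for \<beta>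
    using that assms(2)
    by (intro homog_in_span[OF e, where d = "csize n \<beta>"])
      (auto simp: homog_def lookup_single when_def poly_ring_def split: if_splits)
  then show ?thesis
    by (subst mpol_sum_monomials) (intro mp.span_sum mp.span_scale)
qed

text \<open>Stated for an arbitrary family of eigenfunctions, since \<open>jackE\<close> is a
  definite description and becomes usable only after uniqueness is known.\<close>

lemma eig_unique_in_span:
  assumes e: "\<And>\<mu>. \<mu> \<in> compositions n \<Longrightarrow> eig n \<mu> (e \<mu>) \<and> e \<mu> \<noteq> 0"
    and "f \<in> mp.span (e ` compositions n)" "\<gamma> \<in> compositions n" "eig n \<gamma> f"
  obtains c where "f = mconst c * e \<gamma>"
proof -
  obtain A c where A: "finite A" "A \<subseteq> compositions n" "f = (\<Sum>\<mu>\<in>A. mconst (c \<mu>) * e \<mu>)"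
    using span_imageE[OF assms(2)] .
  have zero: "c \<mu> = 0" if \<mu>: "\<mu> \<in> A" "\<mu> \<noteq> \<gamma>" for \<mu>
  proof -
    obtain i where i: "i \<in> {1..n}" "spectral n \<mu> i \<noteq> spectral n \<gamma> i"
      using \<mu> A(2) assms(3) spectral_inj[of \<mu> n \<gamma>] by blast
    show ?thesis
      using eig_sum_coeff_0[of A n e f c i "spectral n \<gamma> i" \<mu>] A e assms(4) i \<mu>(1)
      unfolding eig_def by blast
  qed
  have "f = (\<Sum>\<mu>\<in>A. if \<mu> = \<gamma> then mconst (c \<gamma>) * e \<gamma> else 0)"
    unfolding A(3) using zero by (intro sum.cong refl) auto
  also have "\<dots> = mconst (if \<gamma> \<in> A then c \<gamma> else 0) * e \<gamma>"
    using A(1) by (simp add: sum.delta)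
  finally show thesis using that by blast
qed

lemma jackE_exists:
  assumes n: "1 \<le> n"
  shows "\<exists>e. \<forall>\<mu>\<in>compositions n. eig n \<mu> (e \<mu>) \<and> e \<mu> \<noteq> 0 \<and> homog n (csize n \<mu>) (e \<mu>) \<and> mcoeff (e \<mu>) \<mu> = 1"
proof -
  have "\<exists>f. eig n \<mu> f \<and> f \<noteq> 0 \<and> homog n (csize n \<mu>) f \<and> mcoeff f \<mu> = 1" if \<mu>: "\<mu> \<in> compositions n" for \<mu>
  proof -
    obtain f where f: "eig n \<mu> f" "homog n (csize n \<mu>) f"
      "\<And>\<beta>. infsml (mcoeff f \<beta> - (if \<beta> = \<mu> then 1 else 0))"
      using eigenfunction_exists[OF n \<mu>] by blast
    \<comment> \<open>If this coefficient were 0, then -1 would vanish at infinity.\<close>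
    have c: "mcoeff f \<mu> \<noteq> 0"
      using f(3)[of \<mu>] not_infsml_1 infsml_minus[of "-1"] by auto
    let ?g = "mconst (inverse (mcoeff f \<mu>)) * f"
    have "mcoeff ?g \<mu> = 1" using c by (simp add: mcoeff_mconst_times)
    moreover from this have "?g \<noteq> 0" by (metis lookup_zero zero_neq_one)
    moreover have "eig n \<mu> ?g" using f(1) by (simp add: eig_def cherednik_mconst mult.left_commute)
    ultimately show ?thesis using homog_mconst[OF f(2)] by blast
  qed
  then show ?thesis by (intro bchoice) blast
qed

lemma homog_poly_ring: "homog n d f \<Longrightarrow> f \<in> poly_ring n"
  by (auto simp: homog_def poly_ring_iff)

lemma
  assumes n: "1 \<le> n" and \<mu>: "\<mu> \<in> compositions n"
  shows jackE_eig: "eig n \<mu> (jackE n \<mu>)"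
    and jackE_homog: "homog n (csize n \<mu>) (jackE n \<mu>)"
    and mcoeff_jackE: "mcoeff (jackE n \<mu>) \<mu> = 1"
proof -
  obtain e where e: "\<And>\<mu>. \<mu> \<in> compositions n \<Longrightarrow>
      eig n \<mu> (e \<mu>) \<and> e \<mu> \<noteq> 0 \<and> homog n (csize n \<mu>) (e \<mu>) \<and> mcoeff (e \<mu>) \<mu> = 1"
    using jackE_exists[OF n] by blast
  have "jackE n \<mu> = e \<mu>"
    unfolding jackE_def
  proof (rule the_equality)
    show "e \<mu> \<in> poly_ring n \<and> (\<forall>i\<in>{1..n}. cherednik n i (e \<mu>) = mconst (spectral n \<mu> i) * e \<mu>)
        \<and> mcoeff (e \<mu>) \<mu> = 1"
      using e[OF \<mu>] homog_poly_ring by (auto simp: eig_def)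
    fix f assume f: "f \<in> poly_ring n \<and> (\<forall>i\<in>{1..n}. cherednik n i f = mconst (spectral n \<mu> i) * f)
        \<and> mcoeff f \<mu> = 1"
    then have "f \<in> mp.span (e ` compositions n)" "eig n \<mu> f"
      using poly_ring_in_span[of n e f] e by (auto simp: eig_def)
    then obtain c where "f = mconst c * e \<mu>"
      using eig_unique_in_span[of n e f \<mu>] e \<mu> by blast
    moreover from this have "c = 1" using f e[OF \<mu>] by (simp add: mcoeff_mconst_times)
    ultimately show "f = e \<mu>" by simp
  qed
  then show "eig n \<mu> (jackE n \<mu>)" "homog n (csize n \<mu>) (jackE n \<mu>)" "mcoeff (jackE n \<mu>) \<mu> = 1"
    using e[OF \<mu>] by simp_all
qed

lemma jackE_nonzero: "1 \<le> n \<Longrightarrow> \<mu> \<in> compositions n \<Longrightarrow> jackE n \<mu> \<noteq> 0"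
  by (metis mcoeff_jackE lookup_zero zero_neq_one)

lemma jackE_inj_on: "1 \<le> n \<Longrightarrow> inj_on (jackE n) (compositions n)"
  by (rule eig_inj_on) (auto simp: jackE_eig jackE_nonzero)

lemma jackE_independent: "1 \<le> n \<Longrightarrow> mp.independent (jackE n ` compositions n)"
  by (rule eig_independent_set) (auto simp: jackE_eig jackE_nonzero)

lemma jackE_span: "1 \<le> n \<Longrightarrow> f \<in> poly_ring n \<Longrightarrow> f \<in> mp.span (jackE n ` compositions n)"
  by (rule poly_ring_in_span) (auto simp: jackE_eig jackE_nonzero jackE_homog)

text \<open>The images of E_\<gamma> under \<Phi> and under the corrected swaps are identified in
  this way, by their eigenvalues and a single coefficient.\<close>

lemma eig_eq_jackE:
  assumes "1 \<le> n" "\<gamma> \<in> compositions n" "f \<in> poly_ring n" "eig n \<gamma> f"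
  shows "f = mconst (mcoeff f \<gamma>) * jackE n \<gamma>"
proof -
  obtain c where c: "f = mconst c * jackE n \<gamma>"
    using eig_unique_in_span[of n "jackE n" f \<gamma>] assms jackE_span jackE_eig jackE_nonzero by metis
  then have "mcoeff f \<gamma> = c" using assms by (simp add: mcoeff_mconst_times mcoeff_jackE)
  then show ?thesis using c by simp
qed

lemma raise_jackE:
  assumes "1 \<le> n" "\<gamma> \<in> compositions n"
  shows "raise n (jackE n \<gamma>) = jackE n (raisec n \<gamma>)"
  using eig_eq_jackE[of n "raisec n \<gamma>" "raise n (jackE n \<gamma>)"] assms
  by (simp add: raisec_compositions eig_raise jackE_eig mcoeff_raise_raisec mcoeff_jackE
      homog_poly_ring[OF homog_raise[OF _ jackE_homog]])

text \<open>The difference s_i E_\<gamma> - E_\<gamma> satisfies the eigenvalue equations of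
  \<gamma> with the values at i and i+1 exchanged. A composition with this spectrum would have the
  entries of \<gamma>, yet the two values of \<gamma> differ by 1. So no basis element can occur in
  the difference.\<close>

lemma act_adj_jackE_eq:
  assumes "1 \<le> i" "i < n" "\<gamma> \<in> compositions n" "part \<gamma> i = part \<gamma> (Suc i)"
  shows "act (adj i) (jackE n \<gamma>) = jackE n \<gamma>"
proof (rule ccontr)
  let ?E = "jackE n \<gamma>"
  let ?g = "act (adj i) ?E - ?E"
  assume "act (adj i) ?E \<noteq> ?E"
  then have g: "?g \<noteq> 0" by simp
  have n: "1 \<le> n" using assms by simp
  have E: "eig n \<gamma> ?E" using n assms by (simp add: jackE_eig)
  have sp: "mconst (spectral n \<gamma> i) = mconst (spectral n \<gamma> (Suc i)) + 1"
    using spectral_Suc_eq[OF assms(1,2,4)] by (simp add: mconst_add)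
  have e: "cherednik n j ?E = mconst (spectral n \<gamma> j) * ?E" if "j \<in> {1..n}" for j
    using E that by (simp add: eig_def)
  have ch: "cherednik n j ?g = mconst (spectral n \<gamma> (adj i j)) * ?g" if j: "j \<in> {1..n}" for j
  proof -
    consider "j = i" | "j = Suc i" | "j \<noteq> i" "j \<noteq> Suc i" by blast
    then show ?thesis
      by cases (use j assms in \<open>simp_all add: cherednik_diff cherednik_act_adj_eig[OF assms(1,2) E] e sp
          right_diff_distrib distrib_right\<close>)
  qed
  have "?g \<in> poly_ring n"
    by (intro homog_poly_ring[of _ "csize n \<gamma>"] homog_diff homog_act_adj jackE_homog n assms)
  from jackE_span[OF n this]
  obtain A c where A: "finite A" "A \<subseteq> compositions n" "?g = (\<Sum>\<mu>\<in>A. mconst (c \<mu>) * jackE n \<mu>)"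
    by (rule span_imageE)
  have "c \<mu> = 0" if \<mu>: "\<mu> \<in> A" for \<mu>
  proof -
    have "\<exists>j\<in>{1..n}. spectral n \<mu> j \<noteq> spectral n \<gamma> (adj i j)"
    proof (rule ccontr)
      assume "\<not> ?thesis"
      then have eq: "spectral n \<mu> j = spectral n \<gamma> (adj i j)" if "j \<in> {1..n}" for j
        using that by blast
      have "part \<mu> j = part \<gamma> j" if "j \<in> {1..n}" for j
        using spectral_eqD(1)[OF eq[OF that]] assms(4)
        by (auto simp: transpose_def split: if_splits)
      then have "\<mu> = \<gamma>" using \<mu> A(2) assms(3) by (intro compositions_eqI) auto
      then have "spectral n \<gamma> i = spectral n \<gamma> (Suc i)" using eq[of i] assms(1,2) by simp
      then show False using spectral_Suc_eq[OF assms(1,2,4)] by simp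
    qed
    then obtain j where j: "j \<in> {1..n}" "spectral n \<mu> j \<noteq> spectral n \<gamma> (adj i j)" by blast
    show ?thesis
      using eig_sum_coeff_0[of A n "jackE n" ?g c j "spectral n \<gamma> (adj i j)" \<mu>] A ch[OF j(1)] j \<mu>
        n jackE_eig jackE_nonzero by blast
  qed
  then have "?g = 0" unfolding A(3) by simp
  then show False using g by blast
qed

text \<open>If t were 0, then E_\<gamma> would be an eigenvector of the involution s_i with
  eigenvalue \<open>refl_coeff n \<gamma> i\<close>, contradicting \<open>refl_coeff_square\<close>.
  Only the nonvanishing of t enters later, so its value is left open.\<close>

lemma act_adj_jackE_neq:
  assumes "1 \<le> i" "i < n" "\<gamma> \<in> compositions n" "part \<gamma> i \<noteq> part \<gamma> (Suc i)"
  obtains t where "t \<noteq> 0"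
    "act (adj i) (jackE n \<gamma>) = mconst (refl_coeff n \<gamma> i) * jackE n \<gamma> + mconst t * jackE n (swapc i \<gamma>)"
proof -
  have n: "1 \<le> n" using assms by simp
  let ?E = "jackE n \<gamma>" and ?r = "refl_coeff n \<gamma> i"
  let ?g = "act (adj i) ?E - mconst ?r * ?E"
  have "?g \<in> poly_ring n"
    by (intro homog_poly_ring[of _ "csize n \<gamma>"] homog_diff homog_act_adj homog_mconst jackE_homog n assms)
  then have eq: "?g = mconst (mcoeff ?g (swapc i \<gamma>)) * jackE n (swapc i \<gamma>)"
    using n assms by (intro eig_eq_jackE eig_swap jackE_eig) (simp_all add: swapc_compositions)
  have "mcoeff ?g (swapc i \<gamma>) \<noteq> 0"
  proof
    assume "mcoeff ?g (swapc i \<gamma>) = 0"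
    then have h: "act (adj i) ?E = mconst ?r * ?E" using eq by simp
    have "?E = act (adj i) (mconst ?r * ?E)" by (simp only: act_transpose_transpose flip: h)
    also have "\<dots> = mconst (?r * ?r) * ?E"
      by (simp only: act_mconst_times bij_transpose h mconst_mult mult.assoc)
    finally have "mcoeff ?E \<gamma> = ?r * ?r * mcoeff ?E \<gamma>"
      by (metis mcoeff_mconst_times)
    then show False using refl_coeff_square[OF assms(4)] mcoeff_jackE[OF n assms(3)] by simp
  qed
  then show thesis using that eq by (metis diff_add_cancel add.commute)
qed

section \<open>Expansion in nonsymmetric Jack polynomials\<close>

lemma poly_ring_add: "f \<in> poly_ring n \<Longrightarrow> g \<in> poly_ring n \<Longrightarrow> f + g \<in> poly_ring n"
  by (simp add: poly_ring_iff lookup_add)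

lemma poly_ring_0 [simp]: "0 \<in> poly_ring n"
  by (simp add: poly_ring_iff)

lemma poly_ring_mconst: "f \<in> poly_ring n \<Longrightarrow> mconst c * f \<in> poly_ring n"
  by (simp add: poly_ring_iff mcoeff_mconst_times)

lemma poly_ring_sum: "(\<And>i. i \<in> I \<Longrightarrow> f i \<in> poly_ring n) \<Longrightarrow> sum f I \<in> poly_ring n"
  by (induction I rule: infinite_finite_induct) (auto intro: poly_ring_add)

lemma poly_ring_mvar:
  assumes "i \<in> {1..n}" "f \<in> poly_ring n"
  shows "mvar i * f \<in> poly_ring n"
  unfolding poly_ring_iff
proof (intro allI impI)
  fix \<beta> assume "\<beta> \<notin> compositions n"
  then have "\<beta> - unit_comp i \<notin> compositions n"
    using assms(1) by (auto simp: compositions_iff lookup_minus part_unit_comp split: if_splits)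
  then show "mcoeff (mvar i * f) \<beta> = 0"
    using assms by (simp add: mcoeff_mvar_times poly_ring_iff)
qed

lemma poly_ring_e1: "f \<in> poly_ring n \<Longrightarrow> e1 n * f \<in> poly_ring n"
  unfolding e1_def sum_distrib_right by (intro poly_ring_sum poly_ring_mvar)

lemma poly_ring_act_adj: "1 \<le> i \<Longrightarrow> i < n \<Longrightarrow> f \<in> poly_ring n \<Longrightarrow> act (adj i) f \<in> poly_ring n"
  by (simp add: poly_ring_iff mcoeff_act_adj swapc_compositions)

lemma poly_ring_jackE: "1 \<le> n \<Longrightarrow> \<mu> \<in> compositions n \<Longrightarrow> jackE n \<mu> \<in> poly_ring n"
  using jackE_homog homog_poly_ring by blast

lemma jackE_induct [consumes 2, case_names zero add]:
  assumes n: "1 \<le> n" and "f \<in> poly_ring n" and "P 0"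
    and "\<And>c \<mu> g. \<mu> \<in> compositions n \<Longrightarrow> g \<in> poly_ring n \<Longrightarrow> P g \<Longrightarrow> P (mconst c * jackE n \<mu> + g)"
  shows "P f"
proof -
  have "f \<in> poly_ring n \<and> P f"
    using jackE_span[OF n assms(2)]
    by (induction rule: mp.span_induct_alt)
      (use assms(3,4) n in \<open>auto intro!: poly_ring_add poly_ring_mconst poly_ring_jackE\<close>)
  then show ?thesis ..
qed

text \<open>The coefficient of E_\<mu> in f. The underlying \<open>representation\<close> is indexed
  by basis vectors; \<open>jackE_inj_on\<close> is what permits compositions as indices.\<close>

definition jcoef :: "nat \<Rightarrow> mpol \<Rightarrow> comp \<Rightarrow> ratfun" where
  "jcoef n f \<mu> = mp.representation (jackE n ` compositions n) f (jackE n \<mu>)"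

lemma jcoef_0 [simp]: "1 \<le> n \<Longrightarrow> jcoef n 0 \<mu> = 0"
  by (simp add: jcoef_def mp.representation_zero)

lemma jcoef_add:
  "1 \<le> n \<Longrightarrow> f \<in> poly_ring n \<Longrightarrow> g \<in> poly_ring n \<Longrightarrow> jcoef n (f + g) \<mu> = jcoef n f \<mu> + jcoef n g \<mu>"
  by (simp add: jcoef_def mp.representation_add jackE_independent jackE_span)

lemma jcoef_mconst: "1 \<le> n \<Longrightarrow> f \<in> poly_ring n \<Longrightarrow> jcoef n (mconst c * f) \<mu> = c * jcoef n f \<mu>"
  by (simp add: jcoef_def mp.representation_scale jackE_independent jackE_span)

lemma jcoef_sum:
  assumes "1 \<le> n" "\<And>i. i \<in> I \<Longrightarrow> f i \<in> poly_ring n"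
  shows "jcoef n (\<Sum>i\<in>I. f i) \<mu> = (\<Sum>i\<in>I. jcoef n (f i) \<mu>)"
  using assms(2)
proof (induction I rule: infinite_finite_induct)
  case (insert x I)
  then show ?case using jcoef_add[OF assms(1)] poly_ring_sum[of I f n] by simp
qed (use assms(1) in auto)

lemma jcoef_jackE:
  assumes "1 \<le> n" "\<nu> \<in> compositions n" "\<mu> \<in> compositions n"
  shows "jcoef n (jackE n \<nu>) \<mu> = (if \<mu> = \<nu> then 1 else 0)"
proof -
  have "jackE n \<mu> = jackE n \<nu> \<longleftrightarrow> \<mu> = \<nu>"
    using jackE_inj_on[OF assms(1)] assms by (auto simp: inj_on_def)
  then show ?thesis
    using assms by (simp add: jcoef_def mp.representation_basis jackE_independent)
qed

lemma jcoef_mconst_jackE_add: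
  assumes "1 \<le> n" "\<nu> \<in> compositions n" "\<mu> \<in> compositions n" "g \<in> poly_ring n"
  shows "jcoef n (mconst c * jackE n \<nu> + g) \<mu> = (if \<mu> = \<nu> then c else 0) + jcoef n g \<mu>"
  using assms by (simp add: jcoef_add jcoef_mconst poly_ring_mconst poly_ring_jackE jcoef_jackE)

lemma jcoef_cherednik:
  assumes n: "1 \<le> n" and "f \<in> poly_ring n" "i \<in> {1..n}" "\<mu> \<in> compositions n"
  shows "cherednik n i f \<in> poly_ring n \<and> jcoef n (cherednik n i f) \<mu> = spectral n \<mu> i * jcoef n f \<mu>"
  using n assms(2)
proof (induction rule: jackE_induct)
  case (add c \<nu> g)
  have eq: "cherednik n i (mconst c * jackE n \<nu> + g)
      = mconst (c * spectral n \<nu> i) * jackE n \<nu> + cherednik n i g"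
    using jackE_eig[OF n add(1)] assms(3)
    by (simp add: cherednik_add cherednik_mconst eig_def)
  show ?case
    unfolding eq using add assms(3,4) n
    by (simp add: jcoef_mconst_jackE_add poly_ring_add poly_ring_mconst poly_ring_jackE
        distrib_left mult.commute[of c] mult.left_commute[of _ c])
qed (use n in auto)

lemma jcoef_raise:
  assumes n: "1 \<le> n" and "f \<in> poly_ring n"
  shows "raise n f \<in> poly_ring n \<and> (\<forall>\<mu>\<in>compositions n. jcoef n (raise n f) (raisec n \<mu>) = jcoef n f \<mu>)
    \<and> (\<forall>\<mu>\<in>compositions n. part \<mu> n = 0 \<longrightarrow> jcoef n (raise n f) \<mu> = 0)"
  using n assms(2)
proof (induction rule: jackE_induct)
  case zero
  have "raise n 0 = 0" using n by (simp add: raise_def bij_rot)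
  then show ?case using n by simp
next
  case (add c \<nu> g)
  have eq: "raise n (mconst c * jackE n \<nu> + g) = mconst c * jackE n (raisec n \<nu>) + raise n g"
    using n add(1) by (simp add: raise_add raise_mconst raise_jackE)
  have "part (raisec n \<nu>) n \<noteq> 0" using part_raisec[of n n \<nu>] n by simp
  then show ?case
    unfolding eq using add n
    by (auto simp: jcoef_mconst_jackE_add raisec_compositions poly_ring_add poly_ring_mconst poly_ring_jackE)
qed

lemma jcoef_act_adj_eq:
  assumes n: "1 \<le> i" "i < n" and "\<mu> \<in> compositions n" "part \<mu> i = part \<mu> (Suc i)" "f \<in> poly_ring n"
  shows "jcoef n (act (adj i) f) \<mu> = jcoef n f \<mu>"
proof -
  have n1: "1 \<le> n" using n by simp
  then show ?thesis using assms(5)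
  proof (induction rule: jackE_induct)
    case (add c \<nu> g)
    note closed = poly_ring_act_adj[OF n] poly_ring_add poly_ring_mconst poly_ring_jackE[OF n1]
      swapc_compositions[OF n]
    show ?case
    proof (cases "part \<nu> i = part \<nu> (Suc i)")
      case True
      with add n1 assms show ?thesis
        by (simp add: act_add act_mconst_times act_adj_jackE_eq jcoef_mconst_jackE_add closed)
    next
      case False
      obtain t where t: "act (adj i) (jackE n \<nu>)
          = mconst (refl_coeff n \<nu> i) * jackE n \<nu> + mconst t * jackE n (swapc i \<nu>)"
        using act_adj_jackE_neq[OF n add(1) False] by blast
      have "\<mu> \<noteq> \<nu>" using False assms by auto
      moreover have "\<mu> \<noteq> swapc i \<nu>" using False assms(4) by (auto simp: part_swapc)
      moreover have eq: "act (adj i) (mconst c * jackE n \<nu> + g) = mconst (c * refl_coeff n \<nu> i) * jackE n \<nu>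
          + (mconst (c * t) * jackE n (swapc i \<nu>) + act (adj i) g)"
        by (simp add: act_add act_mconst_times t distrib_left add.assoc)
      ultimately show ?thesis
        unfolding eq using add n1 assms(3) by (simp add: jcoef_mconst_jackE_add closed)
    qed
  qed simp
qed

text \<open>The matrix of s_i read by target instead of source: E_\<mu> arises only from itself and
  from E of s_i \<mu>. Taking t before f makes it one constant for all polynomials.\<close>

lemma jcoef_act_adj_neq:
  assumes n: "1 \<le> i" "i < n" and mu: "\<mu> \<in> compositions n" "part \<mu> i \<noteq> part \<mu> (Suc i)"
  obtains t where "t \<noteq> 0"
    "\<And>f. f \<in> poly_ring n \<Longrightarrow>
      jcoef n (act (adj i) f) \<mu> = refl_coeff n \<mu> i * jcoef n f \<mu> + t * jcoef n f (swapc i \<mu>)"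
proof -
  have n1: "1 \<le> n" using n by simp
  have mu_s: "swapc i \<mu> \<in> compositions n" "part (swapc i \<mu>) i \<noteq> part (swapc i \<mu>) (Suc i)"
    using mu by (simp_all add: swapc_compositions[OF n] part_swapc)
  obtain t where t: "t \<noteq> 0" "act (adj i) (jackE n (swapc i \<mu>))
      = mconst (refl_coeff n (swapc i \<mu>) i) * jackE n (swapc i \<mu>) + mconst t * jackE n \<mu>"
    using act_adj_jackE_neq[OF n mu_s] by (metis swapc_swapc)
  have "jcoef n (act (adj i) f) \<mu> = refl_coeff n \<mu> i * jcoef n f \<mu> + t * jcoef n f (swapc i \<mu>)"
    if "f \<in> poly_ring n" for f
    using n1 that
  proof (induction rule: jackE_induct)
    case (add c \<nu> g)
    note closed = poly_ring_act_adj[OF n] poly_ring_add poly_ring_mconst poly_ring_jackE[OF n1]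
      swapc_compositions[OF n]
    show ?case
    proof (cases "part \<nu> i = part \<nu> (Suc i)")
      case True
      then have "\<mu> \<noteq> \<nu>" "swapc i \<mu> \<noteq> \<nu>" using mu mu_s by auto
      with True add n1 mu n show ?thesis
        by (simp add: act_add act_mconst_times act_adj_jackE_eq jcoef_mconst_jackE_add closed)
    next
      case False
      obtain u where u: "act (adj i) (jackE n \<nu>)
          = mconst (refl_coeff n \<nu> i) * jackE n \<nu> + mconst u * jackE n (swapc i \<nu>)"
        using act_adj_jackE_neq[OF n add(1) False] by blast
      \<comment> \<open>Both factors come from existence statements, so they must be shown to agree
        when \<nu> is the partner of \<mu>.\<close>
      have tu: "u = t" if "\<nu> = swapc i \<mu>"
      proof -
        have "mconst u * jackE n \<mu> = mconst t * jackE n \<mu>"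
          using u t(2) unfolding that swapc_swapc by (metis add_left_cancel)
        then show ?thesis using jackE_nonzero[OF n1 mu(1)] by (metis mp.scale_cancel_right)
      qed
      have eq: "act (adj i) (mconst c * jackE n \<nu> + g) = mconst (c * refl_coeff n \<nu> i) * jackE n \<nu>
          + (mconst (c * u) * jackE n (swapc i \<nu>) + act (adj i) g)"
        by (simp add: act_add act_mconst_times u distrib_left add.assoc)
      have sw: "\<mu> = swapc i \<nu> \<longleftrightarrow> swapc i \<mu> = \<nu>" by auto
      have ne: "swapc i \<mu> \<noteq> \<mu>" using mu(2) by (metis part_swapc transpose_apply_first)
      show ?thesis
        unfolding eq using add n1 mu tu ne
        by (simp add: jcoef_mconst_jackE_add closed sw) (auto simp: distrib_left mult_ac)
    qed
  qed (use n1 in simp)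
  then show thesis using that t(1) by blast
qed

section \<open>Multiplication by e_1 and by a single variable\<close>

definition pieri_e1 :: "nat \<Rightarrow> comp \<Rightarrow> comp \<Rightarrow> ratfun" where
  "pieri_e1 n \<eta> \<mu> = jcoef n (e1 n * jackE n \<eta>) \<mu>"

lemma jcoef_mvar_jackE:
  assumes n: "1 \<le> n" and "k \<in> {1..n}" "\<eta> \<in> compositions n" "\<mu> \<in> compositions n"
  shows "\<alpha> * jcoef n (mvar k * jackE n \<eta>) \<mu> = (spectral n \<mu> k - spectral n \<eta> k) * pieri_e1 n \<eta> \<mu>"
proof -
  let ?E = "jackE n \<eta>"
  have E: "?E \<in> poly_ring n" using n assms poly_ring_jackE by blast
  have "cherednik n k (e1 n * ?E) = mconst (spectral n \<eta> k) * (e1 n * ?E) + mconst \<alpha> * (mvar k * ?E)"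
    using jackE_eig[OF n assms(3)] assms(2) by (simp add: cherednik_e1_times eig_def mult.left_commute)
  then have "spectral n \<mu> k * pieri_e1 n \<eta> \<mu>
      = jcoef n (mconst (spectral n \<eta> k) * (e1 n * ?E) + mconst \<alpha> * (mvar k * ?E)) \<mu>"
    using jcoef_cherednik[OF n poly_ring_e1[OF E] assms(2,4)] by (simp add: pieri_e1_def)
  also have "\<dots> = spectral n \<eta> k * pieri_e1 n \<eta> \<mu> + \<alpha> * jcoef n (mvar k * ?E) \<mu>"
    using n assms(2) E
    by (simp add: jcoef_add jcoef_mconst poly_ring_mconst poly_ring_e1 poly_ring_mvar pieri_e1_def)
  finally show ?thesis by (simp add: algebra_simps)
qed

lemma pieri_e1_raisec:
  assumes "1 \<le> n" "\<eta> \<in> compositions n" "\<mu> \<in> compositions n"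
  shows "pieri_e1 n (raisec n \<eta>) (raisec n \<mu>) = pieri_e1 n \<eta> \<mu>"
  using jcoef_raise[OF assms(1) poly_ring_e1[OF poly_ring_jackE[OF assms(1,2)]]] assms
  by (simp add: pieri_e1_def raise_e1_times raise_jackE)

text \<open>\<open>down n d = s\<^sub>n\<^sub>-\<^sub>d \<cdots> s\<^sub>n\<^sub>-\<^sub>1\<close>, so that \<open>x\<^sub>n = \<Phi> s\<^sub>1 \<cdots> s\<^sub>n\<^sub>-\<^sub>1\<close> with the raising operator \<open>\<Phi>\<close>.\<close>

primrec down :: "nat \<Rightarrow> nat \<Rightarrow> mpol \<Rightarrow> mpol" where
  "down n 0 f = f"
| "down n (Suc d) f = act (adj (n - Suc d)) (down n d f)"

lemma poly_ring_down: "d < n \<Longrightarrow> f \<in> poly_ring n \<Longrightarrow> down n d f \<in> poly_ring n"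
  by (induction d) (auto intro!: poly_ring_act_adj)

lemma down_act:
  assumes "d < n"
  defines "u \<equiv> \<lambda>d i. if i = n then n - d else if n - d \<le> i \<and> i < n then i + 1 else i"
  shows "bij (u d) \<and> down n d f = act (u d) f"
  using assms(1)
proof (induction d)
  case 0
  have "u 0 = id" by (auto simp: u_def fun_eq_iff)
  then show ?case by (simp only: down.simps act_id bij_id simp_thms)
next
  case (Suc d)
  have "u (Suc d) = adj (n - Suc d) \<circ> u d"
    using Suc.prems by (auto simp: u_def fun_eq_iff transpose_def)
  then show ?case using Suc by (simp only: act_act bij_comp down.simps bij_transpose Suc_lessD simp_thms)
qed

text \<open>For d = n - 1 the cycle in \<open>down_act\<close> is inverse to \<open>rot n\<close>.
  The permutations cancel and only the factor x_n of \<Phi> remains.\<close>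

lemma raise_down:
  assumes "1 \<le> n"
  shows "raise n (down n (n - 1) f) = mvar n * f"
proof -
  let ?u = "\<lambda>i. if i = n then n - (n - 1) else if n - (n - 1) \<le> i \<and> i < n then i + 1 else i"
  have u: "bij ?u" "down n (n - 1) f = act ?u f"
    using down_act[of "n - 1" n f] assms by simp_all
  have "rot n \<circ> ?u = id" using assms by (auto simp: rot_def fun_eq_iff)
  with u(1) have "act (rot n) (act ?u f) = f" using assms by (simp only: act_act bij_rot act_id)
  then show ?thesis unfolding raise_def u(2) by simp
qed

text \<open>By \<open>jcoef_down\<close>, the support of
  \<open>down n d (jackE n \<eta>)\<close>.\<close>

primrec reach :: "nat \<Rightarrow> comp \<Rightarrow> nat \<Rightarrow> comp set" where
  "reach n \<eta> 0 = {\<eta>}"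
| "reach n \<eta> (Suc d) = {\<mu>. \<mu> \<in> reach n \<eta> d \<or> swapc (n - Suc d) \<mu> \<in> reach n \<eta> d}"

text \<open>The first d swaps involve only positions from n - d on. The next swap therefore meets an
  original entry on its left, which excludes collisions in \<open>jcoef_down\<close>.\<close>

lemma reach_part: "\<mu> \<in> reach n \<eta> d \<Longrightarrow> i < n - d \<Longrightarrow> part \<mu> i = part \<eta> i"
proof (induction d arbitrary: \<mu>)
  case (Suc d)
  then have "part (swapc (n - Suc d) \<mu>) i = part \<mu> i" by (simp add: part_swapc)
  with Suc show ?case by auto
qed simp

text \<open>No cancellation occurs: \<open>\<mu>\<close> and \<open>s\<^sub>i \<mu>\<close> are both reached only if they are equal.\<close>

lemma jcoef_down:
  assumes n: "d < n" and \<eta>: "\<eta> \<in> compositions n" and "\<mu> \<in> compositions n"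
  shows "jcoef n (down n d (jackE n \<eta>)) \<mu> \<noteq> 0 \<longleftrightarrow> \<mu> \<in> reach n \<eta> d"
  using assms(1,3)
proof (induction d arbitrary: \<mu>)
  case 0
  then show ?case using \<eta> by (auto simp: jcoef_jackE)
next
  case (Suc d)
  let ?i = "n - Suc d" and ?f = "down n d (jackE n \<eta>)"
  have i: "1 \<le> ?i" "?i < n" and d: "d < n" and Suc_i: "Suc ?i = n - d" using Suc.prems by auto
  have f: "?f \<in> poly_ring n" using d \<eta> by (intro poly_ring_down poly_ring_jackE) auto
  note IH = Suc.IH[OF d]
  have s: "swapc ?i \<mu> \<in> compositions n" using Suc.prems swapc_compositions[OF i] by blast
  show ?case
  proof (cases "part \<mu> ?i = part \<mu> (Suc ?i)")
    case True
    then show ?thesis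
      using jcoef_act_adj_eq[OF i Suc.prems(2) True f] IH[OF Suc.prems(2)] swapc_id[OF True] by simp
  next
    case False
    obtain t where t: "t \<noteq> 0" "jcoef n (act (adj ?i) ?f) \<mu>
        = refl_coeff n \<mu> ?i * jcoef n ?f \<mu> + t * jcoef n ?f (swapc ?i \<mu>)"
      using jcoef_act_adj_neq[OF i Suc.prems(2) False] f by metis
    have "\<not> (\<mu> \<in> reach n \<eta> d \<and> swapc ?i \<mu> \<in> reach n \<eta> d)"
    proof
      assume "\<mu> \<in> reach n \<eta> d \<and> swapc ?i \<mu> \<in> reach n \<eta> d"
      then have "part \<mu> ?i = part \<eta> ?i" "part (swapc ?i \<mu>) ?i = part \<eta> ?i"
        using reach_part[of _ n \<eta> d ?i] Suc_i by auto
      then show False using False by (simp add: part_swapc)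
    qed
    then show ?thesis
      using t refl_coeff_nonzero[OF False] IH[OF Suc.prems(2)] IH[OF s] by auto
  qed
qed

section \<open>Multiplication by the sum of the variables\<close>

text \<open>The operator \<open>c\<^sub>L\<close> puts this value at \<open>k\<close> if \<open>k \<in> L\<close>. For arbitrary \<open>k\<close>, the positions up to \<open>k\<close>
  together lose the entry at \<open>Min L\<close> and gain this value.\<close>

definition nxt :: "nat set \<Rightarrow> comp \<Rightarrow> nat \<Rightarrow> nat" where
  "nxt L \<eta> k = (if \<forall>x\<in>L. x \<le> k then part \<eta> (Min L) + 1 else part \<eta> (Min {m \<in> L. k < m}))"

lemma part_cycle_op_nxt:
  assumes "finite L"
  shows "part (cycle_op L \<eta>) i = (if i \<in> L then nxt L \<eta> i else part \<eta> i)"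
proof -
  have "i = Max L \<longleftrightarrow> (\<forall>x\<in>L. x \<le> i)" if "i \<in> L"
    using assms that Max_eqI[of L i] Max_ge[of L] by auto
  then show ?thesis using assms by (auto simp: part_cycle_op nxt_def)
qed

lemma nxt_eq:
  assumes "finite L" "m \<in> L" "k < m" "\<And>x. x \<in> L \<Longrightarrow> k < x \<Longrightarrow> m \<le> x"
  shows "nxt L \<eta> k = part \<eta> m"
proof -
  have "Min {m \<in> L. k < m} = m" using assms by (intro Min_eqI) auto
  then show ?thesis using assms by (auto simp: nxt_def not_le)
qed

lemma nxt_top:
  assumes "finite L" "m \<in> L" "\<And>x. x \<in> L \<Longrightarrow> x \<le> k" "\<And>x. x \<in> L \<Longrightarrow> m \<le> x"
  shows "nxt L \<eta> k = part \<eta> m + 1"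
proof -
  have "Min L = m" using assms by (intro Min_eqI) auto
  then show ?thesis using assms by (auto simp: nxt_def)
qed

lemma nxt_cases [consumes 2, case_names above top]:
  assumes "finite L" "L \<noteq> {}"
  obtains (above) m where "m \<in> L" "k < m" "\<And>x. x \<in> L \<Longrightarrow> k < x \<Longrightarrow> m \<le> x" "nxt L \<eta> k = part \<eta> m"
  | (top) m where "m \<in> L" "\<And>x. x \<in> L \<Longrightarrow> x \<le> k" "\<And>x. x \<in> L \<Longrightarrow> m \<le> x" "nxt L \<eta> k = part \<eta> m + 1"
proof (cases "\<forall>x\<in>L. x \<le> k")
  case True
  then show thesis using top[of "Min L"] assms by (simp add: nxt_def)
next
  case False
  let ?M = "{m \<in> L. k < m}"
  have "finite ?M" "?M \<noteq> {}" using assms False by auto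
  then have "Min ?M \<in> ?M" by (rule Min_in)
  moreover have "Min ?M \<le> x" if "x \<in> ?M" for x using that assms(1) by (intro Min_le) auto
  ultimately show thesis using above[of "Min ?M"] False by (auto simp: nxt_def)
qed

lemma nxt_0: "finite L \<Longrightarrow> L \<noteq> {} \<Longrightarrow> 0 \<notin> L \<Longrightarrow> nxt L \<eta> 0 = part \<eta> (Min L)"
  by (intro nxt_eq) (auto intro: Min_in gr0I)

text \<open>An entry travels from position n to the left. L contains n and the positions at which a
  swap is declined: there the traveller stays behind and the entry met travels on. The current
  traveller, now at m, is the entry that started at Min L, which is \<open>nxt L \<eta> 0\<close>.
  Behind it everything is shifted by one to the right, which \<open>raisec\<close> undoes in the
  end.\<close>

definition path_part :: "nat \<Rightarrow> comp \<Rightarrow> nat \<Rightarrow> nat set \<Rightarrow> nat \<Rightarrow> nat" where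
  "path_part n \<eta> m L i = (if i < m then part \<eta> i else if i = m then nxt L \<eta> 0
     else if i \<le> n then part (cycle_op L \<eta>) (i - 1) else 0)"

text \<open>The swap at m is declined: the composition stays as it is and m joins L.\<close>

lemma path_part_insert:
  assumes "1 \<le> m" "m < n" "L \<subseteq> {Suc m..n}" "n \<in> L"
  shows "path_part n \<eta> m (insert m L) = path_part n \<eta> (Suc m) L"
proof
  fix i
  have fin: "finite L" using assms(3) finite_subset by blast
  have upper: "nxt (insert m L) \<eta> j = nxt L \<eta> j" if "m \<le> j" "j < n" for j
  proof -
    have "L \<noteq> {}" using assms(4) by auto
    with fin show ?thesis
    proof (cases rule: nxt_cases[where k = j and \<eta> = \<eta>])
      case (above m')
      then have "nxt (insert m L) \<eta> j = part \<eta> m'" using fin that by (intro nxt_eq) auto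
      then show ?thesis using above(4) by simp
    next
      case (top m')
      then show ?thesis using assms(4) that by fastforce
    qed
  qed
  have low: "nxt (insert m L) \<eta> 0 = part \<eta> m" using fin assms by (intro nxt_eq) auto
  have "nxt L \<eta> m = nxt L \<eta> 0"
  proof -
    have "L \<noteq> {}" using assms(4) by auto
    with fin show ?thesis
    proof (cases rule: nxt_cases[where k = m and \<eta> = \<eta>])
      case (above m')
      have "nxt L \<eta> 0 = part \<eta> m'"
        using fin above(1,2) assms(3) by (intro nxt_eq) (auto intro!: above(3) simp: Suc_le_eq subset_eq)
      then show ?thesis using above(4) by simp
    next
      case (top m')
      then show ?thesis using assms(2,4) by fastforce
    qed
  qed
  moreover have "i < m \<or> i = m \<or> i = Suc m \<or> Suc m < i" by linarith
  ultimately show "path_part n \<eta> m (insert m L) i = path_part n \<eta> (Suc m) L i"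
    using upper[of "i - 1"] low upper[of m] assms
    by (elim disjE; auto simp: path_part_def part_cycle_op_nxt fin)
qed

text \<open>The swap at m is carried out: m stays outside L, so c_L keeps the entry at m, and this
  entry moves to m+1.\<close>

lemma path_part_adj:
  assumes "1 \<le> m" "m < n" "L \<subseteq> {Suc m..n}"
  shows "path_part n \<eta> m L i = path_part n \<eta> (Suc m) L (adj m i)"
proof -
  have "finite L" "m \<notin> L" using assms(3) finite_subset by auto
  then have c: "part (cycle_op L \<eta>) m = part \<eta> m" by (simp add: part_cycle_op_nxt)
  consider "i = m" | "i = Suc m" | "i < m" | "Suc m < i" by linarith
  then show ?thesis
    by cases (use assms c in \<open>simp_all add: path_part_def\<close>)
qed

lemma reach_iff:
  assumes "d < n" "\<eta> \<in> compositions n"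
  shows "\<mu> \<in> reach n \<eta> d \<longleftrightarrow> (\<exists>L \<subseteq> {n - d..n}. n \<in> L \<and> part \<mu> = path_part n \<eta> (n - d) L)"
  using assms(1)
proof (induction d arbitrary: \<mu>)
  case 0
  have "nxt {n} \<eta> 0 = part \<eta> n" using 0 by (intro nxt_eq) auto
  then have "path_part n \<eta> n {n} = part \<eta>"
    using assms(2) by (auto simp: path_part_def fun_eq_iff compositions_iff)
  then have "\<mu> = \<eta> \<longleftrightarrow> part \<mu> = path_part n \<eta> n {n}" by (simp only: poly_mapping_eq_iff)
  moreover have "L \<subseteq> {n..n} \<and> n \<in> L \<longleftrightarrow> L = {n}" for L by auto
  ultimately show ?case unfolding reach.simps diff_zero singleton_iff by metis
next
  case (Suc d)
  define m where "m = n - Suc d"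
  have m: "1 \<le> m" "m < n" "n - d = Suc m" using Suc.prems by (auto simp: m_def)
  have d: "d < n" using Suc.prems by simp
  note IH = Suc.IH[OF d, unfolded m(3)]
  have adj: "part (swapc m \<mu>) = path_part n \<eta> (Suc m) L \<longleftrightarrow> part \<mu> = path_part n \<eta> m L"
    if "L \<subseteq> {Suc m..n}" for L
  proof -
    have "part (swapc m \<mu>) = path_part n \<eta> (Suc m) L
        \<longleftrightarrow> (\<forall>i. part \<mu> (adj m i) = path_part n \<eta> m L (adj m i))"
      using path_part_adj[OF m(1,2) that, of \<eta>] by (simp add: fun_eq_iff part_swapc)
    also have "\<dots> \<longleftrightarrow> part \<mu> = path_part n \<eta> m L"
      by (metis ext transpose_involutory)
    finally show ?thesis .
  qed
  have "\<mu> \<in> reach n \<eta> (Suc d)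
    \<longleftrightarrow> (\<exists>L \<subseteq> {Suc m..n}. n \<in> L \<and> part \<mu> = path_part n \<eta> m (insert m L))
      \<or> (\<exists>L \<subseteq> {Suc m..n}. n \<in> L \<and> part \<mu> = path_part n \<eta> m L)"
  proof -
    have "\<mu> \<in> reach n \<eta> d \<longleftrightarrow> (\<exists>L \<subseteq> {Suc m..n}. n \<in> L \<and> part \<mu> = path_part n \<eta> m (insert m L))"
      unfolding IH by (intro ex_cong1 conj_cong refl) (simp only: path_part_insert[OF m(1,2)])
    moreover have "swapc m \<mu> \<in> reach n \<eta> d
        \<longleftrightarrow> (\<exists>L \<subseteq> {Suc m..n}. n \<in> L \<and> part \<mu> = path_part n \<eta> m L)"
      unfolding IH by (intro ex_cong1 conj_cong refl) (simp only: adj)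
    ultimately show ?thesis by (simp only: reach.simps mem_Collect_eq flip: m_def)
  qed
  also have "\<dots> \<longleftrightarrow> (\<exists>L \<subseteq> {m..n}. n \<in> L \<and> part \<mu> = path_part n \<eta> m L)"
  proof (intro iffI)
    assume "\<exists>L \<subseteq> {m..n}. n \<in> L \<and> part \<mu> = path_part n \<eta> m L"
    then obtain L where L: "L \<subseteq> {m..n}" "n \<in> L" "part \<mu> = path_part n \<eta> m L" by blast
    show "(\<exists>L \<subseteq> {Suc m..n}. n \<in> L \<and> part \<mu> = path_part n \<eta> m (insert m L))
      \<or> (\<exists>L \<subseteq> {Suc m..n}. n \<in> L \<and> part \<mu> = path_part n \<eta> m L)"
    proof (cases "m \<in> L")
      case True
      have "L - {m} \<subseteq> {Suc m..n}"
      proof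
        fix x assume "x \<in> L - {m}"
        then have "m \<le> x" "x \<le> n" "x \<noteq> m" using L(1) by auto
        then show "x \<in> {Suc m..n}" by simp
      qed
      moreover have "n \<in> L - {m}" using L(2) m(2) by simp
      moreover have "part \<mu> = path_part n \<eta> m (insert m (L - {m}))"
        using L(3) by (simp only: insert_Diff[OF True])
      ultimately show ?thesis by blast
    next
      case False
      have "L \<subseteq> {Suc m..n}"
      proof
        fix x assume "x \<in> L"
        then have "m \<le> x" "x \<le> n" "x \<noteq> m" using L(1) False by auto
        then show "x \<in> {Suc m..n}" by simp
      qed
      then show ?thesis using L(2,3) by blast
    qed
  next
    assume "(\<exists>L \<subseteq> {Suc m..n}. n \<in> L \<and> part \<mu> = path_part n \<eta> m (insert m L))
      \<or> (\<exists>L \<subseteq> {Suc m..n}. n \<in> L \<and> part \<mu> = path_part n \<eta> m L)"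
    moreover have "{Suc m..n} \<subseteq> {m..n}" "m \<in> {m..n}" using m by auto
    ultimately show "\<exists>L \<subseteq> {m..n}. n \<in> L \<and> part \<mu> = path_part n \<eta> m L"
      by (metis insertI2 insert_subset subset_trans)
  qed
  finally show ?case by (simp only: m_def)
qed

lemma cycle_op_compositions:
  "L \<subseteq> {1..n} \<Longrightarrow> \<eta> \<in> compositions n \<Longrightarrow> cycle_op L \<eta> \<in> compositions n"
  using finite_subset[of L "{1..n}"] by (auto simp: compositions_iff part_cycle_op_nxt)

text \<open>With m = 1 the traveller has arrived at position 1. Raising brings it to n, adds one to
  it and moves all other entries back by one position; the result is c_L.\<close>

lemma raisec_reach_iff:
  assumes n: "1 \<le> n" and \<eta>: "\<eta> \<in> compositions n" and \<mu>: "\<mu> \<in> compositions n"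
  shows "\<mu> \<in> reach n \<eta> (n - 1) \<longleftrightarrow> (\<exists>L \<subseteq> {1..n}. n \<in> L \<and> raisec n \<mu> = cycle_op L \<eta>)"
proof -
  have "part \<mu> = path_part n \<eta> 1 L \<longleftrightarrow> raisec n \<mu> = cycle_op L \<eta>" if L: "L \<subseteq> {1..n}" "n \<in> L" for L
  proof -
    have fin: "finite L" using L(1) finite_subset by blast
    have "0 \<notin> L" "L \<noteq> {}" using L by auto
    then have top: "part (cycle_op L \<eta>) n = nxt L \<eta> 0 + 1"
      using fin L nxt_0[of L \<eta>] by (auto simp: part_cycle_op_nxt nxt_def)
    have comps: "raisec n \<mu> \<in> compositions n" "cycle_op L \<eta> \<in> compositions n"
      using n \<eta> \<mu> L raisec_compositions cycle_op_compositions by auto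
    have "raisec n \<mu> = cycle_op L \<eta> \<longleftrightarrow> (\<forall>i\<in>{1..n}. part (raisec n \<mu>) i = part (cycle_op L \<eta>) i)"
      using compositions_eqI[OF comps] by auto
    also have "\<dots> \<longleftrightarrow> (\<forall>i\<in>{1..n}. part \<mu> i = path_part n \<eta> 1 L i)"
    proof safe
      fix i assume *: "\<forall>i\<in>{1..n}. part (raisec n \<mu>) i = part (cycle_op L \<eta>) i" "i \<in> {1..n}"
      show "part \<mu> i = path_part n \<eta> 1 L i"
      proof (cases "i = 1")
        case True
        then show ?thesis using *(1)[rule_format, of n] n top by (simp add: path_part_def part_raisec)
      next
        case False
        then have i: "1 \<le> i - 1" "i - 1 < n" "Suc (i - 1) = i" using *(2) by auto
        then have "part (raisec n \<mu>) (i - 1) = part (cycle_op L \<eta>) (i - 1)" using *(1) by simp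
        moreover have "part (raisec n \<mu>) (i - 1) = part \<mu> i"
          using part_raisec[OF n i(1), of \<mu>] i by simp
        ultimately have "part \<mu> i = part (cycle_op L \<eta>) (i - 1)" by simp
        then show ?thesis using False *(2) by (simp add: path_part_def)
      qed
    next
      fix i assume *: "\<forall>i\<in>{1..n}. part \<mu> i = path_part n \<eta> 1 L i" "i \<in> {1..n}"
      show "part (raisec n \<mu>) i = part (cycle_op L \<eta>) i"
      proof (cases "i = n")
        case True
        then show ?thesis using *(1)[rule_format, of 1] n top by (simp add: path_part_def part_raisec)
      next
        case False
        then show ?thesis using *(1)[rule_format, of "Suc i"] *(2) n by (simp add: path_part_def part_raisec)
      qed
    qed
    also have "\<dots> \<longleftrightarrow> part \<mu> = path_part n \<eta> 1 L"
    proof safe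
      assume *: "\<forall>i\<in>{1..n}. part \<mu> i = path_part n \<eta> 1 L i"
      show "part \<mu> = path_part n \<eta> 1 L"
      proof
        fix i
        show "part \<mu> i = path_part n \<eta> 1 L i"
        proof (cases "i \<in> {1..n}")
          case False
          then have "part \<mu> i = 0" "part \<eta> i = 0" using \<mu> \<eta> by (auto simp: compositions_iff)
          then show ?thesis using False n by (auto simp: path_part_def)
        qed (use * in blast)
      qed
    qed simp
    finally show ?thesis by simp
  qed
  then show ?thesis using reach_iff[of "n - 1" n \<eta> \<mu>] n \<eta> by auto
qed

lemma jcoef_mvar_last:
  assumes n: "1 \<le> n" and \<eta>: "\<eta> \<in> compositions n" and \<mu>: "\<mu> \<in> compositions n"
  shows "jcoef n (mvar n * jackE n \<eta>) \<mu> \<noteq> 0 \<longleftrightarrow> (\<exists>L \<subseteq> {1..n}. n \<in> L \<and> \<mu> = cycle_op L \<eta>)"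
proof -
  let ?f = "down n (n - 1) (jackE n \<eta>)"
  have f: "?f \<in> poly_ring n" using n \<eta> by (intro poly_ring_down poly_ring_jackE) auto
  have eq: "mvar n * jackE n \<eta> = raise n ?f" using raise_down[OF n] by simp
  have r: "(\<forall>\<mu>\<in>compositions n. jcoef n (raise n ?f) (raisec n \<mu>) = jcoef n ?f \<mu>)
    \<and> (\<forall>\<mu>\<in>compositions n. part \<mu> n = 0 \<longrightarrow> jcoef n (raise n ?f) \<mu> = 0)"
    using jcoef_raise[OF n f] by simp
  show ?thesis
  proof (cases "part \<mu> n = 0")
    case True
    have "part (cycle_op L \<eta>) n \<noteq> 0" if "L \<subseteq> {1..n}" "n \<in> L" for L
      using that finite_subset[of L "{1..n}"] by (auto simp: part_cycle_op_nxt nxt_def)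
    then have "\<not> (\<exists>L \<subseteq> {1..n}. n \<in> L \<and> \<mu> = cycle_op L \<eta>)" using True by metis
    then show ?thesis unfolding eq using True r \<mu> by simp
  next
    case False
    then obtain \<nu> where \<nu>: "\<nu> \<in> compositions n" "\<mu> = raisec n \<nu>"
      using raisec_surj[OF n \<mu>] by blast
    then show ?thesis
      unfolding eq using r raisec_reach_iff[OF n \<eta> \<nu>(1)] jcoef_down[of "n - 1" n \<eta> \<nu>] n \<eta> by simp
  qed
qed

text \<open>Rotation keeps the cyclic order of L. If 1 lies in L, the least element becomes the
  greatest, so the place of the wrap-around with its +1 moves; the +1 that \<open>raisec\<close>
  adds to the entry from position 1 compensates for this.\<close>

lemma cycle_op_raisec:
  assumes n: "1 \<le> n" and L: "L \<subseteq> {1..n}" "L \<noteq> {}" and \<eta>: "\<eta> \<in> compositions n"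
  shows "cycle_op (rot n ` L) (raisec n \<eta>) = raisec n (cycle_op L \<eta>)"
proof -
  note im = rot_image_all[OF n]
  have fin: "finite L" using L(1) finite_subset by blast
  have L': "rot n ` L \<subseteq> {1..n}" "finite (rot n ` L)" using L(1) im fin by auto
  have in_L: "rot n i \<in> rot n ` L \<longleftrightarrow> i \<in> L" for i
    using bij_rot[OF n] by (simp add: bij_is_inj inj_image_mem_iff)
  have rot1: "rot n 1 = n" by (simp add: rot_def)
  have rotS: "rot n i = i - 1" if "i \<in> L" "i \<noteq> 1" for i
    using that L(1) by (auto simp: rot_def)
  have pr: "part (raisec n \<eta>) (rot n m) = part \<eta> m + (if m = 1 then 1 else 0)" if "m \<in> L" for m
    using part_raisec_rot[OF n] that L(1) by auto
  have ge1: "1 \<le> x" "x \<le> n" if "x \<in> L" for x using that L(1) by auto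
  have key: "nxt (rot n ` L) (raisec n \<eta>) (rot n i) = nxt L \<eta> i + (if i = 1 then 1 else 0)"
    if i: "i \<in> L" for i
    using fin L(2)
  proof (cases rule: nxt_cases[where k = i and \<eta> = \<eta>])
    case (above m)
    have m1: "m \<noteq> 1" using above(2) ge1[OF i] by simp
    have m: "rot n m = m - 1" "rot n m \<in> rot n ` L" using rotS[OF above(1) m1] imageI[OF above(1)] .
    show ?thesis
    proof (cases "i = 1")
      case True
      \<comment> \<open>Position 1 becomes n, the last element of the image, so the step from 1 to
        its successor turns into the wrap-around.\<close>
      have "nxt (rot n ` L) (raisec n \<eta>) (rot n i) = part (raisec n \<eta>) (rot n m) + 1"
      proof (rule nxt_top[OF L'(2) m(2)])
        fix x assume "x \<in> rot n ` L"
        then obtain y where y: "y \<in> L" "x = rot n y" by blast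
        show "x \<le> rot n i" using L'(1) \<open>x \<in> rot n ` L\<close> True rot1 by auto
        show "rot n m \<le> x"
          using y m(1) above(3)[OF y(1)] True ge1[OF y(1)] rot1 rotS[OF y(1)] ge1[OF above(1)]
          by (cases "y = 1") auto
      qed
      then show ?thesis using pr[OF above(1)] m1 True above(4) by simp
    next
      case False
      then have ri: "rot n i = i - 1" using rotS i by blast
      have "nxt (rot n ` L) (raisec n \<eta>) (rot n i) = part (raisec n \<eta>) (rot n m)"
      proof (rule nxt_eq[OF L'(2) m(2)])
        show "rot n i < rot n m" using ri m(1) above(2) ge1[OF i] by simp
        fix x assume "x \<in> rot n ` L" "rot n i < x"
        then obtain y where y: "y \<in> L" "x = rot n y" by blast
        show "rot n m \<le> x"
        proof (cases "y = 1")
          case True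
          then show ?thesis using y(2) m(1) rot1 ge1[OF above(1)] by simp
        next
          case False
          then have "x = y - 1" using y rotS by simp
          then have "i < y" using \<open>rot n i < x\<close> ri by simp
          then show ?thesis using above(3)[OF y(1)] m(1) \<open>x = y - 1\<close> by simp
        qed
      qed
      then show ?thesis using pr[OF above(1)] m1 False above(4) by simp
    qed
  next
    case (top m)
    have m: "rot n m \<in> rot n ` L" using top(1) by auto
    show ?thesis
    proof (cases "m = 1")
      case True
      show ?thesis
      proof (cases "i = 1")
        case i1: True
        have "nxt (rot n ` L) (raisec n \<eta>) (rot n i) = part (raisec n \<eta>) (rot n m) + 1"
        proof (rule nxt_top[OF L'(2) m])
          fix x assume "x \<in> rot n ` L"
          then obtain y where y: "y \<in> L" "x = rot n y" by blast
          have "y = 1" using top(2)[OF y(1)] ge1[OF y(1)] i1 by simp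
          then show "x \<le> rot n i" "rot n m \<le> x" using y(2) i1 True by auto
        qed
        then show ?thesis using pr[OF top(1)] True i1 top(4) by simp
      next
        case False
        then have ri: "rot n i = i - 1" using rotS i by blast
        \<comment> \<open>Conversely, the wrap-around from i to 1 becomes an ordinary step from i -
          1 to n.\<close>
        have "nxt (rot n ` L) (raisec n \<eta>) (rot n i) = part (raisec n \<eta>) (rot n m)"
        proof (rule nxt_eq[OF L'(2) m])
          show "rot n i < rot n m" using ri True rot1 ge1[OF i] by simp
          fix x assume "x \<in> rot n ` L" "rot n i < x"
          then obtain y where y: "y \<in> L" "x = rot n y" by blast
          show "rot n m \<le> x"
            using y top(2)[OF y(1)] \<open>rot n i < x\<close> ri ge1[OF y(1)] rot1 rotS[OF y(1)] True
            by (cases "y = 1") auto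
        qed
        then show ?thesis using pr[OF top(1)] True False top(4) by simp
      qed
    next
      case False
      have no1: "y \<noteq> 1" if "y \<in> L" for y
        using top(3)[OF that] ge1[OF top(1)] False by auto
      have "nxt (rot n ` L) (raisec n \<eta>) (rot n i) = part (raisec n \<eta>) (rot n m) + 1"
      proof (rule nxt_top[OF L'(2) m])
        fix x assume "x \<in> rot n ` L"
        then obtain y where y: "y \<in> L" "x = rot n y" by blast
        show "x \<le> rot n i" "rot n m \<le> x"
          using y top(2,3)[OF y(1)] rotS[OF y(1) no1[OF y(1)]] rotS[OF i no1[OF i]] rotS[OF top(1) False]
          by auto
      qed
      then show ?thesis using pr[OF top(1)] False no1[OF i] top(4) by simp
    qed
  qed
  show ?thesis
  proof (rule compositions_eqI)
    show "cycle_op (rot n ` L) (raisec n \<eta>) \<in> compositions n" "raisec n (cycle_op L \<eta>) \<in> compositions n"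
      using n L L' \<eta> by (auto intro!: cycle_op_compositions raisec_compositions)
    fix j assume "j \<in> {1..n}"
    then obtain i where i: "i \<in> {1..n}" "j = rot n i" using im by (metis imageE)
    then show "part (cycle_op (rot n ` L) (raisec n \<eta>)) j = part (raisec n (cycle_op L \<eta>)) j"
      using key[of i] part_raisec_rot[of n i] n by (auto simp: part_cycle_op_nxt fin in_L)
  qed
qed

text \<open>For k = n this is \<open>jcoef_mvar_last\<close>. Raising both compositions turns the
  claim at i into the claim at \<open>rot n i\<close>, so position 1 inherits it from n, position 2
  from 1, and so on. The induction must quantify over \<eta> and \<mu>, since they change in every
  step.\<close>

lemma jcoef_mvar_nonzero_iff:
  assumes n: "1 \<le> n" and k: "k \<in> {1..n}"
    and \<eta>: "\<eta> \<in> compositions n" and \<mu>: "\<mu> \<in> compositions n"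
  shows "pieri_e1 n \<eta> \<mu> \<noteq> 0 \<and> spectral n \<mu> k \<noteq> spectral n \<eta> k
    \<longleftrightarrow> (\<exists>L \<subseteq> {1..n}. k \<in> L \<and> \<mu> = cycle_op L \<eta>)"
proof -
  note im = rot_image_all[OF n]
  have last: "pieri_e1 n \<eta> \<mu> \<noteq> 0 \<and> spectral n \<mu> n \<noteq> spectral n \<eta> n
    \<longleftrightarrow> (\<exists>L \<subseteq> {1..n}. n \<in> L \<and> \<mu> = cycle_op L \<eta>)"
    if "\<eta> \<in> compositions n" "\<mu> \<in> compositions n" for \<eta> \<mu>
  proof -
    have "jcoef n (mvar n * jackE n \<eta>) \<mu> \<noteq> 0
        \<longleftrightarrow> pieri_e1 n \<eta> \<mu> \<noteq> 0 \<and> spectral n \<mu> n \<noteq> spectral n \<eta> n"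
      using jcoef_mvar_jackE[OF n _ that, of n] n alpha_nonzero by auto
    then show ?thesis using jcoef_mvar_last[OF n that] by simp
  qed
  have step: "(\<exists>L \<subseteq> {1..n}. rot n i \<in> L \<and> raisec n \<mu> = cycle_op L (raisec n \<eta>))
      \<longleftrightarrow> (\<exists>L \<subseteq> {1..n}. i \<in> L \<and> \<mu> = cycle_op L \<eta>)"
    if \<eta>: "\<eta> \<in> compositions n" "\<mu> \<in> compositions n" and i: "i \<in> {1..n}" for \<eta> \<mu> i
  proof safe
    fix L assume L: "L \<subseteq> {1..n}" "rot n i \<in> L" "raisec n \<mu> = cycle_op L (raisec n \<eta>)"
    obtain M where M: "M \<subseteq> {1..n}" "L = rot n ` M" using L(1) im by (metis subset_imageE)
    have "i \<in> M" using L(2) M bij_rot[OF n] by (simp add: bij_is_inj inj_image_mem_iff)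
    moreover from this have "M \<noteq> {}" by blast
    then have "\<mu> = cycle_op M \<eta>"
      using L(3) cycle_op_raisec[OF n M(1) _ \<eta>(1)] n unfolding M(2) by simp
    ultimately show "\<exists>L \<subseteq> {1..n}. i \<in> L \<and> \<mu> = cycle_op L \<eta>" using M(1) by blast
  next
    fix L assume L: "L \<subseteq> {1..n}" "i \<in> L" "\<mu> = cycle_op L \<eta>"
    have "L \<noteq> {}" using L(2) by blast
    moreover have "rot n ` L \<subseteq> {1..n}" using image_mono[OF L(1), of "rot n"] im by simp
    ultimately show "\<exists>M \<subseteq> {1..n}. rot n i \<in> M \<and> raisec n (cycle_op L \<eta>) = cycle_op M (raisec n \<eta>)"
      using cycle_op_raisec[OF n L(1) _ \<eta>(1)] L(2) by (intro exI[of _ "rot n ` L"]) simp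
  qed
  define P where "P k \<eta> \<mu> \<longleftrightarrow> (pieri_e1 n \<eta> \<mu> \<noteq> 0 \<and> spectral n \<mu> k \<noteq> spectral n \<eta> k
    \<longleftrightarrow> (\<exists>L \<subseteq> {1..n}. k \<in> L \<and> \<mu> = cycle_op L \<eta>))" for k \<eta> \<mu>
  have P_rot: "P (rot n i) (raisec n \<eta>) (raisec n \<mu>) \<longleftrightarrow> P i \<eta> \<mu>"
    if "\<eta> \<in> compositions n" "\<mu> \<in> compositions n" "i \<in> {1..n}" for i \<eta> \<mu>
  proof -
    have "spectral n (raisec n \<mu>) (rot n i) = spectral n (raisec n \<eta>) (rot n i)
        \<longleftrightarrow> spectral n \<mu> i = spectral n \<eta> i"
      using spectral_raisec_rot[OF n that(3)] by simp
    then show ?thesis unfolding P_def step[OF that] pieri_e1_raisec[OF n that(1,2)] by simp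
  qed
  have "1 \<le> k" using k by simp
  then have "\<forall>\<eta>\<in>compositions n. \<forall>\<mu>\<in>compositions n. k \<le> n \<longrightarrow> P k \<eta> \<mu>"
  proof (induction k rule: dec_induct)
    case base
    have "rot n 1 = n" by (simp add: rot_def)
    moreover have "P n (raisec n \<eta>) (raisec n \<mu>)"
      if "\<eta> \<in> compositions n" "\<mu> \<in> compositions n" for \<eta> \<mu>
      unfolding P_def by (rule last) (intro raisec_compositions n that)+
    ultimately show ?case using P_rot[of _ _ 1] n by simp
  next
    case (step k)
    show ?case
    proof (intro ballI impI)
      fix \<eta> \<mu> assume *: "\<eta> \<in> compositions n" "\<mu> \<in> compositions n" "Suc k \<le> n"
      then have "rot n (Suc k) = k" using step by (simp add: rot_def)
      moreover have "P k (raisec n \<eta>) (raisec n \<mu>)" using step.IH * n by (simp add: raisec_compositions)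
      ultimately show "P (Suc k) \<eta> \<mu>" using P_rot[OF *(1,2), of "Suc k"] * by simp
    qed
  qed
  then show ?thesis using \<eta> \<mu> k unfolding P_def by simp
qed

text \<open>The value that j receives equals the entry that j passes on, so the cyclic predecessor
  of j may take it directly from beyond j. A singleton always changes its entry by 1, hence
  something remains.\<close>

lemma cycle_op_remove:
  assumes "finite L" "j \<in> L" "part (cycle_op L \<eta>) j = part \<eta> j"
  shows "L - {j} \<noteq> {}" "cycle_op (L - {j}) \<eta> = cycle_op L \<eta>"
proof -
  let ?A = "L - {j}"
  have L: "L \<noteq> {}" and fin: "finite ?A" using assms by auto
  have j: "nxt L \<eta> j = part \<eta> j" using assms by (simp add: part_cycle_op_nxt)
  show "?A \<noteq> {}"
  proof
    assume "?A = {}"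
    then have "L = {j}" using assms(2) by auto
    then have "nxt L \<eta> j = part \<eta> j + 1" by (intro nxt_top) auto
    then show False using j by simp
  qed
  have "nxt ?A \<eta> i = nxt L \<eta> i" if i: "i \<in> ?A" for i
    using assms(1) L
  proof (cases rule: nxt_cases[where k = i and \<eta> = \<eta>])
    case (above m)
    show ?thesis
    proof (cases "m = j")
      case False
      then have "nxt ?A \<eta> i = part \<eta> m" using above fin by (intro nxt_eq) auto
      then show ?thesis using above(4) by simp
    next
      case True
      from assms(1) L show ?thesis
      proof (cases rule: nxt_cases[where k = j and \<eta> = \<eta>])
        case above': (above m2)
        have "nxt ?A \<eta> i = part \<eta> m2"
          using above'(1,2) above(2,3) True fin
          by (intro nxt_eq) (auto intro!: above'(3) intro: le_neq_implies_less)
        then show ?thesis using above'(4) j above(4) True by simp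
      next
        case (top m2)
        have "m2 \<noteq> j" using top(4) j by auto
        then have "nxt ?A \<eta> i = part \<eta> m2 + 1"
          using top(1,2,3) above(2,3) True fin
          by (intro nxt_top) (auto simp: not_less[symmetric], metis nat_neq_iff)
        then show ?thesis using top(4) j above(4) True by simp
      qed
    qed
  next
    case (top m)
    show ?thesis
    proof (cases "m = j")
      case False
      then have "nxt ?A \<eta> i = part \<eta> m + 1" using top fin by (intro nxt_top) auto
      then show ?thesis using top(4) by simp
    next
      case True
      have "j < i" using top(2)[OF assms(2)] i by auto
      from assms(1) L show ?thesis
      proof (cases rule: nxt_cases[where k = j and \<eta> = \<eta>])
        case above': (above m2)
        have "nxt ?A \<eta> i = part \<eta> m2 + 1"
          using above'(1,2) top(2,3) True fin
          by (intro nxt_top) (auto intro!: above'(3) intro: le_neq_implies_less)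
        then show ?thesis using above'(4) j top(4) True by simp
      next
        case top': (top m2)
        then show ?thesis using i \<open>j < i\<close> by (meson DiffD1 linorder_not_less)
      qed
    qed
  qed
  then show "cycle_op ?A \<eta> = cycle_op L \<eta>"
    using assms fin by (intro poly_mapping_eqI) (auto simp: part_cycle_op_nxt)
qed

lemma cycle_op_support:
  fixes \<eta> :: comp
  assumes "finite L" "L \<noteq> {}" "L \<subseteq> {1..n}"
  defines "S \<equiv> {i \<in> {1..n}. part \<eta> i \<noteq> part (cycle_op L \<eta>) i}"
  shows "S \<noteq> {}" "cycle_op S \<eta> = cycle_op L \<eta>"
proof -
  have "{i \<in> {1..n}. part \<eta> i \<noteq> part (cycle_op L \<eta>) i} \<noteq> {}
      \<and> cycle_op {i \<in> {1..n}. part \<eta> i \<noteq> part (cycle_op L \<eta>) i} \<eta> = cycle_op L \<eta>"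
    using assms(1-3)
  proof (induction L rule: finite_psubset_induct)
    case (psubset L)
    show ?case
    proof (cases "\<exists>j\<in>L. part (cycle_op L \<eta>) j = part \<eta> j")
      case True
      then obtain j where j: "j \<in> L" "part (cycle_op L \<eta>) j = part \<eta> j" by blast
      note r = cycle_op_remove[OF psubset.hyps(1) j]
      have "L - {j} \<subset> L" using j by auto
      from psubset.IH[OF this r(1)] psubset.prems show ?thesis unfolding r(2) by auto
    next
      case False
      then have "{i \<in> {1..n}. part \<eta> i \<noteq> part (cycle_op L \<eta>) i} = L"
        using psubset.prems psubset.hyps by (auto simp: part_cycle_op_nxt split: if_splits)
      then show ?thesis using psubset.prems by simp
    qed
  qed
  then show "S \<noteq> {}" "cycle_op S \<eta> = cycle_op L \<eta>" unfolding S_def by auto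
qed

lemma pieri_e1_nonzero_iff:
  assumes n: "1 \<le> n" and \<eta>: "\<eta> \<in> compositions n" and \<mu>: "\<mu> \<in> compositions n"
    and ne: "\<eta> \<noteq> \<mu>"
  defines "S \<equiv> {i \<in> {1..n}. part \<eta> i \<noteq> part \<mu> i}"
  shows "pieri_e1 n \<eta> \<mu> \<noteq> 0 \<longleftrightarrow> \<mu> = cycle_op S \<eta>"
proof
  \<comment> \<open>At a position of S the eigenvalues differ too, so there
    \<open>jcoef_mvar_nonzero_iff\<close> decides about the coefficient for e_1.\<close>
  obtain k where k: "k \<in> S"
    using ne compositions_eqI[OF \<eta> \<mu>] unfolding S_def by blast
  then have kn: "k \<in> {1..n}" "part \<mu> k \<noteq> part \<eta> k" unfolding S_def by auto
  then have spec: "spectral n \<mu> k \<noteq> spectral n \<eta> k" using spectral_eqD(1) by blast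
  note iff = jcoef_mvar_nonzero_iff[OF n kn(1) \<eta> \<mu>]
  show "\<mu> = cycle_op S \<eta>" if nz: "pieri_e1 n \<eta> \<mu> \<noteq> 0"
  proof -
    obtain L where L: "L \<subseteq> {1..n}" "k \<in> L" "\<mu> = cycle_op L \<eta>"
      using iffD1[OF iff conjI[OF nz spec]] by blast
    have "finite L" "L \<noteq> {}" using L(1,2) finite_subset by auto
    from cycle_op_support(2)[OF this L(1), of \<eta>] show ?thesis unfolding S_def L(3) by (rule sym)
  qed
  show "pieri_e1 n \<eta> \<mu> \<noteq> 0" if "\<mu> = cycle_op S \<eta>"
  proof -
    have "\<exists>L \<subseteq> {1..n}. k \<in> L \<and> \<mu> = cycle_op L \<eta>"
      using that k by (intro exI[of _ S]) (auto simp: S_def)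
    from iffD2[OF iff this] show ?thesis ..
  qed
qed

section \<open>Multiplication by a nonsymmetric Jack polynomial of degree one\<close>

lemma nxt_not_in:
  assumes "finite L" "L \<noteq> {}" "Suc k \<notin> L"
  shows "nxt L \<eta> (Suc k) = nxt L \<eta> k"
proof -
  have "k < x \<longleftrightarrow> Suc k < x" if "x \<in> L" for x
    using that assms(3) by (metis Suc_lessI Suc_lessD)
  then have "{m \<in> L. k < m} = {m \<in> L. Suc k < m}" "(\<forall>x\<in>L. x \<le> k) \<longleftrightarrow> (\<forall>x\<in>L. x \<le> Suc k)"
    by (auto simp flip: not_less)
  then show ?thesis by (simp only: nxt_def)
qed

text \<open>A telescoping sum over the positions of L up to k. The weight P is arbitrary so that
  sizes, ranks and inversions are all covered.\<close>

lemma cycle_op_sum: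
  fixes P :: "nat \<Rightarrow> int"
  assumes "finite L" "L \<noteq> {}" "0 \<notin> L"
  shows "(\<Sum>j\<in>{1..k}. P (part (cycle_op L \<eta>) j)) + P (part \<eta> (Min L))
    = (\<Sum>j\<in>{1..k}. P (part \<eta> j)) + P (nxt L \<eta> k)"
proof (induction k)
  case 0
  then show ?case using nxt_0[OF assms, of \<eta>] by simp
next
  case (Suc k)
  show ?case
  proof (cases "Suc k \<in> L")
    case True
    have "nxt L \<eta> k = part \<eta> (Suc k)" using assms(1) True by (intro nxt_eq) auto
    then show ?thesis using Suc True assms(1) by (simp add: part_cycle_op_nxt)
  next
    case False
    then show ?thesis using Suc nxt_not_in[OF assms(1,2) False, of \<eta>] assms(1)
      by (simp add: part_cycle_op_nxt)
  qed
qed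

section \<open>Entries and ranks on both sides of position k\<close>

lemma sum_split_interval:
  fixes f :: "nat \<Rightarrow> 'a :: comm_monoid_add"
  assumes "k \<le> n"
  shows "(\<Sum>j\<in>{1..n}. f j) = (\<Sum>j\<in>{1..k}. f j) + (\<Sum>j\<in>{k<..n}. f j)"
proof -
  have "{1..n} = {1..k} \<union> {k<..n}" using assms by auto
  then show ?thesis by (simp only:) (rule sum.union_disjoint, auto)
qed

text \<open>The difference of the instances n and k of \<open>cycle_op_sum\<close>.\<close>

lemma cycle_op_sum_upper:
  fixes P :: "nat \<Rightarrow> int"
  assumes "L \<subseteq> {1..n}" "L \<noteq> {}" "k \<le> n"
  shows "(\<Sum>j\<in>{k<..n}. P (part (cycle_op L \<eta>) j)) + P (nxt L \<eta> k)
    = (\<Sum>j\<in>{k<..n}. P (part \<eta> j)) + P (part \<eta> (Min L) + 1)"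
proof -
  have fin: "finite L" using assms(1) finite_subset by blast
  have "nxt L \<eta> n = part \<eta> (Min L) + 1" using assms(1) by (auto simp: nxt_def)
  moreover have "0 \<notin> L" using assms(1) by auto
  ultimately show ?thesis
    using sum_split_interval[OF assms(3), of "\<lambda>j. P (part \<eta> j)"]
      sum_split_interval[OF assms(3), of "\<lambda>j. P (part (cycle_op L \<eta>) j)"] cycle_op_sum[OF fin assms(2), of P \<eta> k] cycle_op_sum[OF fin assms(2), of P \<eta> n] by simp
qed

text \<open>The pairs in which a row after k beats a row up to k. The later row loses ties, hence
  the strict inequality.\<close>

definition inversions :: "nat \<Rightarrow> nat \<Rightarrow> comp \<Rightarrow> int" where
  "inversions n k \<gamma> = (\<Sum>j\<in>{1..k}. \<Sum>h\<in>{k<..n}. of_bool (part \<gamma> j < part \<gamma> h))"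

lemma coleg_row_sum:
  assumes "i \<in> {1..n}"
  shows "int (coleg_row n \<gamma> i) = (\<Sum>h\<in>{1..n}. of_bool (beats \<gamma> h i))"
  using assms by (simp add: coleg_row_beats Int_def)

text \<open>Among the first \<open>k\<close> rows each pair is counted exactly once.\<close>

lemma coleg_row_sum_lower:
  assumes "k \<le> n"
  shows "2 * (\<Sum>j\<in>{1..k}. int (coleg_row n \<gamma> j)) = int k * (int k - 1) + 2 * inversions n k \<gamma>"
proof -
  let ?B = "\<lambda>h j. of_bool (beats \<gamma> h j) :: int"
  have "(\<Sum>j\<in>{1..k}. int (coleg_row n \<gamma> j)) = (\<Sum>j\<in>{1..k}. (\<Sum>h\<in>{1..k}. ?B h j) + (\<Sum>h\<in>{k<..n}. ?B h j))"
  proof (intro sum.cong refl)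
    fix j assume "j \<in> {1..k}"
    then have "j \<in> {1..n}" using assms by auto
    then show "int (coleg_row n \<gamma> j) = (\<Sum>h\<in>{1..k}. ?B h j) + (\<Sum>h\<in>{k<..n}. ?B h j)"
      by (simp only: coleg_row_sum sum_split_interval[OF assms])
  qed
  also have "\<dots> = (\<Sum>j\<in>{1..k}. \<Sum>h\<in>{1..k}. ?B h j) + inversions n k \<gamma>"
    unfolding inversions_def sum.distrib by (intro arg_cong2[of _ _ _ _ "(+)"] refl sum.cong) (auto simp: beats_def)
  finally have 1: "(\<Sum>j\<in>{1..k}. int (coleg_row n \<gamma> j)) = (\<Sum>j\<in>{1..k}. \<Sum>h\<in>{1..k}. ?B h j) + inversions n k \<gamma>" .
  have "2 * (\<Sum>j\<in>{1..k}. \<Sum>h\<in>{1..k}. ?B h j)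
      = (\<Sum>j\<in>{1..k}. \<Sum>h\<in>{1..k}. ?B h j) + (\<Sum>j\<in>{1..k}. \<Sum>h\<in>{1..k}. ?B j h)"
    using sum.swap[of ?B "{1..k}" "{1..k}"] by simp
  also have "\<dots> = (\<Sum>j\<in>{1..k}. \<Sum>h\<in>{1..k}. 1 - of_bool (h = j))"
    unfolding sum.distrib[symmetric] by (intro sum.cong refl) (auto simp: beats_def)
  also have "\<dots> = int k * (int k - 1)"
    by (simp add: sum_subtractf of_bool_def)
  finally show ?thesis using 1 by simp
qed

text \<open>The ranks of all n rows have the same sum for every composition, so a change among the
  first k rows is balanced by the rest.\<close>

lemma coleg_row_sum_upper:
  assumes "k \<le> n"
  shows "(\<Sum>j\<in>{k<..n}. int (coleg_row n \<delta> j) - int (coleg_row n \<gamma> j)) = inversions n k \<gamma> - inversions n k \<delta>"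
proof -
  have "inversions n n \<epsilon> = 0" for \<epsilon> by (simp add: inversions_def)
  then show ?thesis
    using coleg_row_sum_lower[OF assms, of \<delta>] coleg_row_sum_lower[OF assms, of \<gamma>]
      coleg_row_sum_lower[of n n \<delta>] coleg_row_sum_lower[of n n \<gamma>]
      sum_split_interval[OF assms, of "\<lambda>j. int (coleg_row n \<gamma> j)"] sum_split_interval[OF assms, of "\<lambda>j. int (coleg_row n \<delta> j)"]
    by (simp add: sum_subtractf)
qed

text \<open>Ties count for rows before k and not for rows after k, so the cut at k absorbs the
  tie-breaking. The -1 removes row k, which the first sum counts. The summands now depend on entries
  only, as \<open>cycle_op_sum\<close> requires.\<close>

lemma coleg_row_split:
  assumes "k \<in> {1..n}"
  shows "int (coleg_row n \<gamma> k) = (\<Sum>h\<in>{1..k}. of_bool (part \<gamma> k \<le> part \<gamma> h)) - 1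
    + (\<Sum>h\<in>{k<..n}. of_bool (part \<gamma> k < part \<gamma> h))"
proof -
  have "(\<Sum>h\<in>{1..k}. of_bool (beats \<gamma> h k)) = (\<Sum>h\<in>{1..k}. of_bool (part \<gamma> k \<le> part \<gamma> h) - of_bool (h = k) :: int)"
    by (intro sum.cong refl) (auto simp: beats_def)
  also have "\<dots> = (\<Sum>h\<in>{1..k}. of_bool (part \<gamma> k \<le> part \<gamma> h)) - 1"
    using assms by (simp add: sum_subtractf of_bool_def)
  moreover have "(\<Sum>h\<in>{k<..n}. of_bool (beats \<gamma> h k)) = (\<Sum>h\<in>{k<..n}. of_bool (part \<gamma> k < part \<gamma> h) :: int)"
    by (intro sum.cong refl) (auto simp: beats_def)
  moreover have "k \<le> n" using assms by simp
  ultimately show ?thesis by (simp only: coleg_row_sum[OF assms] sum_split_interval)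
qed

text \<open>\<open>linform n k\<close> is a scalar multiple of the Jack polynomial of \<open>\<epsilon>\<^sub>k\<close>, and \<open>bracket\<close> replaces each of
  its variables \<open>x\<^sub>j\<close> by the corresponding difference of eigenvalues.\<close>

definition bracket :: "nat \<Rightarrow> nat \<Rightarrow> comp \<Rightarrow> comp \<Rightarrow> ratfun" where
  "bracket n k \<eta> \<mu> = (\<alpha> + of_nat k) * (spectral n \<mu> k - spectral n \<eta> k)
     + (\<Sum>j\<in>{k<..n}. spectral n \<mu> j - spectral n \<eta> j)"

text \<open>All three coefficients in \<alpha> must vanish. If the entry at k is unchanged, its rank
  changes by 0 or 1, so b can only be a + 1 or a. The change w of the inversions is then minus the
  number of rows after k with entry a + 1, or the number of rows up to k with entry a, and the last
  coefficient asks that it be 0 or k.\<close>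

lemma bracket_eq_0_iff:
  assumes L: "L \<subseteq> {1..n}" "L \<noteq> {}" and k: "k \<in> {1..n}" and \<mu>: "\<mu> = cycle_op L \<eta>"
  defines "a \<equiv> part \<eta> (Min L)" and "b \<equiv> nxt L \<eta> k"
  shows "bracket n k \<eta> \<mu> = 0 \<longleftrightarrow> part \<mu> k = part \<eta> k \<and>
    (b = a + 1 \<and> (\<forall>i\<in>{k..n}. part \<eta> i \<noteq> a + 1) \<or> b = a \<and> (\<forall>i\<in>{1..k}. part \<eta> i = a))"
proof -
  have fin: "finite L" using L(1) finite_subset by blast
  have kn: "k \<le> n" and L0: "0 \<notin> L" using k L by auto
  define x where "x = int (part \<mu> k) - int (part \<eta> k)"
  define y where "y = int (coleg_row n \<mu> k) - int (coleg_row n \<eta> k)"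
  define w where "w = inversions n k \<mu> - inversions n k \<eta>"
  have lower: "(\<Sum>j\<in>{1..k}. P (part \<mu> j)) = (\<Sum>j\<in>{1..k}. P (part \<eta> j)) + P b - P a" for P :: "nat \<Rightarrow> int"
    using cycle_op_sum[OF fin L(2) L0, of P \<eta> k] by (simp add: \<mu> a_def b_def)
  have upper: "(\<Sum>j\<in>{k<..n}. P (part \<mu> j)) = (\<Sum>j\<in>{k<..n}. P (part \<eta> j)) + P (a + 1) - P b"
    for P :: "nat \<Rightarrow> int"
    using cycle_op_sum_upper[OF L kn, of P \<eta>] by (simp add: \<mu> a_def b_def)
  have "(\<Sum>j\<in>{k<..n}. spectral n \<mu> j - spectral n \<eta> j)
      = \<alpha> * of_int (\<Sum>j\<in>{k<..n}. int (part \<mu> j) - int (part \<eta> j))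
        + of_int (\<Sum>j\<in>{k<..n}. int (coleg_row n \<eta> j) - int (coleg_row n \<mu> j))"
    by (simp only: spectral_diff sum.distrib of_int_sum sum_distrib_left)
  also have "(\<Sum>j\<in>{k<..n}. int (part \<mu> j) - int (part \<eta> j)) = int a + 1 - int b"
    using upper[of int] by (simp add: sum_subtractf)
  also have "(\<Sum>j\<in>{k<..n}. int (coleg_row n \<eta> j) - int (coleg_row n \<mu> j)) = w"
    unfolding w_def by (rule coleg_row_sum_upper[OF kn])
  finally have eq: "bracket n k \<eta> \<mu> = \<alpha> * \<alpha> * of_int x + \<alpha> * of_int (int k * x - y + (int a + 1 - int b))
      + of_int (w - int k * y)"
    unfolding bracket_def spectral_diff by (simp add: x_def y_def algebra_simps)
  have zero: "bracket n k \<eta> \<mu> = 0 \<longleftrightarrow> x = 0 \<and> y = int a + 1 - int b \<and> w = int k * y"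
  proof
    assume "bracket n k \<eta> \<mu> = 0"
    from alpha_quadratic_eq_0[OF this[unfolded eq]]
    show "x = 0 \<and> y = int a + 1 - int b \<and> w = int k * y" by auto
  qed (simp add: eq)
  have y: "y = of_bool (b = part \<eta> k)" if "x = 0"
  proof -
    have v: "part \<mu> k = part \<eta> k" using that by (simp add: x_def)
    \<comment> \<open>The two middle indicators cancel; what remains is whether the entry at k ties
      with b.\<close>
    have "y = of_bool (part \<eta> k \<le> b) - of_bool (part \<eta> k \<le> a)
        + of_bool (part \<eta> k < a + 1) - of_bool (part \<eta> k < b)"
      unfolding y_def coleg_row_split[OF k] v
        lower[of "\<lambda>z. of_bool (part \<eta> k \<le> z)"] upper[of "\<lambda>z. of_bool (part \<eta> k < z)"] by simp
    then show ?thesis by (auto split: if_splits)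
  qed
  \<comment> \<open>By \<open>upper\<close> this is the number of rows of \<mu> after k with an
    entry above z. Expressed through \<eta>, it can serve as a weight in
    \<open>lower\<close>.\<close>
  define Q :: "nat \<Rightarrow> int" where "Q z = (\<Sum>h\<in>{k<..n}. of_bool (z < part \<eta> h)) + of_bool (z < a + 1) - of_bool (z < b)" for z
  have "inversions n k \<mu> = (\<Sum>j\<in>{1..k}. Q (part \<mu> j))"
    unfolding inversions_def Q_def by (intro sum.cong refl upper)
  also have "\<dots> = (\<Sum>j\<in>{1..k}. Q (part \<eta> j)) + Q b - Q a" by (rule lower)
  also have "(\<Sum>j\<in>{1..k}. Q (part \<eta> j)) = inversions n k \<eta>
      + (\<Sum>j\<in>{1..k}. of_bool (part \<eta> j < a + 1) - of_bool (part \<eta> j < b))"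
    unfolding Q_def inversions_def by (simp add: sum.distrib sum_subtractf)
  finally have "w = (\<Sum>j\<in>{1..k}. of_bool (part \<eta> j < a + 1) - of_bool (part \<eta> j < b)) + Q b - Q a"
    unfolding w_def by simp
  \<comment> \<open>The extra terms cancel because exactly one of b < a + 1 and a < b holds.\<close>
  moreover have "Q b - Q a = (\<Sum>h\<in>{k<..n}. of_bool (b < part \<eta> h) - of_bool (a < part \<eta> h))"
    unfolding Q_def by (auto simp: sum_subtractf)
  ultimately have w: "w = (\<Sum>j\<in>{1..k}. of_bool (part \<eta> j < a + 1) - of_bool (part \<eta> j < b))
      + (\<Sum>h\<in>{k<..n}. of_bool (b < part \<eta> h) - of_bool (a < part \<eta> h))"
    by simp
  have w1: "w = 0 \<longleftrightarrow> (\<forall>h\<in>{k<..n}. part \<eta> h \<noteq> a + 1)" if "b = a + 1"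
  proof -
    have "w = - (\<Sum>h\<in>{k<..n}. of_bool (part \<eta> h = a + 1))"
      unfolding w that sum_negf[symmetric] by (simp, intro sum.cong refl) auto
    then show ?thesis by (simp add: sum_nonneg_eq_0_iff del: sum_of_bool_eq)
  qed
  have w2: "w = int k \<longleftrightarrow> (\<forall>i\<in>{1..k}. part \<eta> i = a)" if "b = a"
  proof -
    have "(\<Sum>j\<in>{1..k}. of_bool (part \<eta> j < a + 1) - of_bool (part \<eta> j < a))
        = (\<Sum>j\<in>{1..k}. of_bool (part \<eta> j = a) :: int)"
      by (intro sum.cong refl) auto
    then have "w = (\<Sum>j\<in>{1..k}. of_bool (part \<eta> j = a))"
      unfolding w that by (simp only: diff_self sum.neutral_const add_0_right)
    also have "\<dots> = int k - (\<Sum>j\<in>{1..k}. of_bool (part \<eta> j \<noteq> a))"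
    proof -
      have "(\<Sum>j\<in>{1..k}. of_bool (part \<eta> j = a)) + (\<Sum>j\<in>{1..k}. of_bool (part \<eta> j \<noteq> a))
          = (\<Sum>j\<in>{1..k}. 1 :: int)"
        unfolding sum.distrib[symmetric] by (intro sum.cong refl) auto
      then show ?thesis by simp
    qed
    finally show ?thesis by (simp add: sum_nonneg_eq_0_iff del: sum_of_bool_eq)
  qed
  have up: "(\<forall>i\<in>{k..n}. part \<eta> i \<noteq> a + 1) \<longleftrightarrow> part \<eta> k \<noteq> a + 1 \<and> (\<forall>h\<in>{k<..n}. part \<eta> h \<noteq> a + 1)"
    using k by (auto simp: le_less)
  have x0: "x = 0 \<longleftrightarrow> part \<mu> k = part \<eta> k" by (auto simp: x_def)
  show ?thesis
  proof (cases "x = 0")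
    case True
    consider "b = a + 1" | "b = a" | "b \<noteq> a" "b \<noteq> a + 1" by blast
    then show ?thesis
    proof cases
      case 1
      then show ?thesis unfolding zero up x0[symmetric] using True y[OF True] w1 by auto
    next
      case 2
      then show ?thesis unfolding zero x0[symmetric] using True y[OF True] w2 k by auto
    next
      case 3
      then show ?thesis unfolding zero x0[symmetric] using y[OF True] by auto
    qed
  qed (simp add: zero x0)
qed

text \<open>Every position of S really changes, which turns the conditions on b into conditions on
  positions. If b = a + 1 were an entry after k, it would contradict the absence of a + 1 from k on.
  If b = a and S met the first k positions, the last position of S there would receive the value a
  that it already has.\<close>

lemma bracket_support:
  assumes k: "k \<in> {1..n}" and S: "S = {i \<in> {1..n}. part \<eta> i \<noteq> part \<mu> i}" "S \<noteq> {}"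
    and \<mu>: "\<mu> = cycle_op S \<eta>"
  shows "bracket n k \<eta> \<mu> \<noteq> 0 \<longleftrightarrow>
    (Max S \<ge> k \<or> (\<exists>i\<in>{k..n}. part \<eta> i = part \<eta> (Min S) + 1))
    \<and> ((\<forall>i\<in>{1..k}. part \<eta> i = part \<eta> (Min S)) \<longrightarrow> Min S \<le> k)"
proof -
  have Sn: "S \<subseteq> {1..n}" and fin: "finite S" using S(1) by auto
  define a where "a = part \<eta> (Min S)"
  define b where "b = nxt S \<eta> k"
  define N where "N \<longleftrightarrow> (\<forall>i\<in>{k..n}. part \<eta> i \<noteq> a + 1)"
  define A where "A \<longleftrightarrow> (\<forall>i\<in>{1..k}. part \<eta> i = a)"
  have kS: "part \<mu> k = part \<eta> k \<longleftrightarrow> k \<notin> S" using k S(1) by auto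
  have "bracket n k \<eta> \<mu> = 0 \<longleftrightarrow> k \<notin> S \<and> (b = a + 1 \<and> N \<or> b = a \<and> A)"
    using bracket_eq_0_iff[OF Sn S(2) k \<mu>] unfolding a_def b_def N_def A_def kS .
  also have "\<dots> \<longleftrightarrow> (Max S < k \<and> N) \<or> (A \<and> k < Min S)"
  proof
    assume *: "(Max S < k \<and> N) \<or> (A \<and> k < Min S)"
    then show "k \<notin> S \<and> (b = a + 1 \<and> N \<or> b = a \<and> A)"
    proof
      assume lt: "Max S < k \<and> N"
      then have "\<forall>x\<in>S. x < k" using fin S(2) by simp
      then show ?thesis using lt by (auto simp: b_def a_def nxt_def)
    next
      assume lt: "A \<and> k < Min S"
      then have "\<forall>x\<in>S. k < x" using fin S(2) by simp
      moreover from this have "b = a"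
        unfolding b_def a_def using fin S(2) lt by (intro nxt_eq) auto
      ultimately show ?thesis using lt by auto
    qed
  next
    assume *: "k \<notin> S \<and> (b = a + 1 \<and> N \<or> b = a \<and> A)"
    then have "b = a + 1 \<and> N \<or> b = a \<and> A" by blast
    then show "(Max S < k \<and> N) \<or> (A \<and> k < Min S)"
    proof
      assume b: "b = a + 1 \<and> N"
      have "x < k" if "x \<in> S" for x
        using fin S(2)
      proof (cases rule: nxt_cases[where k = k and \<eta> = \<eta>])
        case (above m)
        then have "m \<in> {k..n}" "part \<eta> m = a + 1" using Sn b by (auto simp: b_def)
        then show ?thesis using b N_def by blast
      next
        case (top m)
        then show ?thesis using that * le_neq_implies_less by metis
      qed
      then show ?thesis using b fin S(2) by simp
    next
      assume b: "b = a \<and> A"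
      have "k < x" if x: "x \<in> S" for x
      proof (rule ccontr)
        assume "\<not> k < x"
        \<comment> \<open>No element of S lies between this position and k, so it receives
          b.\<close>
        define p where "p = Max {x \<in> S. x \<le> k}"
        have ne: "{x \<in> S. x \<le> k} \<noteq> {}" "finite {x \<in> S. x \<le> k}" using x \<open>\<not> k < x\<close> fin by auto
        have p: "p \<in> S" "p \<le> k" using Max_in[OF ne(2,1)] unfolding p_def by auto
        have "z \<le> p \<longleftrightarrow> z \<le> k" if "z \<in> S" for z
          using Max_ge[OF ne(2), of z] that p by (auto simp flip: p_def)
        then have "{m \<in> S. p < m} = {m \<in> S. k < m}" "(\<forall>x\<in>S. x \<le> p) \<longleftrightarrow> (\<forall>x\<in>S. x \<le> k)"
          by (auto simp: not_le[symmetric])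
        then have "nxt S \<eta> p = b" unfolding b_def nxt_def by simp
        then have "part \<mu> p = a" using b p(1) fin by (simp add: \<mu> part_cycle_op_nxt)
        moreover have "part \<eta> p = a" using b p Sn by (auto simp: A_def)
        ultimately show False using p(1) S(1) by auto
      qed
      then show ?thesis using b fin S(2) by simp
    qed
  qed
  finally show ?thesis unfolding N_def A_def a_def by (auto simp flip: not_le)
qed

section \<open>Jack polynomials of degree one\<close>

definition linform :: "nat \<Rightarrow> nat \<Rightarrow> mpol" where
  "linform n k = mconst (\<alpha> + of_nat k) * mvar k + (\<Sum>j\<in>{k<..n}. mvar j)"

lemma poly_ring_linform_times:
  assumes "k \<in> {1..n}" "f \<in> poly_ring n"
  shows "linform n k * f \<in> poly_ring n"
proof -
  have "linform n k * f = mconst (\<alpha> + of_nat k) * (mvar k * f) + (\<Sum>j\<in>{k<..n}. mvar j * f)"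
    by (simp add: linform_def distrib_right sum_distrib_right mult.assoc)
  also have "\<dots> \<in> poly_ring n"
    using assms by (intro poly_ring_add poly_ring_mconst poly_ring_sum poly_ring_mvar) auto
  finally show ?thesis .
qed

lemma jcoef_linform:
  assumes n: "1 \<le> n" and k: "k \<in> {1..n}"
    and \<eta>: "\<eta> \<in> compositions n" and \<mu>: "\<mu> \<in> compositions n"
  shows "\<alpha> * jcoef n (linform n k * jackE n \<eta>) \<mu> = bracket n k \<eta> \<mu> * pieri_e1 n \<eta> \<mu>"
proof -
  let ?E = "jackE n \<eta>"
  have E: "?E \<in> poly_ring n" using poly_ring_jackE n \<eta> by blast
  have mem: "mvar j * ?E \<in> poly_ring n" if "j \<in> {k<..n}" for j
    using that k E by (intro poly_ring_mvar) auto
  have "linform n k * ?E = mconst (\<alpha> + of_nat k) * (mvar k * ?E) + (\<Sum>j\<in>{k<..n}. mvar j * ?E)"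
    by (simp add: linform_def distrib_right sum_distrib_right mult.assoc)
  then have "jcoef n (linform n k * ?E) \<mu>
      = (\<alpha> + of_nat k) * jcoef n (mvar k * ?E) \<mu> + (\<Sum>j\<in>{k<..n}. jcoef n (mvar j * ?E) \<mu>)"
  proof -
    have "mvar k * ?E \<in> poly_ring n" using k E by (rule poly_ring_mvar)
    moreover have "(\<Sum>j\<in>{k<..n}. mvar j * ?E) \<in> poly_ring n" using mem by (rule poly_ring_sum)
    moreover have "jcoef n (\<Sum>j\<in>{k<..n}. mvar j * ?E) \<mu> = (\<Sum>j\<in>{k<..n}. jcoef n (mvar j * ?E) \<mu>)"
      using n mem by (rule jcoef_sum)
    ultimately show ?thesis
      unfolding \<open>linform n k * ?E = _\<close> using n by (simp only: jcoef_add jcoef_mconst poly_ring_mconst)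
  qed
  then have "\<alpha> * jcoef n (linform n k * ?E) \<mu>
      = (\<alpha> + of_nat k) * (\<alpha> * jcoef n (mvar k * ?E) \<mu>) + (\<Sum>j\<in>{k<..n}. \<alpha> * jcoef n (mvar j * ?E) \<mu>)"
    by (simp add: distrib_left sum_distrib_left mult_ac)
  also have "\<dots> = (\<alpha> + of_nat k) * ((spectral n \<mu> k - spectral n \<eta> k) * pieri_e1 n \<eta> \<mu>)
      + (\<Sum>j\<in>{k<..n}. (spectral n \<mu> j - spectral n \<eta> j) * pieri_e1 n \<eta> \<mu>)"
    using k by (intro arg_cong2[of _ _ _ _ "(+)"] arg_cong2[of _ _ _ _ "(*)"] sum.cong refl
        jcoef_mvar_jackE n \<eta> \<mu>) auto
  also have "\<dots> = bracket n k \<eta> \<mu> * pieri_e1 n \<eta> \<mu>"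
    by (simp only: bracket_def distrib_right sum_distrib_right mult.assoc)
  finally show ?thesis .
qed

lemma jcoef_eq_0:
  assumes n: "1 \<le> n" and "f \<in> poly_ring n" "\<And>\<mu>. \<mu> \<in> compositions n \<Longrightarrow> jcoef n f \<mu> = 0"
  shows "f = 0"
proof -
  let ?B = "jackE n ` compositions n"
  have "mp.representation ?B f b = 0" for b
    using assms(3) mp.representation_ne_zero[of ?B f b] by (auto simp: jcoef_def)
  then show ?thesis
    using mp.sum_nonzero_representation_eq[OF jackE_independent[OF n] jackE_span[OF n assms(2)]] by simp
qed

lemma jcoef_eqI:
  assumes n: "1 \<le> n" and "f \<in> poly_ring n" "g \<in> poly_ring n"
    and "\<And>\<mu>. \<mu> \<in> compositions n \<Longrightarrow> jcoef n f \<mu> = jcoef n g \<mu>"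
  shows "f = g"
proof -
  define h where "h = mconst (-1) * g"
  have h: "h \<in> poly_ring n" using assms unfolding h_def by (intro poly_ring_mconst)
  have "jcoef n h \<mu> = - jcoef n g \<mu>" for \<mu> using jcoef_mconst[OF n assms(3), of "-1"] by (simp only: h_def)
  then have "f + h = 0"
    by (intro jcoef_eq_0[OF n poly_ring_add[OF assms(2) h]])
      (simp add: jcoef_add[OF n assms(2) h] assms(4))
  then show ?thesis by (simp add: h_def mconst_minus)
qed

lemma jackE_0:
  assumes "1 \<le> n"
  shows "jackE n 0 = 1"
proof -
  have "1 \<in> poly_ring n" by (auto simp: poly_ring_iff lookup_one when_def)
  from eig_eq_jackE[OF assms zero_compositions this eig_one] show ?thesis by simp
qed

text \<open>Since \<open>E\<^sub>0 = 1\<close>, this is the case \<open>\<eta> = 0\<close> of the expansion of \<open>linform n k * E\<^sub>\<eta>\<close>.\<close>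

lemma jackE_unit_comp:
  assumes n: "1 \<le> n" and k: "k \<in> {1..n}"
  shows "mconst (\<alpha> + of_nat k) * jackE n (unit_comp k) = linform n k"
proof -
  have u: "unit_comp k \<in> compositions n" using k by simp
  have one: "1 \<in> poly_ring n" by (auto simp: poly_ring_iff lookup_one when_def)
  have lf: "linform n k \<in> poly_ring n" using poly_ring_linform_times[OF k one] by simp
  have other: "jcoef n (linform n k) \<mu> = 0" if \<mu>: "\<mu> \<in> compositions n" "\<mu> \<noteq> unit_comp k" for \<mu>
  proof (rule ccontr)
    assume "jcoef n (linform n k) \<mu> \<noteq> 0"
    then have *: "bracket n k 0 \<mu> \<noteq> 0" "pieri_e1 n 0 \<mu> \<noteq> 0"
      using jcoef_linform[OF n k zero_compositions \<mu>(1)] alpha_nonzero by (auto simp: jackE_0[OF n])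
    have "\<exists>j\<in>{1..n}. spectral n \<mu> j \<noteq> spectral n 0 j"
    proof (rule ccontr)
      assume "\<not> ?thesis"
      then have "bracket n k 0 \<mu> = 0" using k by (simp add: bracket_def)
      then show False using *(1) by blast
    qed
    then obtain L where L: "L \<subseteq> {1..n}" "L \<noteq> {}" "\<mu> = cycle_op L 0"
      using jcoef_mvar_nonzero_iff[OF n _ zero_compositions \<mu>(1)] *(2) by blast
    have fin: "finite L" using L(1) finite_subset by blast
    \<comment> \<open>For \<eta> = 0 the gained value b is 1 or 0, and in both cases the
      accompanying condition on entries holds. So a bracket can be nonzero only through a change at
      k.\<close>
    have "part \<mu> k \<noteq> 0"
      using bracket_eq_0_iff[OF L(1,2) k L(3)] *(1) by (auto simp: nxt_def split: if_splits)
    \<comment> \<open>The only nonzero value that c_L can produce from 0 is the 1 placed at the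
      greatest element of L.\<close>
    then have kL: "k \<in> L" "\<forall>x\<in>L. x \<le> k"
      by (auto simp: L(3) part_cycle_op_nxt fin nxt_def split: if_splits)
    have "\<mu> = unit_comp k"
    proof (rule poly_mapping_eqI)
      fix i
      have "(\<forall>x\<in>L. x \<le> i) \<longleftrightarrow> i = k" if "i \<in> L" using that kL by (auto intro: antisym)
      then show "part \<mu> i = part (unit_comp k) i"
        using kL by (auto simp: L(3) part_cycle_op_nxt fin nxt_def part_unit_comp)
    qed
    then show False using \<mu>(2) by blast
  qed
  let ?c = "jcoef n (linform n k) (unit_comp k)"
  have eq: "linform n k = mconst ?c * jackE n (unit_comp k)"
  proof (rule jcoef_eqI[OF n lf])
    show "mconst ?c * jackE n (unit_comp k) \<in> poly_ring n"
      using poly_ring_jackE[OF n u] by (rule poly_ring_mconst)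
    show "jcoef n (linform n k) \<mu> = jcoef n (mconst ?c * jackE n (unit_comp k)) \<mu>"
      if "\<mu> \<in> compositions n" for \<mu>
      using other[OF that] n that u by (simp add: jcoef_mconst poly_ring_jackE jcoef_jackE)
  qed
  have "mcoeff (linform n k) (unit_comp k) = \<alpha> + of_nat k"
    by (auto simp: linform_def lookup_add lookup_sum mcoeff_mconst_times mvar_def lookup_single
        when_def intro!: sum.neutral)
  then have "?c = \<alpha> + of_nat k"
    using arg_cong[OF eq, of "\<lambda>f. mcoeff f (unit_comp k)"] mcoeff_jackE[OF n u]
    by (simp add: mcoeff_mconst_times)
  then show ?thesis using eq by simp
qed

section \<open>Integral and dual normalisation\<close>

lemma hook_prod_nonzero: "hook_prod n \<gamma> \<noteq> 0"
proof -
  have "hook n \<gamma> s \<noteq> 0" for s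
    using alpha_linear_nonzero[of "arm \<gamma> s" "leg n \<gamma> s + 1"] by (simp add: hook_def add.assoc)
  moreover have "finite (diagram n \<gamma>)" by (simp add: diagram_def)
  ultimately show ?thesis by (simp add: hook_prod_def)
qed

lemma hook'_prod_nonzero: "hook'_prod n \<gamma> \<noteq> 0"
proof -
  have "hook' n \<gamma> s \<noteq> 0" for s
    using alpha_linear_nonzero[of "arm \<gamma> s" "leg n \<gamma> s"] by (simp add: hook'_def hook_def)
  moreover have "finite (diagram n \<gamma>)" by (simp add: diagram_def)
  ultimately show ?thesis by (simp add: hook'_prod_def)
qed

lemma jackF_dual_jackE: "jackF_dual n \<mu> = mconst (inverse (hook'_prod n \<mu>)) * jackE n \<mu>"
proof -
  have eq: "inverse (hook_prod n \<mu> * hook'_prod n \<mu>) * hook_prod n \<mu> = inverse (hook'_prod n \<mu>)"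
    using hook_prod_nonzero[of n \<mu>] by (simp add: field_simps)
  show ?thesis
    unfolding jackF_dual_def jackF_def mult.assoc[symmetric] mconst_mult[symmetric] by (simp only: eq)
qed

lemma finite_jcoef_support:
  assumes n: "1 \<le> n"
  shows "finite {\<mu> \<in> compositions n. jcoef n f \<mu> \<noteq> 0}"
proof -
  let ?B = "jackE n ` compositions n"
  have "finite {b. mp.representation ?B f b \<noteq> 0}" by (rule mp.finite_representation)
  moreover have "jackE n ` {\<mu> \<in> compositions n. jcoef n f \<mu> \<noteq> 0} \<subseteq> {b. mp.representation ?B f b \<noteq> 0}"
    by (auto simp: jcoef_def)
  ultimately have "finite (jackE n ` {\<mu> \<in> compositions n. jcoef n f \<mu> \<noteq> 0})" by (rule finite_subset[rotated])
  moreover have "inj_on (jackE n) {\<mu> \<in> compositions n. jcoef n f \<mu> \<noteq> 0}"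
    using jackE_inj_on[OF n] by (rule inj_on_subset) auto
  ultimately show ?thesis by (rule finite_imageD)
qed

lemma jackF_dual_expansion_iff:
  assumes n: "1 \<le> n" and f: "f \<in> poly_ring n" and g: "Poly_Mapping.keys g \<subseteq> compositions n"
  shows "f = (\<Sum>\<mu>\<in>Poly_Mapping.keys g. mconst (Poly_Mapping.lookup g \<mu>) * jackF_dual n \<mu>)
    \<longleftrightarrow> (\<forall>\<mu>\<in>compositions n. Poly_Mapping.lookup g \<mu> = hook'_prod n \<mu> * jcoef n f \<mu>)"
proof -
  let ?h = "\<Sum>\<mu>\<in>Poly_Mapping.keys g. mconst (Poly_Mapping.lookup g \<mu>) * jackF_dual n \<mu>"
  have mem: "mconst c * jackF_dual n \<mu> \<in> poly_ring n" if "\<mu> \<in> Poly_Mapping.keys g" for \<mu> c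
    using that g n unfolding jackF_dual_jackE by (intro poly_ring_mconst poly_ring_jackE) auto
  have h: "?h \<in> poly_ring n" using mem by (intro poly_ring_sum)
  have coef: "jcoef n ?h \<nu> = Poly_Mapping.lookup g \<nu> * inverse (hook'_prod n \<nu>)" if "\<nu> \<in> compositions n" for \<nu>
  proof -
    have "jcoef n ?h \<nu> = (\<Sum>\<mu>\<in>Poly_Mapping.keys g.
        jcoef n (mconst (Poly_Mapping.lookup g \<mu>) * jackF_dual n \<mu>) \<nu>)"
      using n mem by (intro jcoef_sum)
    also have "\<dots> = (\<Sum>\<mu>\<in>Poly_Mapping.keys g.
        if \<mu> = \<nu> then Poly_Mapping.lookup g \<nu> * inverse (hook'_prod n \<nu>) else 0)"
      using g n that
      by (intro sum.cong refl) (auto simp: jackF_dual_jackE jcoef_mconst poly_ring_jackE jcoef_jackE subset_eq)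
    also have "\<dots> = Poly_Mapping.lookup g \<nu> * inverse (hook'_prod n \<nu>)"
      by (auto simp: sum.delta in_keys_iff)
    finally show ?thesis .
  qed
  have "f = ?h \<longleftrightarrow> (\<forall>\<mu>\<in>compositions n. jcoef n f \<mu> = jcoef n ?h \<mu>)"
    using jcoef_eqI[OF n f h] by auto
  also have "\<dots> \<longleftrightarrow> (\<forall>\<mu>\<in>compositions n. Poly_Mapping.lookup g \<mu> = hook'_prod n \<mu> * jcoef n f \<mu>)"
  proof -
    have "x = y * inverse d \<longleftrightarrow> y = d * x" if "d \<noteq> 0" for x y d :: ratfun
      using that by (auto simp: field_simps)
    from this[OF hook'_prod_nonzero] show ?thesis
      by (intro ball_cong refl) (simp only: coef)
  qed
  finally show ?thesis .
qed

lemma pieri_coeff_eq: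
  assumes n: "1 \<le> n" and f: "jackF n (unit_comp k) * jackF n \<eta> \<in> poly_ring n" and \<mu>: "\<mu> \<in> compositions n"
  shows "pieri_coeff n k \<eta> \<mu> = hook'_prod n \<mu> * jcoef n (jackF n (unit_comp k) * jackF n \<eta>) \<mu>"
proof -
  let ?f = "jackF n (unit_comp k) * jackF n \<eta>"
  \<comment> \<open>Outside the compositions \<open>jackE\<close> is an unsatisfiable description;
    the value is set to 0 there, as the condition on the keys demands.\<close>
  define g where "g = Abs_poly_mapping (\<lambda>\<mu>. if \<mu> \<in> compositions n then hook'_prod n \<mu> * jcoef n ?f \<mu> else 0)"
  have "finite {\<mu>. (if \<mu> \<in> compositions n then hook'_prod n \<mu> * jcoef n ?f \<mu> else 0) \<noteq> 0}"
    using finite_jcoef_support[OF n, of ?f] by (rule finite_subset[rotated]) auto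
  then have g: "Poly_Mapping.lookup g \<mu> = (if \<mu> \<in> compositions n then hook'_prod n \<mu> * jcoef n ?f \<mu> else 0)" for \<mu>
    unfolding g_def by (subst lookup_Abs_poly_mapping) auto
  have keys: "Poly_Mapping.keys g \<subseteq> compositions n" by (auto simp: in_keys_iff g split: if_splits)
  have "pieri_coeffs n k \<eta> = g"
    unfolding pieri_coeffs_def
  proof (rule the_equality)
    show "Poly_Mapping.keys g \<subseteq> compositions n
        \<and> ?f = (\<Sum>\<mu>\<in>Poly_Mapping.keys g. mconst (Poly_Mapping.lookup g \<mu>) * jackF_dual n \<mu>)"
      using keys jackF_dual_expansion_iff[OF n f keys] g by auto
    fix h assume h: "Poly_Mapping.keys h \<subseteq> compositions n
        \<and> ?f = (\<Sum>\<mu>\<in>Poly_Mapping.keys h. mconst (Poly_Mapping.lookup h \<mu>) * jackF_dual n \<mu>)"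
    then have "\<forall>\<mu>\<in>compositions n. Poly_Mapping.lookup h \<mu> = hook'_prod n \<mu> * jcoef n ?f \<mu>"
      using jackF_dual_expansion_iff[OF n f, of h] by blast
    then show "h = g"
      using h by (intro poly_mapping_eqI) (auto simp: g in_keys_iff)
  qed
  then show ?thesis using g \<mu> by (simp add: pieri_coeff_def)
qed

theorem theorem1p1:
  fixes n k :: nat and \<eta> \<mu> :: comp and S :: "nat set"
  assumes "n \<ge> 1"
    and "\<eta> \<in> compositions n" and "\<mu> \<in> compositions n"
    and "1 \<le> k" and "k \<le> n"
    and "csize n \<mu> = csize n \<eta> + 1"
    and S: "S = {i \<in> {1..n}. part \<eta> i \<noteq> part \<mu> i}"
  shows "pieri_coeff n k \<eta> \<mu> \<noteq> 0 \<longleftrightarrow>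
    \<mu> = cycle_op S \<eta>
    \<and> (Max S \<ge> k \<or> (\<exists>i\<in>{k..n}. part \<eta> i = part \<eta> (Min S) + 1))
    \<and> ((\<forall>i\<in>{1..k}. part \<eta> i = part \<eta> (Min S)) \<longrightarrow> Min S \<le> k)"
proof -
  have k: "k \<in> {1..n}" using assms by simp
  have ne: "\<eta> \<noteq> \<mu>" using assms(6) by auto
  \<comment> \<open>This gives \<open>Min S\<close> and \<open>Max S\<close> their meaning.\<close>
  then have S_ne: "S \<noteq> {}" using compositions_eqI[OF assms(2,3)] S by blast
  \<comment> \<open>The number \<alpha> + k is the hook of the single box of \<epsilon>_k. Only its
    nonvanishing enters here, so the quotient is kept as it is.\<close>
  let ?c = "hook_prod n (unit_comp k) * hook_prod n \<eta> * inverse (\<alpha> + of_nat k)"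
  have ak: "\<alpha> + of_nat k \<noteq> 0" using alpha_linear_nonzero[of 0 k] by simp
  have E: "linform n k * jackE n \<eta> \<in> poly_ring n"
    using k assms by (intro poly_ring_linform_times poly_ring_jackE)
  have "jackF n (unit_comp k) * jackF n \<eta> = mconst ?c * (linform n k * jackE n \<eta>)"
  proof -
    have "mconst ?c * (linform n k * jackE n \<eta>)
      = (mconst (hook_prod n (unit_comp k)) * jackE n (unit_comp k)) * (mconst (hook_prod n \<eta>) * jackE n \<eta>)
        * (mconst (inverse (\<alpha> + of_nat k)) * mconst (\<alpha> + of_nat k))"
      unfolding jackE_unit_comp[OF assms(1) k, symmetric] mconst_mult by (simp only: mult_ac)
    also have "mconst (inverse (\<alpha> + of_nat k)) * mconst (\<alpha> + of_nat k) = 1"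
      using ak by (simp flip: mconst_mult)
    finally show ?thesis by (simp only: jackF_def mult_1_right)
  qed
  then have "pieri_coeff n k \<eta> \<mu> = hook'_prod n \<mu> * (?c * jcoef n (linform n k * jackE n \<eta>) \<mu>)"
    using pieri_coeff_eq[OF assms(1) _ assms(3), of k \<eta>] E assms(1)
    by (simp only: poly_ring_mconst jcoef_mconst simp_thms)
  then have "pieri_coeff n k \<eta> \<mu> \<noteq> 0 \<longleftrightarrow> jcoef n (linform n k * jackE n \<eta>) \<mu> \<noteq> 0"
    using hook_prod_nonzero hook'_prod_nonzero ak by simp
  also have "\<dots> \<longleftrightarrow> pieri_e1 n \<eta> \<mu> \<noteq> 0 \<and> bracket n k \<eta> \<mu> \<noteq> 0"
    using jcoef_linform[OF assms(1) k assms(2,3)] alpha_nonzero by auto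
  also have "\<dots> \<longleftrightarrow> \<mu> = cycle_op S \<eta> \<and> bracket n k \<eta> \<mu> \<noteq> 0"
    using pieri_e1_nonzero_iff[OF assms(1-3) ne] by (simp only: S)
  also have "\<dots> \<longleftrightarrow> \<mu> = cycle_op S \<eta>
    \<and> (Max S \<ge> k \<or> (\<exists>i\<in>{k..n}. part \<eta> i = part \<eta> (Min S) + 1))
    \<and> ((\<forall>i\<in>{1..k}. part \<eta> i = part \<eta> (Min S)) \<longrightarrow> Min S \<le> k)"
    using bracket_support[OF k S S_ne] by (intro conj_cong refl)
  finally show ?thesis .
qed

end
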